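(* Let $u_0\in C_\psi$ be such that $\mathcal{E}(u_0)<\frac{c_0^2}{4}$. Let $u$ be an FVI gradient flow starting at $u_0$ which is obtained as a minimizing movement limit. Then for each $T>0$ one has $$\mathcal{E}(u(T))+\frac12\int_0^T\|\dot u(t)\|_{L^2}^2\,dt\le\mathcal{E}(u_0).$$
   Context: The elastic energy is $\mathcal{E}: W^{2,2}(0,1)\cap W_0^{1,2}(0,1)\to\mathbb{R}$, $\mathcal{E}(u)=\int_0^1 \frac{u''(x)^2}{(1+u'(x)^2)^{5/2}}\,dx$, where $W^{2,2}(0,1)\cap W_0^{1,2}(0,1)$ carries the norm $\|u\|=\|u''\|_{L^2}$; $D\mathcal{E}$ denotes its Fréchet derivative. Set $c_0=\int_{\mathbb{R}}(1+t^2)^{-5/4}\,dt$. Standing assumption on the obstacle: $\psi\in C([0,1])$, $\psi(0)<0$, $\psi(1)<0$, and there is $x_0\in(0,1)$ with $\psi(x_0)>0$. Set $C_\psi=\{u\in W^{2,2}(0,1)\cap W_0^{1,2}(0,1): u\ge\psi \text{ a.e.}\}$. For a Banach space $V$, $D^{1,2}((0,\infty),V)=\{u\in W^{1,1}_{loc}((0,\infty),V): \dot u\in L^2((0,\infty),V)\}$, where $\dot u$ is the weak time derivative. $(\cdot,\cdot)$ is the scalar product of $L^2(0,1)$. For $u_0\in C_\psi$, a function $u\in L^\infty((0,\infty),W^{2,2}(0,1)\cap W_0^{1,2}(0,1))\cap D^{1,2}((0,\infty),L^2(0,1))$ is an FVI gradient flow (for $\mathcal{E}$, in $C_\psi$)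 starting at $u_0$ if: (i) $u(t)\in C_\psi$ for a.e. $t>0$; (ii) $t\mapsto\mathcal{E}(u(t))$ coincides a.e. with a nonincreasing function $\phi:[0,\infty)\to\mathbb{R}$ with $\phi(0)=\mathcal{E}(u_0)$; (iii) the unique $C([0,\infty),L^2(0,1))$-representative of $u$ satisfies $u(0)=u_0$; (iv) for a.e. $t>0$: $(\dot u(t),v-u(t))+D\mathcal{E}(u(t))(v-u(t))\ge0$ for all $v\in C_\psi$. Such a $u$ has a unique representative in $C([0,\infty),C^1([0,1]))$, with which it is always identified. Minimizing movements: for $\tau>0$ set $u_{0\tau}=u_0$ and choose iteratively, for $k\in\mathbb{N}_0$, $u_{(k+1)\tau}\in\arg\min_{w\in C_\psi}\big(\mathcal{E}(w)+\frac1{2\tau}\|w-u_{k\tau}\|_{L^2}^2\big)$ (minimizers exist when $\mathcal{E}(u_0)<c_0^2/4$). The piecewise linear interpolation is $u^\tau(0)=u_0$, $u^\tau(t)=u_{k\tau}+\frac{t-k\tau}{\tau}(u_{(k+1)\tau}-u_{k\tau})$ for $t\in(k\tau,(k+1)\tau]$. A minimizing movement limit is a function $u\in L^\infty((0,\infty),W^{2,2}(0,1))\cap D^{1,2}((0,\infty),L^2(0,1))$ for which there is a sequence $\tau_n\to0$ such that for every $T>0$, $u^{\tau_n}\to u$ weakly in $W^{1,2}((0,T),L^2(0,1))$ and strongly in $C([0,T],C^1([0,1]))$, and $u^{\tau_n}(t)\rightharpoonup u(t)$ weakly in $W^{2,2}(0,1)$ for every $t>0$. *)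

theory Defs
  imports "HOL-Analysis.Analysis"
begin

section \<open>The Hilbert space $L^2(0,1)$\<close>

definition square_integrable_on ::
    "(real \<Rightarrow> 'b::{real_normed_vector, second_countable_topology}) \<Rightarrow> real set \<Rightarrow> bool"
    (infix "square'_integrable'_on" 50) where
  "f square_integrable_on S \<longleftrightarrow>
     f \<in> borel_measurable (lebesgue_on S) \<and> integrable (lebesgue_on S) (\<lambda>t. (norm (f t))\<^sup>2)"

lemma square_integrable_mult:
  fixes f g :: "real \<Rightarrow> real"
  assumes "f square_integrable_on S" "g square_integrable_on S"
  shows "integrable (lebesgue_on S) (\<lambda>x. f x * g x)"
proof (rule Bochner_Integration.integrable_bound)
  show "integrable (lebesgue_on S) (\<lambda>x. (norm (f x))\<^sup>2 + (norm (g x))\<^sup>2)"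
    using assms by (auto simp: square_integrable_on_def)
  show "(\<lambda>x. f x * g x) \<in> borel_measurable (lebesgue_on S)"
    using assms by (auto simp: square_integrable_on_def)
  have "\<bar>a * b\<bar> \<le> a\<^sup>2 + b\<^sup>2" for a b :: real
    using sum_squares_bound[of "\<bar>a\<bar>" "\<bar>b\<bar>"] abs_ge_zero[of "a * b"]
    unfolding power2_abs abs_mult by linarith
  then show "AE x in lebesgue_on S. norm (f x * g x) \<le> norm ((norm (f x))\<^sup>2 + (norm (g x))\<^sup>2)"
    by (auto simp: abs_of_nonneg)
qed

lemma square_integrable_add:
  fixes f g :: "real \<Rightarrow> real"
  assumes "f square_integrable_on S" "g square_integrable_on S"
  shows "(\<lambda>x. f x + g x) square_integrable_on S"
  using assms square_integrable_mult[OF assms]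
  by (auto simp: square_integrable_on_def power2_sum mult.assoc)

lemma square_integrable_scale:
  fixes f :: "real \<Rightarrow> real"
  assumes "f square_integrable_on S"
  shows "(\<lambda>x. c * f x) square_integrable_on S"
  using assms by (auto simp: square_integrable_on_def power_mult_distrib abs_mult)

quotient_type L2 = "real \<Rightarrow> real" / partial:
  "\<lambda>f g. f square_integrable_on {0<..<1} \<and> g square_integrable_on {0<..<1} \<and>
         (AE x in lebesgue_on {0<..<1}. f x = g x)"
proof (rule part_equivpI)
  show "\<exists>f::real \<Rightarrow> real. f square_integrable_on {0<..<1} \<and> f square_integrable_on {0<..<1} \<and>
         (AE x in lebesgue_on {0<..<1}. f x = f x)"
    by (rule exI[of _ "\<lambda>_. 0"]) (auto simp: square_integrable_on_def)
  show "symp (\<lambda>f g. f square_integrable_on {0<..<1} \<and> g square_integrable_on {0<..<1} \<and>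
         (AE x in lebesgue_on {0<..<1}. f x = (g x :: real)))"
    unfolding symp_def by (simp add: eq_commute)
  show "transp (\<lambda>f g. f square_integrable_on {0<..<1} \<and> g square_integrable_on {0<..<1} \<and>
         (AE x in lebesgue_on {0<..<1}. f x = (g x :: real)))"
  proof (rule transpI, elim conjE, intro conjI)
    fix f g h :: "real \<Rightarrow> real"
    assume "AE x in lebesgue_on {0<..<1}. f x = g x" "AE x in lebesgue_on {0<..<1}. g x = h x"
    then show "AE x in lebesgue_on {0<..<1}. f x = h x" by eventually_elim simp
  qed
qed

lemma rep_L2_square_integrable: "rep_L2 u square_integrable_on {0<..<1}"
  using Quotient_rep_reflp[OF Quotient_L2, of u] by simp

lemma borel_measurable_rep_L2 [measurable]: "rep_L2 u \<in> borel_measurable (lebesgue_on {0<..<1})"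
  using rep_L2_square_integrable by (simp add: square_integrable_on_def)

lemma square_integrable_imp_measurable:
  "f square_integrable_on S \<Longrightarrow> f \<in> borel_measurable (lebesgue_on S)"
  by (simp add: square_integrable_on_def)

lemma rep_abs_L2:
  assumes "f square_integrable_on {0<..<1}"
  shows "AE x in lebesgue_on {0<..<1}. rep_L2 (abs_L2 f) x = f x"
  using assms Quotient_rep_abs[OF Quotient_L2, of f] by auto

lemma L2_eq_iff: "u = v \<longleftrightarrow> (AE x in lebesgue_on {0<..<1}. rep_L2 u x = rep_L2 v x)"
  using Quotient_rel_rep[OF Quotient_L2, of u v] rep_L2_square_integrable by auto

lemma abs_L2_eqI:
  assumes "f square_integrable_on {0<..<1}" "AE x in lebesgue_on {0<..<1}. rep_L2 u x = f x"
  shows "abs_L2 f = u"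
  unfolding L2_eq_iff using rep_abs_L2[OF assms(1)] assms(2) by eventually_elim simp

instantiation L2 :: real_inner
begin

lift_definition zero_L2 :: L2 is "\<lambda>_. 0"
  by (auto simp: square_integrable_on_def)

lift_definition plus_L2 :: "L2 \<Rightarrow> L2 \<Rightarrow> L2" is "\<lambda>f g x. f x + g x"
  by (auto intro: square_integrable_add)

lift_definition uminus_L2 :: "L2 \<Rightarrow> L2" is "\<lambda>f x. - f x"
  using square_integrable_scale[of _ _ "-1"] by auto

lift_definition minus_L2 :: "L2 \<Rightarrow> L2 \<Rightarrow> L2" is "\<lambda>f g x. f x - g x"
  using square_integrable_add[OF _ square_integrable_scale[of _ _ "-1"]] by auto

lift_definition scaleR_L2 :: "real \<Rightarrow> L2 \<Rightarrow> L2" is "\<lambda>c f x. c * f x"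
  using square_integrable_scale by auto

lift_definition inner_L2 :: "L2 \<Rightarrow> L2 \<Rightarrow> real" is
  "\<lambda>f g. LINT x|lebesgue_on {0<..<1}. f x * g x"
proof -
  fix f f' g g' :: "real \<Rightarrow> real"
  assume *: "f square_integrable_on {0<..<1} \<and> f' square_integrable_on {0<..<1} \<and>
      (AE x in lebesgue_on {0<..<1}. f x = f' x)"
    "g square_integrable_on {0<..<1} \<and> g' square_integrable_on {0<..<1} \<and>
      (AE x in lebesgue_on {0<..<1}. g x = g' x)"
  then have "AE x in lebesgue_on {0<..<1}. f x * g x = f' x * g' x"
    by auto
  with * show "(LINT x|lebesgue_on {0<..<1}. f x * g x) = (LINT x|lebesgue_on {0<..<1}. f' x * g' x)"
    by (intro integral_cong_AE) (auto simp: square_integrable_on_def)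
qed

definition norm_L2 :: "L2 \<Rightarrow> real" where "norm_L2 u = sqrt (u \<bullet> u)"
definition sgn_L2 :: "L2 \<Rightarrow> L2" where "sgn_L2 u = inverse (norm u) *\<^sub>R u"
definition dist_L2 :: "L2 \<Rightarrow> L2 \<Rightarrow> real" where "dist_L2 u v = norm (u - v)"
definition uniformity_L2 :: "(L2 \<times> L2) filter" where
  "uniformity_L2 = (INF e\<in>{0<..}. principal {(x, y). dist x y < e})"
definition open_L2 :: "L2 set \<Rightarrow> bool" where
  "open_L2 U \<longleftrightarrow> (\<forall>x\<in>U. \<forall>\<^sub>F (x', y) in uniformity. x' = x \<longrightarrow> y \<in> U)"

instance
proof
  fix a b c :: real and u v w :: L2
  show "u + v + w = u + (v + w)"
    by transfer (auto intro!: square_integrable_add simp: add.assoc)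
  show "u + v = v + u"
    by transfer (auto intro!: square_integrable_add simp: add.commute)
  show "0 + u = u" by transfer auto
  show "- u + u = 0"
    by transfer (auto simp: square_integrable_on_def)
  show "u - v = u + - v"
    by transfer (use square_integrable_add[OF _ square_integrable_scale[of _ _ "-1"]] in auto)
  show "a *\<^sub>R (u + v) = a *\<^sub>R u + a *\<^sub>R v"
    by transfer (auto intro!: square_integrable_add square_integrable_scale simp: distrib_left)
  show "(a + b) *\<^sub>R u = a *\<^sub>R u + b *\<^sub>R u"
    by transfer (auto intro!: square_integrable_add square_integrable_scale simp: distrib_right)
  show "a *\<^sub>R b *\<^sub>R u = (a * b) *\<^sub>R u"
    by transfer (auto intro!: square_integrable_scale simp: mult.assoc)
  show "1 *\<^sub>R u = u" by transfer auto
  show "u \<bullet> v = v \<bullet> u" by transfer (simp add: mult.commute)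
  show "(u + v) \<bullet> w = u \<bullet> w + v \<bullet> w"
    by transfer (simp add: distrib_right square_integrable_mult)
  show "(a *\<^sub>R u) \<bullet> v = a * (u \<bullet> v)"
    by transfer (simp add: mult.assoc)
  show "0 \<le> u \<bullet> u" by transfer simp
  show "u \<bullet> u = 0 \<longleftrightarrow> u = 0"
  proof transfer
    fix f :: "real \<Rightarrow> real"
    assume "f square_integrable_on {0<..<1} \<and> f square_integrable_on {0<..<1} \<and>
      (AE x in lebesgue_on {0<..<1}. f x = f x)"
    then have f: "f square_integrable_on {0<..<1}" by simp
    have "(LINT x|lebesgue_on {0<..<1}. f x * f x) = 0 \<longleftrightarrow>
        (AE x in lebesgue_on {0<..<1}. f x * f x = 0)"
      by (rule integral_nonneg_eq_0_iff_AE) (auto intro: square_integrable_mult f)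
    with f show "(LINT x|lebesgue_on {0<..<1}. f x * f x) = 0 \<longleftrightarrow>
      f square_integrable_on {0<..<1} \<and> (\<lambda>_. 0::real) square_integrable_on {0<..<1} \<and>
      (AE x in lebesgue_on {0<..<1}. f x = 0)"
      by (auto simp: square_integrable_on_def)
  qed
qed (simp_all add: norm_L2_def sgn_L2_def dist_L2_def uniformity_L2_def open_L2_def)

end

lemma rep_L2_plus: "AE x in lebesgue_on {0<..<1}. rep_L2 (u + v) x = rep_L2 u x + rep_L2 v x"
proof -
  have "u + v = abs_L2 (\<lambda>x. rep_L2 u x + rep_L2 v x)"
    using plus_L2.abs_eq[of "rep_L2 u" "rep_L2 v"] 
    by (simp add: rep_L2_square_integrable Quotient_abs_rep[OF Quotient_L2])
  then show ?thesis
    using rep_abs_L2[OF square_integrable_add[OF rep_L2_square_integrable rep_L2_square_integrable]]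
    by simp
qed

lemma rep_L2_minus: "AE x in lebesgue_on {0<..<1}. rep_L2 (u - v) x = rep_L2 u x - rep_L2 v x"
proof -
  have "AE x in lebesgue_on {0<..<1}. rep_L2 u x = rep_L2 (u - v) x + rep_L2 v x"
    using rep_L2_plus[of "u - v" v] by simp
  then show ?thesis by eventually_elim simp
qed

lemma rep_L2_scaleR: "AE x in lebesgue_on {0<..<1}. rep_L2 (c *\<^sub>R u) x = c * rep_L2 u x"
proof -
  have "c *\<^sub>R u = abs_L2 (\<lambda>x. c * rep_L2 u x)"
    using scaleR_L2.abs_eq[of "rep_L2 u" c]
    by (simp add: rep_L2_square_integrable Quotient_abs_rep[OF Quotient_L2])
  then show ?thesis
    using rep_abs_L2[OF square_integrable_scale[OF rep_L2_square_integrable]] by simp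
qed

lemma rep_L2_zero: "AE x in lebesgue_on {0<..<1}. rep_L2 0 x = 0"
  using rep_abs_L2[of "\<lambda>_. 0"] by (simp add: zero_L2_def square_integrable_on_def)

lemma inner_L2_rep: "u \<bullet> v = (LINT x|lebesgue_on {0<..<1}. rep_L2 u x * rep_L2 v x)"
  by (simp add: inner_L2.rep_eq)

lemma norm_L2_rep: "norm u = sqrt (LINT x|lebesgue_on {0<..<1}. (rep_L2 u x)\<^sup>2)"
  by (simp add: norm_eq_sqrt_inner inner_L2_rep power2_eq_square)

lemma inner_abs_L2:
  assumes "f square_integrable_on {0<..<1}"
  shows "abs_L2 f \<bullet> v = (LINT x|lebesgue_on {0<..<1}. f x * rep_L2 v x)"
  unfolding inner_L2_rep
proof -
  have [measurable]: "f \<in> borel_measurable (lebesgue_on {0<..<1})"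
    using assms by (rule square_integrable_imp_measurable)
  show "(LINT x|lebesgue_on {0<..<1}. rep_L2 (abs_L2 f) x * rep_L2 v x) =
    (LINT x|lebesgue_on {0<..<1}. f x * rep_L2 v x)"
  proof (rule integral_cong_AE)
    show "AE x in lebesgue_on {0<..<1}. rep_L2 (abs_L2 f) x * rep_L2 v x = f x * rep_L2 v x"
      using rep_abs_L2[OF assms] by eventually_elim simp
  qed measurable
qed

lemma norm_diff_abs_L2:
  assumes "f square_integrable_on {0<..<1}"
  shows "norm (u - abs_L2 f) = sqrt (LINT x|lebesgue_on {0<..<1}. (rep_L2 u x - f x)\<^sup>2)"
proof -
  have [measurable]: "f \<in> borel_measurable (lebesgue_on {0<..<1})"
    using assms by (rule square_integrable_imp_measurable)
  have "AE x in lebesgue_on {0<..<1}. (rep_L2 (u - abs_L2 f) x)\<^sup>2 = (rep_L2 u x - f x)\<^sup>2"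
    using rep_abs_L2[OF assms] rep_L2_minus[of u "abs_L2 f"] by eventually_elim simp
  then have "(LINT x|lebesgue_on {0<..<1}. (rep_L2 (u - abs_L2 f) x)\<^sup>2) =
      (LINT x|lebesgue_on {0<..<1}. (rep_L2 u x - f x)\<^sup>2)"
    by (rule integral_cong_AE[rotated 2]) measurable
  then show ?thesis by (simp add: norm_L2_rep)
qed

lemma integrable_const_01: "integrable (lebesgue_on {0<..<1::real}) (\<lambda>_. c :: real)"
  by (rule finite_measure.integrable_const[OF finite_measure_lebesgue_on]) simp

lemma square_integrable_const: "(\<lambda>_. c :: real) square_integrable_on {0<..<1}"
  by (auto simp: square_integrable_on_def intro: integrable_const_01)

lemma square_integrable_bound:
  fixes h w :: "real \<Rightarrow> real"
  assumes "w square_integrable_on S" "h \<in> borel_measurable (lebesgue_on S)"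
    "AE x in lebesgue_on S. \<bar>h x\<bar> \<le> w x"
  shows "h square_integrable_on S"
  unfolding square_integrable_on_def
proof
  show "integrable (lebesgue_on S) (\<lambda>t. (norm (h t))\<^sup>2)"
  proof (rule Bochner_Integration.integrable_bound)
    show "integrable (lebesgue_on S) (\<lambda>t. (norm (w t))\<^sup>2)"
      using assms(1) by (simp add: square_integrable_on_def)
    show "AE x in lebesgue_on S. norm ((norm (h x))\<^sup>2) \<le> norm ((norm (w x))\<^sup>2)"
      using assms(3) by eventually_elim (use power_mono[of "\<bar>_\<bar>" _ 2] in fastforce)
    show "(\<lambda>t. (norm (h t))\<^sup>2) \<in> borel_measurable (lebesgue_on S)"
      using assms(2) by measurable
  qed
qed fact

lemma L2_dominated_convergence:
  fixes h :: "real \<Rightarrow> real"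
  assumes w: "w square_integrable_on {0<..<1}"
    and h_n: "\<And>n. h_n n \<in> borel_measurable (lebesgue_on {0<..<1})"
      "\<And>n. AE x in lebesgue_on {0<..<1}. \<bar>h_n n x\<bar> \<le> w x"
    and h: "h \<in> borel_measurable (lebesgue_on {0<..<1})"
      "AE x in lebesgue_on {0<..<1}. (\<lambda>n. h_n n x) \<longlonglongrightarrow> h x"
  shows "(\<lambda>n. abs_L2 (h_n n)) \<longlonglongrightarrow> abs_L2 h"
proof -
  note [measurable] = h_n(1) h(1)
  have "AE x in lebesgue_on {0<..<1}. \<forall>n. \<bar>h_n n x\<bar> \<le> w x"
    using h_n(2) by (simp add: AE_all_countable)
  with h(2) have hw: "AE x in lebesgue_on {0<..<1}. \<bar>h x\<bar> \<le> w x"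
  proof eventually_elim
    case (elim x)
    have "(\<lambda>n. \<bar>h_n n x\<bar>) \<longlonglongrightarrow> \<bar>h x\<bar>"
      using elim(1) by (rule tendsto_rabs)
    then show ?case
      by (rule LIMSEQ_le_const2) (use elim in auto)
  qed
  have sq: "h square_integrable_on {0<..<1}" "h_n n square_integrable_on {0<..<1}" for n
    using square_integrable_bound[OF w] hw h_n h(1) by auto
  have "(\<lambda>n. LINT x|lebesgue_on {0<..<1}. (rep_L2 (abs_L2 h) x - h_n n x)\<^sup>2) \<longlonglongrightarrow>
      (LINT x|lebesgue_on {0<..<1::real}. 0)"
  proof (rule integral_dominated_convergence)
    show "integrable (lebesgue_on {0<..<1}) (\<lambda>x. 4 * (w x)\<^sup>2)"
      using w by (auto simp: square_integrable_on_def)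
    show "AE x in lebesgue_on {0<..<1}.
        (\<lambda>n. (rep_L2 (abs_L2 h) x - h_n n x)\<^sup>2) \<longlonglongrightarrow> 0"
      using h(2) rep_abs_L2[OF sq(1)]
    proof eventually_elim
      case (elim x)
      have "(\<lambda>n. (h x - h_n n x)\<^sup>2) \<longlonglongrightarrow> (h x - h x)\<^sup>2"
        by (intro tendsto_intros elim)
      then show ?case using elim by simp
    qed
    show "AE x in lebesgue_on {0<..<1}.
        norm ((rep_L2 (abs_L2 h) x - h_n n x)\<^sup>2) \<le> 4 * (w x)\<^sup>2" for n
      using hw h_n(2)[of n] rep_abs_L2[OF sq(1)]
    proof eventually_elim
      case (elim x)
      then have "\<bar>h x - h_n n x\<bar> \<le> 2 * w x" by linarith
      then have "\<bar>h x - h_n n x\<bar>\<^sup>2 \<le> (2 * w x)\<^sup>2" by (rule power_mono) simp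
      then show ?case using elim by (simp add: power_mult_distrib)
    qed
  qed measurable
  then have "(\<lambda>n. sqrt (LINT x|lebesgue_on {0<..<1}. (rep_L2 (abs_L2 h) x - h_n n x)\<^sup>2)) \<longlonglongrightarrow>
      sqrt 0"
    by (intro tendsto_real_sqrt) simp
  then have "(\<lambda>n. norm (abs_L2 h - abs_L2 (h_n n))) \<longlonglongrightarrow> 0"
    by (simp add: norm_diff_abs_L2[OF sq(2)])
  then show ?thesis
    by (simp add: LIMSEQ_iff dist_norm norm_minus_commute)
qed

lemma L2_complete:
  fixes X :: "nat \<Rightarrow> L2"
  assumes "Cauchy X"
  shows "convergent X"
proof -
  let ?M = "lebesgue_on {0<..<1::real}"
  have sp: "emeasure ?M (space ?M) = 1"
    by (simp add: emeasure_restrict_space)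
  have "\<exists>N. \<forall>m\<ge>N. \<forall>n\<ge>N. norm (X m - X n) < (1/2)^k" for k
    using CauchyD[OF assms, of "(1/2)^k"] by auto
  then obtain N where N: "\<And>k m n. m \<ge> N k \<Longrightarrow> n \<ge> N k \<Longrightarrow> norm (X m - X n) < (1/2)^k"
    by metis
  define r where "r = rec_nat (N 0) (\<lambda>k s. max (Suc s) (N (Suc k)))"
  have r_Suc: "r (Suc k) = max (Suc (r k)) (N (Suc k))" for k by (simp add: r_def)
  have rN: "r k \<ge> N k" for k by (cases k) (auto simp: r_def)
  have r: "strict_mono r" by (rule strict_monoI_Suc) (simp add: r_Suc)
  define f where "f = (\<lambda>k. rep_L2 (X (r k)))"
  have f[measurable]: "f k \<in> borel_measurable ?M" for k by (simp add: f_def)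
  have fsq: "f k square_integrable_on {0<..<1}" for k
    by (simp add: f_def rep_L2_square_integrable)
  have diff_sq: "(\<lambda>x. f k x - f l x) square_integrable_on {0<..<1}" for k l
    using square_integrable_add[OF fsq square_integrable_scale[OF fsq, where c="-1"]] by simp
  have norm_f: "(LINT x|?M. (f k x - f l x)\<^sup>2) = (norm (X (r k) - X (r l)))\<^sup>2" for k l
  proof -
    have "abs_L2 (f l) = X (r l)" by (rule abs_L2_eqI[OF fsq]) (simp add: f_def)
    then have "norm (X (r k) - X (r l)) = sqrt (LINT x|?M. (f k x - f l x)\<^sup>2)"
      using norm_diff_abs_L2[OF fsq, of "X (r k)" l] by (simp add: f_def)
    then show ?thesis by simp
  qed
  have diff1: "(\<integral>\<^sup>+x. ennreal \<bar>f (Suc k) x - f k x\<bar> \<partial>?M) \<le> ennreal ((1/2)^k)" for k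
  proof -
    let ?c = "(1/2::real)^k"
    let ?d = "\<lambda>x. f (Suc k) x - f k x"
    have int: "integrable ?M (\<lambda>x. (?c + (?d x)\<^sup>2 / ?c) / 2)"
      using diff_sq[of "Suc k" k] integrable_const_01[of ?c]
      by (simp add: square_integrable_on_def)
    have "\<bar>?d x\<bar> \<le> (?c + (?d x)\<^sup>2 / ?c) / 2" for x
    proof -
      have "2 * ?c * \<bar>?d x\<bar> \<le> ?c\<^sup>2 + (?d x)\<^sup>2"
        using sum_squares_bound[of ?c "\<bar>?d x\<bar>"] by simp
      then show ?thesis by (simp add: field_simps power2_eq_square)
    qed
    then have "(\<integral>\<^sup>+x. ennreal \<bar>?d x\<bar> \<partial>?M) \<le> (\<integral>\<^sup>+x. ennreal ((?c + (?d x)\<^sup>2 / ?c) / 2) \<partial>?M)"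
      by (intro nn_integral_mono ennreal_leI) auto
    also have "\<dots> = ennreal (LINT x|?M. (?c + (?d x)\<^sup>2 / ?c) / 2)"
      by (rule nn_integral_eq_integral[OF int]) auto
    also have "(LINT x|?M. (?c + (?d x)\<^sup>2 / ?c) / 2) = (?c + (norm (X (r (Suc k)) - X (r k)))\<^sup>2 / ?c) / 2"
    proof -
      have "(LINT x|?M. ?c + (?d x)\<^sup>2 / ?c) = (LINT x|?M. ?c) + (LINT x|?M. (?d x)\<^sup>2 / ?c)"
        using diff_sq[of "Suc k" k] integrable_const_01[of ?c]
        by (intro Bochner_Integration.integral_add) (simp_all add: square_integrable_on_def)
      moreover have "(LINT x|?M. ?c) = ?c"
        using sp by (simp add: measure_def)
      ultimately show ?thesis by (simp add: norm_f)
    qed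
    also have "\<dots> \<le> ?c"
    proof -
      have "norm (X (r (Suc k)) - X (r k)) \<le> ?c"
        using N[of k "r (Suc k)" "r k"] rN[of k] strict_mono_less_eq[OF r, of k "Suc k"] by auto
      then have "(norm (X (r (Suc k)) - X (r k)))\<^sup>2 \<le> ?c\<^sup>2" by (rule power_mono) simp
      then show ?thesis by (simp add: field_simps power2_eq_square)
    qed
    finally show ?thesis by (simp add: ennreal_leI)
  qed
  have "(\<integral>\<^sup>+x. (\<Sum>k. ennreal \<bar>f (Suc k) x - f k x\<bar>) \<partial>?M) =
      (\<Sum>k. \<integral>\<^sup>+x. ennreal \<bar>f (Suc k) x - f k x\<bar> \<partial>?M)"
    by (rule nn_integral_suminf) measurable
  also have "\<dots> \<le> (\<Sum>k. ennreal ((1/2)^k))"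
    by (intro suminf_le diff1 summableI)
  also have "\<dots> = ennreal (\<Sum>k. (1/2)^k)"
    by (intro suminf_ennreal2) auto
  finally have "(\<integral>\<^sup>+x. (\<Sum>k. ennreal \<bar>f (Suc k) x - f k x\<bar>) \<partial>?M) \<noteq> \<infinity>"
    by (metis ennreal_neq_top infinity_ennreal_def top.extremum_unique)
  then have "AE x in ?M. (\<Sum>k. ennreal \<bar>f (Suc k) x - f k x\<bar>) \<noteq> \<infinity>"
    by (intro nn_integral_noteq_infinite) measurable
  then have conv: "AE x in ?M. (\<lambda>k. f k x) \<longlonglongrightarrow> lim (\<lambda>k. f k x)"
  proof eventually_elim
    case (elim x)
    then have "summable (\<lambda>k. \<bar>f (Suc k) x - f k x\<bar>)"
      by (intro summable_suminf_not_top) auto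
    then have "summable (\<lambda>k. f (Suc k) x - f k x)" by (rule summable_rabs_cancel)
    then have "convergent (\<lambda>n. \<Sum>k<n. f (Suc k) x - f k x)"
      by (simp add: summable_iff_convergent)
    then have "convergent (\<lambda>n. f n x - f 0 x)"
      by (simp only: sum_lessThan_telescope[of "\<lambda>k. f k x"])
    then have "convergent (\<lambda>n. f n x)"
      using convergent_diff_const_right_iff[of "\<lambda>n. f n x" "f 0 x"] by simp
    then show ?case by (simp add: convergent_LIMSEQ_iff)
  qed
  define F where "F = (\<lambda>x. lim (\<lambda>k. f k x))"
  have F[measurable]: "F \<in> borel_measurable ?M"
    unfolding F_def by (rule borel_measurable_lim_metric) measurable
  have close: "(\<integral>\<^sup>+x. ennreal ((F x - f n x)\<^sup>2) \<partial>?M) \<le> ennreal (((1/2)^n)\<^sup>2)" for n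
  proof -
    have "(\<integral>\<^sup>+x. ennreal ((F x - f n x)\<^sup>2) \<partial>?M) =
        (\<integral>\<^sup>+x. liminf (\<lambda>m. ennreal ((f m x - f n x)\<^sup>2)) \<partial>?M)"
      using conv
    proof (intro nn_integral_cong_AE, eventually_elim)
      case (elim x)
      have "(\<lambda>m. ennreal ((f m x - f n x)\<^sup>2)) \<longlonglongrightarrow> ennreal ((F x - f n x)\<^sup>2)"
        using elim unfolding F_def by (intro tendsto_intros)
      then show ?case
        by (rule lim_imp_Liminf[symmetric, rotated]) simp
    qed
    also have "\<dots> \<le> liminf (\<lambda>m. \<integral>\<^sup>+x. ennreal ((f m x - f n x)\<^sup>2) \<partial>?M)"
      by (rule nn_integral_liminf) measurable
    also have "\<dots> \<le> ennreal (((1/2)^n)\<^sup>2)"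
    proof (rule Liminf_le)
      have "(\<integral>\<^sup>+x. ennreal ((f m x - f n x)\<^sup>2) \<partial>?M) \<le> ennreal (((1/2)^n)\<^sup>2)" if "m \<ge> n" for m
      proof -
        have "(\<integral>\<^sup>+x. ennreal ((f m x - f n x)\<^sup>2) \<partial>?M) = ennreal (LINT x|?M. (f m x - f n x)\<^sup>2)"
          using diff_sq[of m n]
          by (intro nn_integral_eq_integral) (auto simp: square_integrable_on_def)
        also have "(LINT x|?M. (f m x - f n x)\<^sup>2) \<le> ((1/2)^n)\<^sup>2"
          unfolding norm_f
          using N[of n "r m" "r n"] rN[of n] strict_mono_less_eq[OF r, of n m] that
          by (intro power_mono) auto
        finally show ?thesis by (simp add: ennreal_leI)
      qed
      then show "\<forall>\<^sub>F m in sequentially.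
          (\<integral>\<^sup>+x. ennreal ((f m x - f n x)\<^sup>2) \<partial>?M) \<le> ennreal (((1/2)^n)\<^sup>2)"
        by (auto simp: eventually_sequentially)
    qed simp
    finally show ?thesis .
  qed
  have dsq: "(\<lambda>x. F x - f n x) square_integrable_on {0<..<1}" for n
    unfolding square_integrable_on_def
  proof
    show "integrable ?M (\<lambda>x. (norm (F x - f n x))\<^sup>2)"
      using close[of n] by (intro integrableI_bounded) (auto simp: less_top[symmetric] top_unique)
  qed measurable
  have Fsq: "F square_integrable_on {0<..<1}"
    using square_integrable_add[OF dsq[of 0] fsq[of 0]] by simp
  have "norm (X (r n) - abs_L2 F) \<le> (1/2)^n" for n
  proof -
    have "ennreal (LINT x|?M. (F x - f n x)\<^sup>2) \<le> ennreal (((1/2)^n)\<^sup>2)"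
      using close[of n] dsq[of n]
      by (subst nn_integral_eq_integral[symmetric]) (auto simp: square_integrable_on_def)
    then have "(LINT x|?M. (f n x - F x)\<^sup>2) \<le> ((1/2)^n)\<^sup>2"
      by (simp add: power2_commute)
    then show ?thesis
      unfolding norm_diff_abs_L2[OF Fsq] f_def by (intro real_le_lsqrt) auto
  qed
  then have "(\<lambda>n. X (r n) - abs_L2 F) \<longlonglongrightarrow> 0"
    by (intro Lim_null_comparison[OF _ LIMSEQ_power_zero[of "1/2::real"]]) auto
  then have "(X \<circ> r) \<longlonglongrightarrow> abs_L2 F"
    by (simp add: o_def LIM_zero_iff)
  then have "X \<longlonglongrightarrow> abs_L2 F"
    using Cauchy_converges_subseq[OF assms r] by blast
  then show ?thesis by (rule convergentI)
qed

instance L2 :: banach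
  by standard (rule L2_complete)

lemma subbasis_if_countable_dense:
  fixes D :: "'a::metric_space set"
  assumes "countable D" "closure D = UNIV"
  shows "\<exists>B::'a set set. countable B \<and> open = generate_topology B"
proof -
  define B where "B = (\<lambda>(d, n::nat). ball d (1 / Suc n)) ` (D \<times> UNIV)"
  have "topological_basis B"
  proof (rule topological_basisI)
    show "open U" if "U \<in> B" for U using that by (auto simp: B_def)
    fix U :: "'a set" and x assume "open U" "x \<in> U"
    then obtain e where e: "e > 0" "ball x e \<subseteq> U" by (auto simp: open_contains_ball)
    obtain n where n: "1 / Suc n < e / 2" using nat_approx_posE[of "e/2"] e by auto
    obtain d where d: "d \<in> D" "dist d x < 1 / Suc n"
      using assms(2) closure_approachable[of x D] by (metis UNIV_I of_nat_0_less_iff zero_less_Suc zero_less_divide_1_iff)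
    have "ball d (1 / Suc n) \<subseteq> ball x e"
    proof
      fix y assume "y \<in> ball d (1 / Suc n)"
      then show "y \<in> ball x e"
        using d n dist_triangle[of x y d] by (auto simp: dist_commute)
    qed
    then show "\<exists>B'\<in>B. x \<in> B' \<and> B' \<subseteq> U"
      using d e by (intro bexI[of _ "ball d (1 / Suc n)"]) (auto simp: B_def)
  qed
  moreover have "countable B" unfolding B_def using assms(1) by auto
  ultimately show ?thesis using topological_basis_imp_subbasis by blast
qed

lemma subbasis_if_isometry:
  fixes j :: "'a::metric_space \<Rightarrow> 'b::{metric_space, second_countable_topology}"
  assumes "\<And>x y. dist (j x) (j y) = dist x y"
  shows "\<exists>B::'a set set. countable B \<and> open = generate_topology B"
proof -
  obtain A :: "'b set set" where A: "countable A" "topological_basis A"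
    using ex_countable_basis by auto
  have cont: "continuous_on UNIV j"
    by (auto simp: continuous_on_iff assms)
  have "topological_basis ((-`) j ` A)"
  proof (rule topological_basisI)
    show "open U" if "U \<in> (-`) j ` A" for U
      using that topological_basis_open[OF A(2)] open_vimage[OF _ cont] by auto
    fix U :: "'a set" and x assume "open U" "x \<in> U"
    then obtain e where e: "e > 0" "ball x e \<subseteq> U" by (auto simp: open_contains_ball)
    obtain V where V: "V \<in> A" "j x \<in> V" "V \<subseteq> ball (j x) e"
      using topological_basisE[OF A(2), of "ball (j x) e" "j x"] e by auto
    have "j -` V \<subseteq> ball x e"
      using V(3) by (auto simp: assms)
    then show "\<exists>B'\<in>(-`) j ` A. x \<in> B' \<and> B' \<subseteq> U"
      using V e by (intro bexI[of _ "j -` V"]) auto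
  qed
  then show ?thesis using A(1) topological_basis_imp_subbasis by blast
qed

definition step_fun :: "nat \<Rightarrow> rat list \<Rightarrow> real \<Rightarrow> real" where
  "step_fun n rs x = (\<Sum>k<length rs. of_rat (rs ! k) * indicat_real {k / Suc n..<(k + 1) / Suc n} x)"

lemma borel_imp_lebesgue_on:
  "f \<in> borel_measurable borel \<Longrightarrow> f \<in> borel_measurable (lebesgue_on S)"
  by (intro measurable_restrict_space1 measurable_completion) simp

lemma measurable_step_fun [measurable]:
  "step_fun n rs \<in> borel_measurable (lebesgue_on S)"
proof -
  have "step_fun n rs \<in> borel_measurable borel" unfolding step_fun_def[abs_def] by measurable
  then show ?thesis by (rule borel_imp_lebesgue_on)
qed

lemma step_fun_eq:
  fixes x :: real
  assumes "0 \<le> x" "nat \<lfloor>Suc n * x\<rfloor> < length rs"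
  shows "step_fun n rs x = of_rat (rs ! nat \<lfloor>Suc n * x\<rfloor>)"
proof -
  define m where "m = nat \<lfloor>Suc n * x\<rfloor>"
  have "indicat_real {k / Suc n..<(k + 1) / Suc n} x = (if k = m then 1 else 0)" for k :: nat
  proof -
    have "x \<in> {k / Suc n..<(k + 1) / Suc n} \<longleftrightarrow> real k \<le> Suc n * x \<and> Suc n * x < real (Suc k)"
      by (auto simp: field_simps simp del: of_nat_Suc)
    also have "\<dots> \<longleftrightarrow> k = m"
    proof
      assume "real k \<le> Suc n * x \<and> Suc n * x < real (Suc k)"
      then have "\<lfloor>Suc n * x\<rfloor> = int k" by (intro floor_unique) auto
      then show "k = m" by (simp add: m_def)
    next
      assume "k = m"
      moreover have "0 \<le> Suc n * x" using assms(1) by simp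
      ultimately have "real k = of_int \<lfloor>Suc n * x\<rfloor>" by (simp add: m_def)
      then show "real k \<le> Suc n * x \<and> Suc n * x < real (Suc k)" by linarith
    qed
    finally show ?thesis by (simp add: indicator_def)
  qed
  then have "step_fun n rs x = (\<Sum>k<length rs. if k = m then of_rat (rs ! k) else 0)"
    unfolding step_fun_def by (intro sum.cong) auto
  then show ?thesis using assms(2) by (simp add: m_def)
qed

lemma bounded_square_integrable:
  fixes f :: "real \<Rightarrow> real"
  assumes "f \<in> borel_measurable (lebesgue_on {0<..<1})" "\<And>x. \<bar>f x\<bar> \<le> c"
  shows "f square_integrable_on {0<..<1}"
  by (rule square_integrable_bound[OF square_integrable_const[of c]]) (use assms in auto)

lemma closure_step_funs:
  "closure (range (\<lambda>(n, rs). abs_L2 (step_fun n rs))) = UNIV" (is "closure ?D = UNIV")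
proof -
  let ?M = "lebesgue_on {0<..<1::real}"
  have cont_meas: "g \<in> borel_measurable ?M" if "continuous_on UNIV g" for g :: "real \<Rightarrow> real"
    using that by (rule borel_imp_lebesgue_on[OF borel_measurable_continuous_onI])
  have cont: "abs_L2 g \<in> closure ?D" if g: "continuous_on UNIV g" "\<And>x. \<bar>g x\<bar> \<le> c" for g c
  proof -
    have "\<exists>q. \<bar>of_rat q - g (k / Suc n)\<bar> < 1 / Suc n" for k n :: nat
      using of_rat_dense[of "g (k / Suc n) - 1 / Suc n" "g (k / Suc n) + 1 / Suc n"]
      by (auto simp: abs_less_iff field_simps)
    then obtain q where q: "\<And>(k::nat) n. \<bar>of_rat (q k n) - g (k / Suc n)\<bar> < 1 / Suc n"
      by metis
    define h where "h = (\<lambda>n. step_fun n (map (\<lambda>k. q k n) [0..<Suc (Suc n)]))"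
    have h_eq: "h n x = of_rat (q (nat \<lfloor>Suc n * x\<rfloor>) n)" if "x \<in> {0<..<1}" for n and x :: real
    proof -
      have "Suc n * x < Suc n" using that by simp
      then have "nat \<lfloor>Suc n * x\<rfloor> < Suc (Suc n)" by linarith
      then show ?thesis
        unfolding h_def using that by (subst step_fun_eq) (auto simp del: upt_Suc)
    qed
    have near: "\<bar>h n x - g (nat \<lfloor>Suc n * x\<rfloor> / Suc n)\<bar> < 1 / Suc n" if "x \<in> {0<..<1}" for n and x :: real
      unfolding h_eq[OF that] by (rule q)
    have "(\<lambda>n. abs_L2 (h n)) \<longlonglongrightarrow> abs_L2 g"
    proof (rule L2_dominated_convergence[OF square_integrable_const[of "c + 1"]])
      show "h n \<in> borel_measurable ?M" for n by (simp add: h_def)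
      show "AE x in ?M. \<bar>h n x\<bar> \<le> c + 1" for n
      proof (rule AE_I2)
        fix x assume "x \<in> space ?M"
        then have "\<bar>h n x - g (nat \<lfloor>Suc n * x\<rfloor> / Suc n)\<bar> < 1 / Suc n" by (intro near) simp
        moreover have "1 / Suc n \<le> (1::real)" by simp
        ultimately show "\<bar>h n x\<bar> \<le> c + 1" using g(2)[of "nat \<lfloor>Suc n * x\<rfloor> / Suc n"] by linarith
      qed
      show "AE x in ?M. (\<lambda>n. h n x) \<longlonglongrightarrow> g x"
      proof (rule AE_I2)
        fix x assume "x \<in> space ?M"
        then have x: "x \<in> {0<..<1}" by simp
        have inv: "(\<lambda>n. 1 / real (Suc n)) \<longlonglongrightarrow> 0"
          using LIMSEQ_inverse_real_of_nat by (simp add: inverse_eq_divide)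
        have "\<bar>nat \<lfloor>Suc n * x\<rfloor> / Suc n - x\<bar> \<le> 1 / Suc n" for n
        proof -
          have "real (nat \<lfloor>Suc n * x\<rfloor>) = real_of_int \<lfloor>Suc n * x\<rfloor>" using x by simp
          then have "\<bar>nat \<lfloor>Suc n * x\<rfloor> - Suc n * x\<bar> \<le> 1" by linarith
          then have "\<bar>nat \<lfloor>Suc n * x\<rfloor> - Suc n * x\<bar> / Suc n \<le> 1 / Suc n"
            by (intro divide_right_mono) auto
          also have "\<bar>nat \<lfloor>Suc n * x\<rfloor> - Suc n * x\<bar> / Suc n = \<bar>(nat \<lfloor>Suc n * x\<rfloor> - Suc n * x) / Suc n\<bar>"
            by simp
          also have "(nat \<lfloor>Suc n * x\<rfloor> - Suc n * x) / Suc n = nat \<lfloor>Suc n * x\<rfloor> / Suc n - x"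
            by (simp add: diff_divide_distrib del: of_nat_Suc)
          finally show ?thesis .
        qed
        then have "(\<lambda>n. nat \<lfloor>Suc n * x\<rfloor> / Suc n - x) \<longlonglongrightarrow> 0"
          by (intro Lim_null_comparison[OF _ inv]) auto
        then have "(\<lambda>n. nat \<lfloor>Suc n * x\<rfloor> / Suc n) \<longlonglongrightarrow> x" by (simp add: LIM_zero_iff)
        then have "(\<lambda>n. g (nat \<lfloor>Suc n * x\<rfloor> / Suc n)) \<longlonglongrightarrow> g x"
          using g(1) by (auto intro!: continuous_on_tendsto_compose[of UNIV g])
        moreover have "(\<lambda>n. h n x - g (nat \<lfloor>Suc n * x\<rfloor> / Suc n)) \<longlonglongrightarrow> 0"
          using near[OF x] by (intro Lim_null_comparison[OF _ inv] always_eventually)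
            (simp del: of_nat_Suc add: less_imp_le)
        ultimately have "(\<lambda>n. h n x - g (nat \<lfloor>Suc n * x\<rfloor> / Suc n) + g (nat \<lfloor>Suc n * x\<rfloor> / Suc n)) \<longlonglongrightarrow> 0 + g x"
          by (intro tendsto_add)
        then show "(\<lambda>n. h n x) \<longlonglongrightarrow> g x" by simp
      qed
    qed (rule cont_meas[OF g(1)])
    moreover have "abs_L2 (h n) \<in> ?D" for n
      unfolding h_def by (rule image_eqI[where x="(n, map (\<lambda>k. q k n) [0..<Suc (Suc n)])"]) auto
    ultimately show ?thesis
      unfolding closure_sequential by (intro exI[of _ "\<lambda>n. abs_L2 (h n)"] conjI allI)
  qed
  have bdd: "abs_L2 f \<in> closure ?D"
    if f: "f \<in> borel_measurable ?M" "\<And>x. \<bar>f x\<bar> \<le> c" for f c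
  proof -
    have "f measurable_on {0<..<1}"
      using f(1) by (subst measurable_on_iff_borel_measurable) auto
    then obtain N g where N: "negligible N" and g: "\<And>n. continuous_on UNIV (g n)"
      "\<And>x. x \<notin> N \<Longrightarrow> (\<lambda>n. g n x) \<longlonglongrightarrow> (if x \<in> {0<..<1} then f x else 0)"
      unfolding measurable_on_def by blast
    define h where "h = (\<lambda>n x. max (- c) (min c (g n x)))"
    have c: "c \<ge> 0" using f(2)[of 0] by linarith
    have hc: "continuous_on UNIV (h n)" for n
      unfolding h_def by (intro continuous_intros g)
    have "(\<lambda>n. abs_L2 (h n)) \<longlonglongrightarrow> abs_L2 f"
    proof (rule L2_dominated_convergence[OF square_integrable_const[of c]])
      show "AE x in ?M. (\<lambda>n. h n x) \<longlonglongrightarrow> f x"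
      proof -
        have "AE x in lebesgue. x \<notin> N"
          using N by (simp add: AE_not_in negligible_iff_null_sets)
        then have "AE x in ?M. x \<notin> N" by (rule AE_restrict_space_iff[THEN iffD2, OF _ eventually_mono, rotated]) auto
        moreover have "AE x in ?M. x \<in> {0<..<1}" by (rule AE_I2) simp
        ultimately show ?thesis
        proof eventually_elim
          case (elim x)
          then have "(\<lambda>n. h n x) \<longlonglongrightarrow> max (- c) (min c (f x))"
            unfolding h_def using g(2)[of x] by (intro tendsto_intros) auto
          then show ?case using f(2)[of x] by (simp add: min_def max_def abs_le_iff split: if_splits)
        qed
      qed
      show "AE x in ?M. \<bar>h n x\<bar> \<le> c" for n
        using c by (auto simp: h_def)
    qed (use cont_meas[OF hc] f in auto)
    moreover have "abs_L2 (h n) \<in> closure ?D" for n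
      by (rule cont[OF hc, of _ c]) (use c in \<open>auto simp: h_def\<close>)
    ultimately show ?thesis by (rule closed_sequentially[OF closed_closure, rotated])
  qed
  have "u \<in> closure ?D" for u
  proof -
    define h where "h = (\<lambda>n x. max (- real n) (min (real n) (rep_L2 u x)))"
    have [measurable]: "h n \<in> borel_measurable ?M" for n unfolding h_def by measurable
    have w: "(\<lambda>x. \<bar>rep_L2 u x\<bar>) square_integrable_on {0<..<1}"
      using rep_L2_square_integrable[of u] by (auto simp: square_integrable_on_def)
    have "(\<lambda>n. abs_L2 (h n)) \<longlonglongrightarrow> abs_L2 (rep_L2 u)"
    proof (rule L2_dominated_convergence[OF w])
      show "AE x in ?M. (\<lambda>n. h n x) \<longlonglongrightarrow> rep_L2 u x"
      proof (rule AE_I2)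
        fix x
        obtain m where m: "\<bar>rep_L2 u x\<bar> \<le> real m" using real_arch_simple by blast
        have "h n x = rep_L2 u x" if "n \<ge> m" for n
          using m that by (auto simp: h_def min_def max_def)
        then show "(\<lambda>n. h n x) \<longlonglongrightarrow> rep_L2 u x"
          by (intro tendsto_eventually) (auto simp: eventually_sequentially)
      qed
      show "AE x in ?M. \<bar>h n x\<bar> \<le> \<bar>rep_L2 u x\<bar>" for n
        by (auto simp: h_def)
    qed measurable
    moreover have "abs_L2 (h n) \<in> closure ?D" for n
      by (rule bdd[of _ n]) (auto simp: h_def)
    ultimately have "abs_L2 (rep_L2 u) \<in> closure ?D"
      by (rule closed_sequentially[OF closed_closure, rotated])
    then show ?thesis by (simp only: Quotient_abs_rep[OF Quotient_L2])
  qed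
  then show ?thesis by auto
qed

instance L2 :: second_countable_topology
  by standard (rule subbasis_if_countable_dense[OF _ closure_step_funs], simp)

section \<open>Test functions and weak derivatives\<close>

definition smooth :: "(real \<Rightarrow> real) \<Rightarrow> bool" where
  "smooth \<phi> \<longleftrightarrow> (\<forall>k x. (deriv ^^ k) \<phi> differentiable (at x))"

definition test_function_on :: "real set \<Rightarrow> (real \<Rightarrow> real) \<Rightarrow> bool" where
  "test_function_on S \<phi> \<longleftrightarrow>
     smooth \<phi> \<and> (\<exists>K. compact K \<and> K \<subseteq> S \<and> (\<forall>x. x \<notin> K \<longrightarrow> \<phi> x = 0))"

definition locally_integrable_on ::
    "(real \<Rightarrow> 'b::{banach, second_countable_topology}) \<Rightarrow> real set \<Rightarrow> bool"
    (infix "locally'_integrable'_on" 50) where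
  "f locally_integrable_on S \<longleftrightarrow> (\<forall>K. compact K \<and> K \<subseteq> S \<longrightarrow> integrable (lebesgue_on K) f)"

text \<open>
  With Bochner integrals, so that the definition serves both for real functions of space and for
  \<^typ>\<open>L2\<close>-valued functions of time. Then \<^prop>\<open>weak_derivative_on S f g\<close> says that \<open>f\<close> lies in
  $W^{1,1}_{loc}(S)$ and has weak derivative \<open>g\<close>.
\<close>

definition weak_derivative_on ::
    "real set \<Rightarrow> (real \<Rightarrow> 'b::{banach, second_countable_topology}) \<Rightarrow> (real \<Rightarrow> 'b) \<Rightarrow> bool" where
  "weak_derivative_on S f g \<longleftrightarrow>
     f locally_integrable_on S \<and> g locally_integrable_on S \<and>
     (\<forall>\<phi>. test_function_on S \<phi> \<longrightarrow>
       (LINT x|lebesgue_on S. deriv \<phi> x *\<^sub>R f x) = - (LINT x|lebesgue_on S. \<phi> x *\<^sub>R g x))"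

lemma smooth_family:
  assumes "f \<in> F" "\<And>g. g \<in> F \<Longrightarrow> \<exists>g'\<in>F. \<forall>x. (g has_real_derivative g' x) (at x)"
  shows "smooth f"
proof -
  have "(deriv ^^ k) f \<in> F" for k
  proof (induction k)
    case (Suc k)
    then obtain g' where "g' \<in> F" "\<forall>x. ((deriv ^^ k) f has_real_derivative g' x) (at x)"
      using assms(2) by blast
    moreover from this have "deriv ((deriv ^^ k) f) = g'"
      by (auto intro!: ext DERIV_imp_deriv)
    ultimately show ?case by simp
  qed (simp add: assms(1))
  then show ?thesis
    unfolding smooth_def using assms(2) by (meson real_differentiable_def)
qed

lemma smooth_deriv_DERIV:
  "smooth f \<Longrightarrow> ((deriv ^^ k) f has_real_derivative (deriv ^^ Suc k) f x) (at x)"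
  unfolding smooth_def by (simp add: DERIV_deriv_iff_real_differentiable)

lemma smooth_deriv: "smooth f \<Longrightarrow> smooth (deriv f)"
  unfolding smooth_def by (metis funpow_swap1 comp_apply funpow_Suc_right)

lemma smooth_continuous: "smooth f \<Longrightarrow> continuous_on UNIV f"
  using smooth_deriv_DERIV[of f 0]
  by (auto intro!: continuous_at_imp_continuous_on DERIV_isCont)

lemma smooth_mult:
  assumes "smooth f" "smooth g"
  shows "smooth (\<lambda>x. f x * g x)"
proof -
  let ?P = "\<lambda>L x. \<Sum>(i, j)\<leftarrow>L. (deriv ^^ i) f x * (deriv ^^ j) g x"
  show ?thesis
  proof (rule smooth_family[where F = "range ?P"])
    show "(\<lambda>x. f x * g x) \<in> range ?P"
      by (rule image_eqI[of _ _ "[(0, 0)]"]) auto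
    fix h assume "h \<in> range ?P"
    then obtain L where h: "h = ?P L" by auto
    have "\<exists>L'. \<forall>x. (?P L has_real_derivative ?P L' x) (at x)"
    proof (induction L)
      case Nil
      show ?case by (rule exI[of _ "[]"]) auto
    next
      case (Cons p L)
      then obtain L' where L': "\<And>x. (?P L has_real_derivative ?P L' x) (at x)" by auto
      obtain i j where p: "p = (i, j)" by force
      have "(?P (p # L) has_real_derivative ?P ((Suc i, j) # (i, Suc j) # L') x) (at x)" for x
        using DERIV_add[OF DERIV_mult[OF smooth_deriv_DERIV[OF assms(1), of i x]
            smooth_deriv_DERIV[OF assms(2), of j x]] L'[of x]]
        by (simp add: p algebra_simps)
      then show ?case by blast
    qed
    then show "\<exists>g'\<in>range ?P. \<forall>x. (h has_real_derivative g' x) (at x)"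
      unfolding h by auto
  qed
qed

lemma smooth_affine:
  assumes "smooth f"
  shows "smooth (\<lambda>x. f (c * x + d))"
proof (rule smooth_family[where F = "range (\<lambda>(k, i) x. k * (deriv ^^ i) f (c * x + d))"])
  show "(\<lambda>x. f (c * x + d)) \<in> range (\<lambda>(k, i) x. k * (deriv ^^ i) f (c * x + d))"
    by (rule image_eqI[of _ _ "(1, 0)"]) auto
  fix g assume "g \<in> range (\<lambda>(k, i) x. k * (deriv ^^ i) f (c * x + d))"
  then obtain k i where g: "g = (\<lambda>x. k * (deriv ^^ i) f (c * x + d))" by auto
  let ?g' = "\<lambda>x. (k * c) * (deriv ^^ Suc i) f (c * x + d)"
  have "(g has_real_derivative ?g' x) (at x)" for x
  proof -
    have "((\<lambda>x. (deriv ^^ i) f (c * x + d)) has_real_derivative (deriv ^^ Suc i) f (c * x + d) * c) (at x)"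
      by (rule DERIV_chain2[OF smooth_deriv_DERIV[OF assms]]) (auto intro!: derivative_eq_intros)
    then have "(g has_real_derivative k * ((deriv ^^ Suc i) f (c * x + d) * c)) (at x)"
      unfolding g by (rule DERIV_cmult)
    moreover have "k * ((deriv ^^ Suc i) f (c * x + d) * c) = ?g' x"
      by (simp only: mult.assoc mult.commute[of c])
    ultimately show ?thesis by (rule DERIV_cong)
  qed
  moreover have "?g' \<in> range (\<lambda>(k, i) x. k * (deriv ^^ i) f (c * x + d))"
    by (rule image_eqI[of _ _ "(k * c, Suc i)"]) auto
  ultimately show "\<exists>g'\<in>range (\<lambda>(k, i) x. k * (deriv ^^ i) f (c * x + d)).
      \<forall>x. (g has_real_derivative g' x) (at x)"
    by (intro bexI[of _ ?g'] allI)
qed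

lemma smooth_id: "smooth (\<lambda>x. x)"
proof (rule smooth_family[where F = "insert (\<lambda>x. x) (range (\<lambda>c x. c))"])
  fix g :: "real \<Rightarrow> real" assume "g \<in> insert (\<lambda>x. x) (range (\<lambda>c x. c))"
  then consider "g = (\<lambda>x. x)" | c where "g = (\<lambda>x. c)" by auto
  then show "\<exists>g'\<in>insert (\<lambda>x. x) (range (\<lambda>c x. c)). \<forall>x. (g has_real_derivative g' x) (at x)"
  proof cases
    case 1
    then show ?thesis by (intro bexI[of _ "\<lambda>_. 1"]) (auto intro!: derivative_eq_intros)
  next
    case 2
    then show ?thesis by (intro bexI[of _ "\<lambda>_. 0"]) auto
  qed
qed simp

definition bump :: "real \<Rightarrow> real" where
  "bump x = (if x > 0 then exp (- 1 / x) else 0)"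

lemma smooth_bump: "smooth bump"
proof -
  let ?F = "\<lambda>p x. if x > 0 then poly p (1 / x) * exp (- 1 / x) else (0::real)"
  show ?thesis
  proof (rule smooth_family[where F = "range ?F"])
    show "bump \<in> range ?F" by (rule image_eqI[of _ _ 1]) (auto simp: bump_def)
    fix g assume "g \<in> range ?F"
    then obtain p where g: "g = ?F p" by auto
    define q where "q = [:0, 0, 1:] * (p - pderiv p)"
    have "(?F p has_real_derivative ?F q x) (at x)" for x
    proof -
      consider "x > 0" | "x < 0" | "x = 0" by linarith
      then show ?thesis
      proof cases
        case 1
        have "((\<lambda>x. poly p (1 / x) * exp (- 1 / x)) has_real_derivative ?F q x) (at x)"
        proof -
          have "((\<lambda>x. poly p (1 / x)) has_real_derivative poly (pderiv p) (1 / x) * (- 1 / x\<^sup>2)) (at x)"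
            using 1 by (intro DERIV_chain2[OF poly_DERIV])
              (auto intro!: derivative_eq_intros simp: power2_eq_square)
          moreover have "((\<lambda>x. exp (- 1 / x)) has_real_derivative exp (- 1 / x) * (1 / x\<^sup>2)) (at x)"
            using 1 by (auto intro!: derivative_eq_intros simp: power2_eq_square)
          ultimately have "((\<lambda>x. poly p (1 / x) * exp (- 1 / x)) has_real_derivative
             poly (pderiv p) (1 / x) * (- 1 / x\<^sup>2) * exp (- 1 / x) +
             exp (- 1 / x) * (1 / x\<^sup>2) * poly p (1 / x)) (at x)"
            by (rule DERIV_mult)
          then show ?thesis
            using 1 by (simp add: q_def power2_eq_square algebra_simps)
        qed
        then show ?thesis
        proof (rule has_field_derivative_transform_within_open[of _ _ _ "{0<..}"])
        qed (use 1 in auto)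
      next
        case 2
        have "((\<lambda>x. 0) has_real_derivative ?F q x) (at x)" using 2 by simp
        then show ?thesis
        proof (rule has_field_derivative_transform_within_open[of _ _ _ "{..<0}"])
        qed (use 2 in auto)
      next
        case 3
        have "((\<lambda>y. poly p y * y / exp y) \<longlongrightarrow> (\<Sum>i\<le>degree p. coeff p i * 0)) at_top"
        proof -
          have "((\<lambda>y. \<Sum>i\<le>degree p. coeff p i * (y ^ Suc i / exp y)) \<longlongrightarrow>
              (\<Sum>i\<le>degree p. coeff p i * 0)) at_top"
            by (intro tendsto_sum tendsto_mult tendsto_const tendsto_power_div_exp_0)
          then show ?thesis
            by (simp add: poly_altdef sum_distrib_left sum_divide_distrib mult_ac)
        qed
        then have lim: "((\<lambda>h. poly p (inverse h) * inverse h / exp (inverse h)) \<longlongrightarrow> 0) (at_right 0)"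
          by (intro filterlim_compose[OF _ filterlim_inverse_at_top_right]) simp
        have "((\<lambda>h. (?F p h - ?F p 0) / (h - 0)) \<longlongrightarrow> 0) (at_right 0)"
          by (rule Lim_transform_eventually[OF lim])
            (auto simp: eventually_at_right_field exp_minus field_simps intro!: exI[of _ 1])
        moreover have "((\<lambda>h. (?F p h - ?F p 0) / (h - 0)) \<longlongrightarrow> 0) (at_left 0)"
          by (rule tendsto_eventually) (auto simp: eventually_at_left_field intro!: exI[of _ "-1"])
        ultimately show ?thesis
          unfolding 3 has_field_derivative_iff by (auto intro: filterlim_split_at)
      qed
    qed
    then show "\<exists>g'\<in>range ?F. \<forall>x. (g has_real_derivative g' x) (at x)"
      unfolding g by (intro bexI[of _ "?F q"] allI rangeI)
  qed
qed

lemma test_function_approx_indicator: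
  fixes a b :: real
  obtains \<phi> where "\<And>n. test_function_on {a<..<b} (\<phi> n)" "\<And>n x. \<bar>\<phi> n x\<bar> \<le> 1"
    "\<And>x. (\<lambda>n. \<phi> n x) \<longlonglongrightarrow> indicat_real {a<..<b} x"
proof
  define \<phi> where "\<phi> = (\<lambda>n (x::real). bump (Suc n * x + (- Suc n * a - 1)) * bump (- Suc n * x + (Suc n * b - 1)))"
  have out: "\<phi> n x = 0" if "x \<notin> {a + 1 / Suc n..b - 1 / Suc n}" for n and x :: real
  proof -
    from that consider "x < a + 1 / Suc n" | "x > b - 1 / Suc n" by force
    then have "Suc n * x + (- Suc n * a - 1) < 0 \<or> - Suc n * x + (Suc n * b - 1) < 0"
      by cases (auto simp: field_simps simp del: of_nat_Suc)
    then show ?thesis by (auto simp: \<phi>_def bump_def)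
  qed
  show "test_function_on {a<..<b} (\<phi> n)" for n
    unfolding test_function_on_def
  proof
    show "smooth (\<phi> n)"
      unfolding \<phi>_def by (intro smooth_mult smooth_affine smooth_bump)
    show "\<exists>K. compact K \<and> K \<subseteq> {a<..<b} \<and> (\<forall>x. x \<notin> K \<longrightarrow> \<phi> n x = 0)"
    proof (intro exI conjI)
      show "{a + 1 / Suc n..b - 1 / Suc n} \<subseteq> {a<..<b}"
      proof
        fix x assume "x \<in> {a + 1 / Suc n..b - 1 / Suc n}"
        moreover have "1 / real (Suc n) > 0" by simp
        ultimately show "x \<in> {a<..<b}" by (simp only: atLeastAtMost_iff greaterThanLessThan_iff) linarith
      qed
    qed (use out in auto)
  qed
  have b: "0 \<le> bump y" "bump y \<le> 1" for y by (auto simp: bump_def)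
  show "\<bar>\<phi> n x\<bar> \<le> 1" for n x
    unfolding \<phi>_def abs_mult by (rule mult_le_one) (use b in auto)
  show "(\<lambda>n. \<phi> n x) \<longlonglongrightarrow> indicat_real {a<..<b} x" for x
  proof (cases "x \<in> {a<..<b}")
    case True
    have bump_top: "(bump \<longlongrightarrow> 1) at_top"
    proof -
      have "((\<lambda>y::real. exp (- 1 / y)) \<longlongrightarrow> exp 0) at_top"
        by (intro tendsto_exp real_tendsto_divide_at_top[OF tendsto_const] filterlim_ident)
      moreover have "\<forall>\<^sub>F y in at_top. exp (- 1 / y) = bump y"
        using eventually_gt_at_top[of 0] by eventually_elim (simp add: bump_def)
      ultimately show ?thesis
        by (rule Lim_transform_eventually[THEN tendsto_eq_rhs]) simp
    qed
    have top: "filterlim (\<lambda>n. Suc n * c + (- 1)) at_top sequentially" if "c > 0" for c :: real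
    proof -
      have "filterlim (\<lambda>n. c * real (Suc n)) at_top sequentially"
        using that by (intro filterlim_tendsto_pos_mult_at_top[OF tendsto_const]
            filterlim_compose[OF filterlim_real_sequentially filterlim_Suc]) auto
      then show ?thesis
        using filterlim_tendsto_add_at_top[OF tendsto_const[of "-1::real"], of "\<lambda>n. c * real (Suc n)" sequentially]
        by (simp add: mult.commute add.commute)
    qed
    have "(\<lambda>n. bump (Suc n * (x - a) + (-1)) * bump (Suc n * (b - x) + (-1))) \<longlonglongrightarrow> 1 * 1"
      using True by (intro tendsto_mult filterlim_compose[OF bump_top] top) auto
    moreover have "\<phi> n x = bump (Suc n * (x - a) + (-1)) * bump (Suc n * (b - x) + (-1))" for n
      unfolding \<phi>_def by (simp add: algebra_simps)
    ultimately show ?thesis using True by simp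
  next
    case False
    have "\<phi> n x = 0" for n
    proof (rule out)
      have "1 / real (Suc n) > 0" by simp
      with False show "x \<notin> {a + 1 / Suc n..b - 1 / Suc n}" 
        by (simp only: atLeastAtMost_iff greaterThanLessThan_iff) linarith
    qed
    with False show ?thesis by simp
  qed
qed

lemma test_function_deriv:
  assumes "test_function_on S \<phi>"
  shows "test_function_on S (deriv \<phi>)"
proof -
  obtain K where K: "compact K" "K \<subseteq> S" "\<And>x. x \<notin> K \<Longrightarrow> \<phi> x = 0"
    using assms by (auto simp: test_function_on_def)
  have "deriv \<phi> x = 0" if "x \<notin> K" for x
  proof -
    have "((\<lambda>_. 0) has_real_derivative 0) (at x)" by simp
    then have "(\<phi> has_real_derivative 0) (at x)"
      by (rule has_field_derivative_transform_within_open[of _ _ _ "- K"])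
        (use that K compact_imp_closed in auto)
    then show ?thesis by (rule DERIV_imp_deriv)
  qed
  then show ?thesis
    using assms K smooth_deriv unfolding test_function_on_def by blast
qed

lemma test_function_continuous: "test_function_on S \<phi> \<Longrightarrow> continuous_on UNIV \<phi>"
  by (auto simp: test_function_on_def intro: smooth_continuous)

lemma test_function_bounded:
  assumes "test_function_on S \<phi>"
  obtains c where "\<And>x. \<bar>\<phi> x\<bar> \<le> c"
proof -
  obtain K where K: "compact K" "\<And>x. x \<notin> K \<Longrightarrow> \<phi> x = 0"
    using assms by (auto simp: test_function_on_def)
  have "compact (\<phi> ` K)"
    using K(1) test_function_continuous[OF assms]
    by (intro compact_continuous_image) (auto intro: continuous_on_subset)
  then obtain c where c: "\<And>x. x \<in> K \<Longrightarrow> \<bar>\<phi> x\<bar> \<le> c"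
    by (force dest!: compact_imp_bounded simp: bounded_iff)
  have "\<bar>\<phi> x\<bar> \<le> max c 0" for x using c[of x] K(2)[of x] by (cases "x \<in> K") auto
  then show thesis by (rule that)
qed

lemma test_function_square_integrable:
  assumes "test_function_on S \<phi>"
  shows "\<phi> square_integrable_on {0<..<1}"
proof -
  obtain c where "\<And>x. \<bar>\<phi> x\<bar> \<le> c" using test_function_bounded[OF assms] by blast
  then show ?thesis
    by (intro bounded_square_integrable[of _ c] borel_imp_lebesgue_on borel_measurable_continuous_onI
        test_function_continuous[OF assms])
qed

lemma test_function_mono: "test_function_on S \<phi> \<Longrightarrow> S \<subseteq> T \<Longrightarrow> test_function_on T \<phi>"
  unfolding test_function_on_def by blast

lemma locally_integrable_rep_L2: "rep_L2 u locally_integrable_on {0<..<1}"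
  unfolding locally_integrable_on_def
proof (intro allI impI)
  fix K :: "real set" assume K: "compact K \<and> K \<subseteq> {0<..<1}"
  have "integrable (lebesgue_on {0<..<1}) (\<lambda>x. 1 * rep_L2 u x)"
    by (intro square_integrable_mult square_integrable_const rep_L2_square_integrable)
  then have "integrable (lebesgue_on {0<..<1}) (rep_L2 u)" by simp
  then have "set_integrable lebesgue {0<..<1} (rep_L2 u)"
    by (simp add: integrable_restrict_space set_integrable_def)
  then have "set_integrable lebesgue K (rep_L2 u)"
    by (rule set_integrable_subset) (use K in \<open>auto intro: lmeasurable_compact fmeasurableD\<close>)
  then show "integrable (lebesgue_on K) (rep_L2 u)"
    using K by (simp add: integrable_restrict_space set_integrable_def lmeasurable_compact fmeasurableD)
qed

lemma weak_derivative_L2_iff: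
  "weak_derivative_on {0<..<1} (rep_L2 u) (rep_L2 v) \<longleftrightarrow>
   (\<forall>\<phi>. test_function_on {0<..<1} \<phi> \<longrightarrow> abs_L2 (deriv \<phi>) \<bullet> u = - (abs_L2 \<phi> \<bullet> v))"
  unfolding weak_derivative_on_def
  by (auto simp: locally_integrable_rep_L2 inner_abs_L2[OF test_function_square_integrable]
      inner_abs_L2[OF test_function_square_integrable[OF test_function_deriv]])

lemma orthogonal_test_functions:
  assumes "\<And>\<phi>. test_function_on {0<..<1} \<phi> \<Longrightarrow> abs_L2 \<phi> \<bullet> v = 0"
  shows "v = 0"
proof -
  let ?M = "lebesgue_on {0<..<1::real}"
  have ind: "(LINT x|?M. indicat_real {a<..<b} x * rep_L2 v x) = 0"
    if "0 \<le> a" "b \<le> 1" for a b :: real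
  proof -
    obtain \<phi> where \<phi>: "\<And>n. test_function_on {a<..<b} (\<phi> n)" "\<And>n x. \<bar>\<phi> n x\<bar> \<le> 1"
      "\<And>x. (\<lambda>n. \<phi> n x) \<longlonglongrightarrow> indicat_real {a<..<b} x"
      using test_function_approx_indicator by blast
    have "(\<lambda>n. abs_L2 (\<phi> n)) \<longlonglongrightarrow> abs_L2 (indicat_real {a<..<b})"
    proof (rule L2_dominated_convergence[OF square_integrable_const[of 1]])
      show "\<phi> n \<in> borel_measurable ?M" for n
        by (intro borel_imp_lebesgue_on borel_measurable_continuous_onI test_function_continuous[OF \<phi>(1)])
    qed (use \<phi>(2,3) in \<open>auto intro!: borel_imp_lebesgue_on\<close>)
    then have "(\<lambda>n. abs_L2 (\<phi> n) \<bullet> v) \<longlonglongrightarrow> abs_L2 (indicat_real {a<..<b}) \<bullet> v"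
      by (intro tendsto_inner tendsto_const)
    moreover have "abs_L2 (\<phi> n) \<bullet> v = 0" for n
      using that by (intro assms test_function_mono[OF \<phi>(1)]) auto
    ultimately have "abs_L2 (indicat_real {a<..<b}) \<bullet> v = 0"
      by (simp add: LIMSEQ_const_iff)
    then show ?thesis
      by (subst (asm) inner_abs_L2)
        (auto intro!: bounded_square_integrable[of _ 1] borel_imp_lebesgue_on simp: indicator_def)
  qed
  have "abs_L2 (step_fun n rs) \<bullet> v = 0" for n rs
  proof -
    let ?I = "\<lambda>k::nat. indicat_real {k / Suc n..<(k + 1) / Suc n}"
    have I: "?I k square_integrable_on {0<..<1}" for k
      by (rule bounded_square_integrable[of _ 1]) (auto intro!: borel_imp_lebesgue_on simp: indicator_def)
    have zero: "(LINT x|?M. ?I k x * rep_L2 v x) = 0" for k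
    proof (cases "k < Suc n")
      case True
      have "AE x in lebesgue. x \<notin> {k / Suc n}"
        by (rule AE_not_in) (simp add: negligible_iff_null_sets[symmetric])
      then have "AE x in ?M. x \<notin> {k / Suc n}"
        by (rule AE_restrict_space_iff[THEN iffD2, OF _ eventually_mono, rotated]) auto
      then have "AE x in ?M. ?I k x * rep_L2 v x =
          indicat_real {k / Suc n<..<(k + 1) / Suc n} x * rep_L2 v x"
        by eventually_elim (auto simp: indicator_def)
      then have "(LINT x|?M. ?I k x * rep_L2 v x) =
          (LINT x|?M. indicat_real {k / Suc n<..<(k + 1) / Suc n} x * rep_L2 v x)"
        by (rule integral_cong_AE[rotated 2])
          (intro borel_measurable_times borel_measurable_rep_L2 borel_imp_lebesgue_on; simp)+
      also have "\<dots> = 0" by (rule ind) (use True in \<open>auto simp: field_simps\<close>)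
      finally show ?thesis .
    next
      case False
      have "?I k x = 0" if "x \<in> {0<..<1}" for x :: real
      proof -
        have "1 \<le> k / Suc n" using False by (simp add: le_divide_eq del: of_nat_Suc)
        with that have "x < k / Suc n" by (simp only: greaterThanLessThan_iff) linarith
        then show ?thesis by (auto simp: indicator_def)
      qed
      then have "(LINT x|?M. ?I k x * rep_L2 v x) = (LINT x|?M. 0)"
        by (intro Bochner_Integration.integral_cong) auto
      then show ?thesis by simp
    qed
    have "(step_fun n rs) square_integrable_on {0<..<1}"
    proof -
      have "\<bar>step_fun n rs x\<bar> \<le> (\<Sum>k<length rs. \<bar>of_rat (rs ! k)\<bar>)" for x
        unfolding step_fun_def
        by (rule order_trans[OF sum_abs]) (auto intro!: sum_mono simp: indicator_def)
      then show ?thesis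
        by (rule bounded_square_integrable[OF measurable_step_fun])
    qed
    then have "abs_L2 (step_fun n rs) \<bullet> v = (LINT x|?M. step_fun n rs x * rep_L2 v x)"
      by (rule inner_abs_L2)
    also have "\<dots> = (LINT x|?M. (\<Sum>k<length rs. of_rat (rs ! k) * (?I k x * rep_L2 v x)))"
      unfolding step_fun_def sum_distrib_right mult.assoc ..
    also have "\<dots> = (\<Sum>k<length rs. (LINT x|?M. of_rat (rs ! k) * (?I k x * rep_L2 v x)))"
      by (intro Bochner_Integration.integral_sum integrable_mult_right square_integrable_mult I
          rep_L2_square_integrable)
    also have "\<dots> = 0" by (simp only: integral_mult_right_zero zero) simp
    finally show ?thesis .
  qed
  then have "range (\<lambda>(n, rs). abs_L2 (step_fun n rs)) \<subseteq> {w. w \<bullet> v = 0}" by auto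
  moreover have "closed {w. w \<bullet> v = 0}"
    by (intro closed_Collect_eq continuous_intros)
  ultimately have "closure (range (\<lambda>(n, rs). abs_L2 (step_fun n rs))) \<subseteq> {w. w \<bullet> v = 0}"
    by (rule closure_minimal)
  then have "v \<in> {w. w \<bullet> v = 0}" unfolding closure_step_funs by (rule subsetD) simp
  then have "v \<bullet> v = 0" by simp
  then show ?thesis by simp
qed

section \<open>Sobolev spaces on the unit interval\<close>

text \<open>
  \<open>L2_wderiv\<close> is meaningful on \<open>W12_01\<close>, where the weak derivative is unique (\<open>L2_wderiv_unique\<close>);
  \<open>W12_0_01\<close> is the closure of the test functions in the norm of $W^{1,2}(0,1)$.
\<close>

definition L2_wderiv :: "L2 \<Rightarrow> L2" where
  "L2_wderiv u = (THE v. weak_derivative_on {0<..<1} (rep_L2 u) (rep_L2 v))"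

definition W12_01 :: "L2 set" where
  "W12_01 = {u. \<exists>v. weak_derivative_on {0<..<1} (rep_L2 u) (rep_L2 v)}"

definition W12_0_01 :: "L2 set" where
  "W12_0_01 = {u \<in> W12_01. \<exists>\<phi>. (\<forall>n. test_function_on {0<..<1} (\<phi> n)) \<and>
     (\<lambda>n. abs_L2 (\<phi> n)) \<longlonglongrightarrow> u \<and> (\<lambda>n. abs_L2 (deriv (\<phi> n))) \<longlonglongrightarrow> L2_wderiv u}"

definition W22_01 :: "L2 set" where
  "W22_01 = {u \<in> W12_01. L2_wderiv u \<in> W12_01}"

lemma L2_wderiv_unique:
  assumes "weak_derivative_on {0<..<1} (rep_L2 u) (rep_L2 v)"
  shows "L2_wderiv u = v"
  unfolding L2_wderiv_def
proof (rule the_equality)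
  show "weak_derivative_on {0<..<1} (rep_L2 u) (rep_L2 v)" by (rule assms)
  fix w assume w: "weak_derivative_on {0<..<1} (rep_L2 u) (rep_L2 w)"
  have "w - v = 0"
  proof (rule orthogonal_test_functions)
    fix \<phi> assume "test_function_on {0<..<1} \<phi>"
    then show "abs_L2 \<phi> \<bullet> (w - v) = 0"
      using assms w by (simp add: weak_derivative_L2_iff inner_diff_right)
  qed
  then show "w = v" by simp
qed

lemma W12_01_iff:
  "u \<in> W12_01 \<longleftrightarrow> weak_derivative_on {0<..<1} (rep_L2 u) (rep_L2 (L2_wderiv u))"
  using L2_wderiv_unique unfolding W12_01_def by blast

lemma W12_01_test:
  "u \<in> W12_01 \<Longrightarrow> test_function_on {0<..<1} \<phi> \<Longrightarrow>
    abs_L2 (deriv \<phi>) \<bullet> u = - (abs_L2 \<phi> \<bullet> L2_wderiv u)"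
  by (simp add: W12_01_iff weak_derivative_L2_iff)

lemma L2_wderiv_lincomb:
  assumes "u \<in> W12_01" "v \<in> W12_01"
  shows "a *\<^sub>R u + b *\<^sub>R v \<in> W12_01"
    "L2_wderiv (a *\<^sub>R u + b *\<^sub>R v) = a *\<^sub>R L2_wderiv u + b *\<^sub>R L2_wderiv v"
proof -
  have *: "weak_derivative_on {0<..<1} (rep_L2 (a *\<^sub>R u + b *\<^sub>R v))
      (rep_L2 (a *\<^sub>R L2_wderiv u + b *\<^sub>R L2_wderiv v))"
    unfolding weak_derivative_L2_iff
    using W12_01_test[OF assms(1)] W12_01_test[OF assms(2)] by (simp add: inner_add_right)
  then show "a *\<^sub>R u + b *\<^sub>R v \<in> W12_01" unfolding W12_01_def by blast
  from * show "L2_wderiv (a *\<^sub>R u + b *\<^sub>R v) = a *\<^sub>R L2_wderiv u + b *\<^sub>R L2_wderiv v"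
    by (rule L2_wderiv_unique)
qed

lemma W22_01_lincomb:
  assumes "u \<in> W22_01" "v \<in> W22_01"
  shows "a *\<^sub>R u + b *\<^sub>R v \<in> W22_01"
  using assms L2_wderiv_lincomb by (simp add: W22_01_def)

lemma smooth_lincomb:
  assumes "smooth f" "smooth g"
  shows "smooth (\<lambda>x. a * f x + b * g x)"
proof (rule smooth_family[where F = "range (\<lambda>k x. a * (deriv ^^ k) f x + b * (deriv ^^ k) g x)"])
  show "(\<lambda>x. a * f x + b * g x) \<in> range (\<lambda>k x. a * (deriv ^^ k) f x + b * (deriv ^^ k) g x)"
    by (rule image_eqI[of _ _ 0]) auto
  fix h assume "h \<in> range (\<lambda>k x. a * (deriv ^^ k) f x + b * (deriv ^^ k) g x)"
  then obtain k where h: "h = (\<lambda>x. a * (deriv ^^ k) f x + b * (deriv ^^ k) g x)" by auto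
  have "(h has_real_derivative a * (deriv ^^ Suc k) f x + b * (deriv ^^ Suc k) g x) (at x)" for x
    unfolding h by (intro DERIV_add DERIV_cmult smooth_deriv_DERIV assms)
  then show "\<exists>g'\<in>range (\<lambda>k x. a * (deriv ^^ k) f x + b * (deriv ^^ k) g x).
      \<forall>x. (h has_real_derivative g' x) (at x)"
    by (intro bexI[of _ "\<lambda>x. a * (deriv ^^ Suc k) f x + b * (deriv ^^ Suc k) g x"] allI rangeI)
qed

lemma abs_L2_lincomb:
  assumes "f square_integrable_on {0<..<1}" "g square_integrable_on {0<..<1}"
  shows "abs_L2 (\<lambda>x. a * f x + b * g x) = a *\<^sub>R abs_L2 f + b *\<^sub>R abs_L2 g"
proof (rule abs_L2_eqI)
  show "(\<lambda>x. a * f x + b * g x) square_integrable_on {0<..<1}"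
    by (intro square_integrable_add square_integrable_scale assms)
  show "AE x in lebesgue_on {0<..<1}.
      rep_L2 (a *\<^sub>R abs_L2 f + b *\<^sub>R abs_L2 g) x = a * f x + b * g x"
    using rep_L2_plus[of "a *\<^sub>R abs_L2 f" "b *\<^sub>R abs_L2 g"] rep_L2_scaleR[of a "abs_L2 f"]
      rep_L2_scaleR[of b "abs_L2 g"] rep_abs_L2[OF assms(1)] rep_abs_L2[OF assms(2)]
    by eventually_elim simp
qed

lemma W12_0_01_lincomb:
  assumes "u \<in> W12_0_01" "v \<in> W12_0_01"
  shows "a *\<^sub>R u + b *\<^sub>R v \<in> W12_0_01"
proof -
  obtain \<phi> where \<phi>: "\<And>n. test_function_on {0<..<1} (\<phi> n)"
    "(\<lambda>n. abs_L2 (\<phi> n)) \<longlonglongrightarrow> u" "(\<lambda>n. abs_L2 (deriv (\<phi> n))) \<longlonglongrightarrow> L2_wderiv u"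
    using assms(1) by (auto simp: W12_0_01_def)
  obtain \<psi> where \<psi>: "\<And>n. test_function_on {0<..<1} (\<psi> n)"
    "(\<lambda>n. abs_L2 (\<psi> n)) \<longlonglongrightarrow> v" "(\<lambda>n. abs_L2 (deriv (\<psi> n))) \<longlonglongrightarrow> L2_wderiv v"
    using assms(2) by (auto simp: W12_0_01_def)
  have W: "u \<in> W12_01" "v \<in> W12_01" using assms by (auto simp: W12_0_01_def)
  let ?f = "\<lambda>n x. a * \<phi> n x + b * \<psi> n x"
  have "test_function_on {0<..<1} (?f n)" for n
  proof -
    obtain K L where "compact K" "K \<subseteq> {0<..<1}" "\<And>x. x \<notin> K \<Longrightarrow> \<phi> n x = 0"
      and "compact L" "L \<subseteq> {0<..<1}" "\<And>x. x \<notin> L \<Longrightarrow> \<psi> n x = 0"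
      using \<phi>(1)[of n] \<psi>(1)[of n] by (auto simp: test_function_on_def)
    then show ?thesis
      using \<phi>(1)[of n] \<psi>(1)[of n] unfolding test_function_on_def
      by (intro conjI smooth_lincomb exI[of _ "K \<union> L"]) auto
  qed
  moreover have "(\<lambda>n. abs_L2 (?f n)) \<longlonglongrightarrow> a *\<^sub>R u + b *\<^sub>R v"
    unfolding abs_L2_lincomb[OF test_function_square_integrable[OF \<phi>(1)] test_function_square_integrable[OF \<psi>(1)]]
    by (intro tendsto_intros \<phi> \<psi>)
  moreover have "(\<lambda>n. abs_L2 (deriv (?f n))) \<longlonglongrightarrow> L2_wderiv (a *\<^sub>R u + b *\<^sub>R v)"
  proof -
    have "deriv (?f n) = (\<lambda>x. a * deriv (\<phi> n) x + b * deriv (\<psi> n) x)" for n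
    proof
      fix x
      have "(\<phi> n has_real_derivative deriv (\<phi> n) x) (at x)" "(\<psi> n has_real_derivative deriv (\<psi> n) x) (at x)"
        using smooth_deriv_DERIV[of _ 0] \<phi>(1) \<psi>(1) by (auto simp: test_function_on_def)
      then show "deriv (?f n) x = a * deriv (\<phi> n) x + b * deriv (\<psi> n) x"
        by (intro DERIV_imp_deriv DERIV_add DERIV_cmult)
    qed
    then have "abs_L2 (deriv (?f n)) = a *\<^sub>R abs_L2 (deriv (\<phi> n)) + b *\<^sub>R abs_L2 (deriv (\<psi> n))" for n
      by (simp add: abs_L2_lincomb[OF test_function_square_integrable[OF test_function_deriv[OF \<phi>(1)]]
            test_function_square_integrable[OF test_function_deriv[OF \<psi>(1)]]])
    then show ?thesis
      unfolding L2_wderiv_lincomb(2)[OF W] by (simp only:) (intro tendsto_intros \<phi> \<psi>)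
  qed
  ultimately show ?thesis
    using L2_wderiv_lincomb(1)[OF W] unfolding W12_0_01_def
    by (intro CollectI conjI exI[of _ ?f] allI)
qed

lemma zero_W12_0_01: "0 \<in> W12_0_01" and zero_W22_01: "0 \<in> W22_01" and L2_wderiv_zero: "L2_wderiv 0 = 0"
proof -
  have wd: "weak_derivative_on {0<..<1} (rep_L2 0) (rep_L2 0)"
    by (simp add: weak_derivative_L2_iff)
  then show wd0: "L2_wderiv 0 = 0" by (rule L2_wderiv_unique)
  have W: "0 \<in> W12_01" using wd unfolding W12_01_def by blast
  then show "0 \<in> W22_01" by (simp add: W22_01_def wd0)
  have "test_function_on {0<..<1} (\<lambda>_. 0)"
    unfolding test_function_on_def using smooth_mult[OF smooth_id smooth_id] smooth_lincomb[OF smooth_id smooth_id, of 0 0]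
    by auto
  moreover have "deriv (\<lambda>_::real. 0::real) = (\<lambda>_. 0)" by auto
  moreover have "abs_L2 (\<lambda>_. 0) = 0" by (simp add: zero_L2_def)
  ultimately show "0 \<in> W12_0_01"
    using W unfolding W12_0_01_def
    by (intro CollectI conjI exI[of _ "\<lambda>_ _. 0"]) (simp_all add: wd0)
qed

lemma W12_0_01_definite:
  assumes u: "u \<in> W12_0_01" "L2_wderiv u \<in> W12_01" and zero: "L2_wderiv (L2_wderiv u) = 0"
  shows "u = 0"
proof -
  obtain \<phi> where \<phi>: "\<And>n. test_function_on {0<..<1} (\<phi> n)"
    "(\<lambda>n. abs_L2 (\<phi> n)) \<longlonglongrightarrow> u" "(\<lambda>n. abs_L2 (deriv (\<phi> n))) \<longlonglongrightarrow> L2_wderiv u"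
    using u by (auto simp: W12_0_01_def)
  have uW: "u \<in> W12_01" using u by (simp add: W12_0_01_def)
  have "(\<lambda>n. abs_L2 (deriv (\<phi> n)) \<bullet> L2_wderiv u) \<longlonglongrightarrow> L2_wderiv u \<bullet> L2_wderiv u"
    by (intro tendsto_intros \<phi>)
  moreover have "abs_L2 (deriv (\<phi> n)) \<bullet> L2_wderiv u = 0" for n
    using W12_01_test[OF u(2) \<phi>(1)] zero by simp
  ultimately have wd0: "L2_wderiv u = 0" by (simp add: LIMSEQ_const_iff)
  have bound: "\<bar>abs_L2 (\<phi> n) \<bullet> u\<bar> \<le> norm (abs_L2 (deriv (\<phi> n))) * norm u" for n
  proof -
    let ?d = "deriv (\<phi> n)"
    have D: "(\<phi> n has_real_derivative ?d x) (at x)" for x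
      using smooth_deriv_DERIV[of "\<phi> n" 0] \<phi>(1) by (simp add: test_function_on_def)
    have test: "test_function_on {0<..<1} (\<lambda>x. x * \<phi> n x)"
      using \<phi>(1)[of n] unfolding test_function_on_def by (auto intro: smooth_mult smooth_id)
    have deriv: "deriv (\<lambda>x. x * \<phi> n x) = (\<lambda>x. 1 * \<phi> n x + 1 * (x * ?d x))"
    proof
      fix x show "deriv (\<lambda>x. x * \<phi> n x) x = 1 * \<phi> n x + 1 * (x * ?d x)"
        using DERIV_mult[OF DERIV_ident D[of x]] by (intro DERIV_imp_deriv) (simp add: mult_ac add_ac)
    qed
    have dsq: "?d square_integrable_on {0<..<1}"
      by (rule test_function_square_integrable[OF test_function_deriv[OF \<phi>(1)]])
    have dsq': "(\<lambda>x. \<bar>?d x\<bar>) square_integrable_on {0<..<1}"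
      using dsq by (auto simp: square_integrable_on_def)
    have xsq: "(\<lambda>x. x * ?d x) square_integrable_on {0<..<1}"
    proof (rule square_integrable_bound[OF dsq'])
      show "(\<lambda>x. x * ?d x) \<in> borel_measurable (lebesgue_on {0<..<1})"
        by (intro borel_measurable_times square_integrable_imp_measurable[OF dsq])
          (simp add: borel_imp_lebesgue_on)
      show "AE x in lebesgue_on {0<..<1}. \<bar>x * ?d x\<bar> \<le> \<bar>?d x\<bar>"
        by (rule AE_I2) (auto simp: abs_mult intro!: mult_left_le_one_le)
    qed
    have "abs_L2 (deriv (\<lambda>x. x * \<phi> n x)) = abs_L2 (\<phi> n) + abs_L2 (\<lambda>x. x * ?d x)"
      unfolding deriv abs_L2_lincomb[OF test_function_square_integrable[OF \<phi>(1)] xsq] by simp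
    then have "abs_L2 (\<phi> n) \<bullet> u = - (abs_L2 (\<lambda>x. x * ?d x) \<bullet> u)"
      using W12_01_test[OF uW test] wd0 by (simp add: inner_add_left)
    then have "\<bar>abs_L2 (\<phi> n) \<bullet> u\<bar> \<le> norm (abs_L2 (\<lambda>x. x * ?d x)) * norm u"
      using Cauchy_Schwarz_ineq2[of "abs_L2 (\<lambda>x. x * ?d x)" u] by simp
    also have "norm (abs_L2 (\<lambda>x. x * ?d x)) \<le> norm (abs_L2 ?d)"
    proof -
      have "AE x in lebesgue_on {0<..<1}. (rep_L2 (abs_L2 (\<lambda>x. x * ?d x)) x)\<^sup>2 \<le> (rep_L2 (abs_L2 ?d) x)\<^sup>2"
        using rep_abs_L2[OF xsq] rep_abs_L2[OF dsq] AE_space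
      proof eventually_elim
        case (elim x)
        then have "\<bar>x * ?d x\<bar> \<le> \<bar>?d x\<bar>" by (auto simp: abs_mult intro!: mult_left_le_one_le)
        then show ?case using elim by (simp only: abs_le_square_iff)
      qed
      then show ?thesis
        unfolding norm_L2_rep using rep_L2_square_integrable
        by (intro real_sqrt_le_mono integral_mono_AE) (auto simp: square_integrable_on_def)
    qed
    finally show ?thesis by (simp add: mult_right_mono)
  qed
  have "(\<lambda>n. norm (abs_L2 (deriv (\<phi> n))) * norm u) \<longlonglongrightarrow> norm (L2_wderiv u) * norm u"
    by (intro tendsto_intros \<phi>)
  then have "(\<lambda>n. norm (abs_L2 (deriv (\<phi> n))) * norm u) \<longlonglongrightarrow> 0" by (simp add: wd0)
  then have "(\<lambda>n. abs_L2 (\<phi> n) \<bullet> u) \<longlonglongrightarrow> 0"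
    by (rule Lim_null_comparison[rotated]) (simp add: bound)
  moreover have "(\<lambda>n. abs_L2 (\<phi> n) \<bullet> u) \<longlonglongrightarrow> u \<bullet> u" by (intro tendsto_intros \<phi>)
  ultimately have "u \<bullet> u = 0" using LIMSEQ_unique by blast
  then show ?thesis by simp
qed

text \<open>
  \<open>W22\<close> is $W^{2,2}(0,1)$ with its usual norm, \<open>W22_0\<close> is $W^{2,2}(0,1) \cap W^{1,2}_0(0,1)$ with the
  norm $\|u''\|_{L^2}$.
\<close>

typedef W22 = W22_01 morphisms W22_to_L2 Abs_W22
  using zero_W22_01 by blast

typedef W22_0 = "W22_01 \<inter> W12_0_01" morphisms W22_0_to_L2 Abs_W22_0
  using zero_W22_01 zero_W12_0_01 by blast

setup_lifting type_definition_W22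
setup_lifting type_definition_W22_0

lemma lincomb_imp_closed:
  fixes S :: "'a::real_vector set"
  assumes "\<And>u v a b. u \<in> S \<Longrightarrow> v \<in> S \<Longrightarrow> a *\<^sub>R u + b *\<^sub>R v \<in> S"
  shows "u \<in> S \<Longrightarrow> v \<in> S \<Longrightarrow> u + v \<in> S" "u \<in> S \<Longrightarrow> v \<in> S \<Longrightarrow> u - v \<in> S"
    "u \<in> S \<Longrightarrow> - u \<in> S" "u \<in> S \<Longrightarrow> c *\<^sub>R u \<in> S"
  using assms[of u v 1 1] assms[of u v 1 "-1"] assms[of u u "-1" 0] assms[of u u c 0] by simp_all

lemmas W22_01_closed = lincomb_imp_closed[of W22_01, OF W22_01_lincomb]

lemma W22_0_01_lincomb:
  "u \<in> W22_01 \<inter> W12_0_01 \<Longrightarrow> v \<in> W22_01 \<inter> W12_0_01 \<Longrightarrow> a *\<^sub>R u + b *\<^sub>R v \<in> W22_01 \<inter> W12_0_01"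
  by (simp add: W22_01_lincomb W12_0_01_lincomb)

lemmas W22_0_01_closed = lincomb_imp_closed[of "W22_01 \<inter> W12_0_01", OF W22_0_01_lincomb]

lemma L2_wderiv_add: "u \<in> W12_01 \<Longrightarrow> v \<in> W12_01 \<Longrightarrow> L2_wderiv (u + v) = L2_wderiv u + L2_wderiv v"
  using L2_wderiv_lincomb(2)[of u v 1 1] by simp

lemma L2_wderiv_scaleR: "u \<in> W12_01 \<Longrightarrow> L2_wderiv (c *\<^sub>R u) = c *\<^sub>R L2_wderiv u"
  using L2_wderiv_lincomb(2)[of u u c 0] by simp

instantiation W22 :: real_inner
begin

lift_definition zero_W22 :: W22 is 0 by (rule zero_W22_01)
lift_definition plus_W22 :: "W22 \<Rightarrow> W22 \<Rightarrow> W22" is "(+)" by (rule W22_01_closed)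
lift_definition minus_W22 :: "W22 \<Rightarrow> W22 \<Rightarrow> W22" is "(-)" by (rule W22_01_closed)
lift_definition uminus_W22 :: "W22 \<Rightarrow> W22" is uminus by (rule W22_01_closed)
lift_definition scaleR_W22 :: "real \<Rightarrow> W22 \<Rightarrow> W22" is scaleR by (rule W22_01_closed)
lift_definition inner_W22 :: "W22 \<Rightarrow> W22 \<Rightarrow> real" is
  "\<lambda>u v. u \<bullet> v + L2_wderiv u \<bullet> L2_wderiv v + L2_wderiv (L2_wderiv u) \<bullet> L2_wderiv (L2_wderiv v)" .
lift_definition norm_W22 :: "W22 \<Rightarrow> real" is
  "\<lambda>u. sqrt ((norm u)\<^sup>2 + (norm (L2_wderiv u))\<^sup>2 + (norm (L2_wderiv (L2_wderiv u)))\<^sup>2)" .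
definition sgn_W22 :: "W22 \<Rightarrow> W22" where "sgn_W22 u = inverse (norm u) *\<^sub>R u"
definition dist_W22 :: "W22 \<Rightarrow> W22 \<Rightarrow> real" where "dist_W22 u v = norm (u - v)"
definition uniformity_W22 :: "(W22 \<times> W22) filter" where
  "uniformity_W22 = (INF e\<in>{0<..}. principal {(x, y). dist x y < e})"
definition open_W22 :: "W22 set \<Rightarrow> bool" where
  "open_W22 U \<longleftrightarrow> (\<forall>x\<in>U. \<forall>\<^sub>F (x', y) in uniformity. x' = x \<longrightarrow> y \<in> U)"

instance
proof
  fix a b :: real and u v w :: W22
  show "u + v + w = u + (v + w)" by transfer simp
  show "u + v = v + u" by transfer simp
  show "0 + u = u" by transfer simp
  show "- u + u = 0" by transfer simp
  show "u - v = u + - v" by transfer simp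
  show "a *\<^sub>R (u + v) = a *\<^sub>R u + a *\<^sub>R v" by transfer (simp add: scaleR_add_right)
  show "(a + b) *\<^sub>R u = a *\<^sub>R u + b *\<^sub>R u" by transfer (simp add: scaleR_add_left)
  show "a *\<^sub>R b *\<^sub>R u = (a * b) *\<^sub>R u" by transfer simp
  show "1 *\<^sub>R u = u" by transfer simp
  show "u \<bullet> v = v \<bullet> u" by transfer (simp add: inner_commute)
  show "(u + v) \<bullet> w = u \<bullet> w + v \<bullet> w"
    by transfer (auto simp: W22_01_def L2_wderiv_add inner_add_left)
  show "(a *\<^sub>R u) \<bullet> v = a * (u \<bullet> v)"
    by transfer (auto simp: W22_01_def L2_wderiv_scaleR algebra_simps)
  show "0 \<le> u \<bullet> u" by transfer simp
  show "u \<bullet> u = 0 \<longleftrightarrow> u = 0"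
    by transfer (auto simp: L2_wderiv_zero add_nonneg_eq_0_iff)
  show "norm u = sqrt (u \<bullet> u)" by transfer (simp add: power2_norm_eq_inner)
qed (simp_all add: sgn_W22_def dist_W22_def uniformity_W22_def open_W22_def)

end

instance W22 :: second_countable_topology
proof
  let ?j = "\<lambda>u. (W22_to_L2 u, L2_wderiv (W22_to_L2 u), L2_wderiv (L2_wderiv (W22_to_L2 u)))"
  have "dist (?j u) (?j v) = dist u v" for u v
  proof -
    have "?j u = ?j ((u - v) + v)" by simp
    also have "\<dots> = ?j (u - v) + ?j v"
      by (simp only: plus_W22.rep_eq plus_prod_def fst_conv snd_conv)
        (use W22_to_L2[of "u - v"] W22_to_L2[of v] in \<open>simp add: W22_01_def L2_wderiv_add\<close>)
    finally have "?j u - ?j v = ?j (u - v)" by (simp only: diff_eq_eq)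
    then have "dist (?j u) (?j v) = norm (?j (u - v))" by (simp only: dist_norm)
    then show ?thesis by (simp add: dist_norm norm_Pair norm_W22.rep_eq add.assoc)
  qed
  then show "\<exists>B::W22 set set. countable B \<and> open = generate_topology B"
    by (rule subbasis_if_isometry)
qed

instantiation W22_0 :: real_inner
begin

lift_definition zero_W22_0 :: W22_0 is 0 by (simp add: zero_W22_01 zero_W12_0_01)
lift_definition plus_W22_0 :: "W22_0 \<Rightarrow> W22_0 \<Rightarrow> W22_0" is "(+)" by (rule W22_0_01_closed)
lift_definition minus_W22_0 :: "W22_0 \<Rightarrow> W22_0 \<Rightarrow> W22_0" is "(-)" by (rule W22_0_01_closed)
lift_definition uminus_W22_0 :: "W22_0 \<Rightarrow> W22_0" is uminus by (rule W22_0_01_closed)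
lift_definition scaleR_W22_0 :: "real \<Rightarrow> W22_0 \<Rightarrow> W22_0" is scaleR by (rule W22_0_01_closed)
lift_definition inner_W22_0 :: "W22_0 \<Rightarrow> W22_0 \<Rightarrow> real" is
  "\<lambda>u v. L2_wderiv (L2_wderiv u) \<bullet> L2_wderiv (L2_wderiv v)" .
lift_definition norm_W22_0 :: "W22_0 \<Rightarrow> real" is "\<lambda>u. norm (L2_wderiv (L2_wderiv u))" .
definition sgn_W22_0 :: "W22_0 \<Rightarrow> W22_0" where "sgn_W22_0 u = inverse (norm u) *\<^sub>R u"
definition dist_W22_0 :: "W22_0 \<Rightarrow> W22_0 \<Rightarrow> real" where "dist_W22_0 u v = norm (u - v)"
definition uniformity_W22_0 :: "(W22_0 \<times> W22_0) filter" where
  "uniformity_W22_0 = (INF e\<in>{0<..}. principal {(x, y). dist x y < e})"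
definition open_W22_0 :: "W22_0 set \<Rightarrow> bool" where
  "open_W22_0 U \<longleftrightarrow> (\<forall>x\<in>U. \<forall>\<^sub>F (x', y) in uniformity. x' = x \<longrightarrow> y \<in> U)"

instance
proof
  fix a b :: real and u v w :: W22_0
  show "u + v + w = u + (v + w)" by transfer simp
  show "u + v = v + u" by transfer simp
  show "0 + u = u" by transfer simp
  show "- u + u = 0" by transfer simp
  show "u - v = u + - v" by transfer simp
  show "a *\<^sub>R (u + v) = a *\<^sub>R u + a *\<^sub>R v" by transfer (simp add: scaleR_add_right)
  show "(a + b) *\<^sub>R u = a *\<^sub>R u + b *\<^sub>R u" by transfer (simp add: scaleR_add_left)
  show "a *\<^sub>R b *\<^sub>R u = (a * b) *\<^sub>R u" by transfer simp
  show "1 *\<^sub>R u = u" by transfer simp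
  show "u \<bullet> v = v \<bullet> u" by transfer (simp add: inner_commute)
  show "(u + v) \<bullet> w = u \<bullet> w + v \<bullet> w"
    by transfer (auto simp: W22_01_def L2_wderiv_add inner_add_left)
  show "(a *\<^sub>R u) \<bullet> v = a * (u \<bullet> v)"
    by transfer (auto simp: W22_01_def L2_wderiv_scaleR)
  show "0 \<le> u \<bullet> u" by transfer simp
  show "u \<bullet> u = 0 \<longleftrightarrow> u = 0"
    by transfer (auto simp: L2_wderiv_zero W22_01_def intro: W12_0_01_definite)
  show "norm u = sqrt (u \<bullet> u)" by transfer (simp add: norm_eq_sqrt_inner)
qed (simp_all add: sgn_W22_0_def dist_W22_0_def uniformity_W22_0_def open_W22_0_def)

end

instance W22_0 :: second_countable_topology
proof
  let ?j = "\<lambda>u. L2_wderiv (L2_wderiv (W22_0_to_L2 u))"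
  have "dist (?j u) (?j v) = dist u v" for u v
  proof -
    have "?j u = ?j ((u - v) + v)" by simp
    also have "\<dots> = ?j (u - v) + ?j v"
      by (simp only: plus_W22_0.rep_eq)
        (use W22_0_to_L2[of "u - v"] W22_0_to_L2[of v] in \<open>simp add: W22_01_def L2_wderiv_add\<close>)
    finally have "?j u - ?j v = ?j (u - v)" by simp
    then show ?thesis by (simp add: dist_norm norm_W22_0.rep_eq)
  qed
  then show "\<exists>B::W22_0 set set. countable B \<and> open = generate_topology B"
    by (rule subbasis_if_isometry)
qed

lift_definition W22_0_to_W22 :: "W22_0 \<Rightarrow> W22" is "\<lambda>u. u" by simp

section \<open>Energy and obstacle\<close>

definition energy :: "W22_0 \<Rightarrow> real" where
  "energy u = (LINT x|lebesgue_on {0<..<1}.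
     (rep_L2 (L2_wderiv (L2_wderiv (W22_0_to_L2 u))) x)\<^sup>2 /
     (1 + (rep_L2 (L2_wderiv (W22_0_to_L2 u)) x)\<^sup>2) powr (5 / 2))"

definition c0 :: real where
  "c0 = (LINT t|lborel. (1 + t\<^sup>2) powr (- 5 / 4))"

definition obstacle :: "(real \<Rightarrow> real) \<Rightarrow> bool" where
  "obstacle \<psi> \<longleftrightarrow>
     continuous_on {0..1} \<psi> \<and> \<psi> 0 < 0 \<and> \<psi> 1 < 0 \<and> (\<exists>x0\<in>{0<..<1}. \<psi> x0 > 0)"

definition admissible :: "(real \<Rightarrow> real) \<Rightarrow> W22_0 set" where
  "admissible \<psi> = {u. AE x in lebesgue_on {0<..<1}. rep_L2 (W22_0_to_L2 u) x \<ge> \<psi> x}"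

section \<open>Gradient flows\<close>

text \<open>
  The elements of $W^{2,2}(0,1)$ have a unique representative in $C^1([0,1])$, with one-sided
  derivatives at the end points.
\<close>

definition C1_representative :: "L2 \<Rightarrow> real \<Rightarrow> real" where
  "C1_representative u = (SOME f.
     (\<exists>f'. continuous_on {0..1} f' \<and>
           (\<forall>x\<in>{0..1}. (f has_real_derivative f' x) (at x within {0..1}))) \<and>
     (AE x in lebesgue_on {0<..<1}. f x = rep_L2 u x))"

definition C1_norm :: "(real \<Rightarrow> real) \<Rightarrow> real" where
  "C1_norm f = (SUP x\<in>{0..1}. \<bar>f x\<bar>) + (SUP x\<in>{0..1}. \<bar>vector_derivative f (at x within {0..1})\<bar>)"

definition C1_dist :: "W22_0 \<Rightarrow> W22_0 \<Rightarrow> real" where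
  "C1_dist u v =
     C1_norm (\<lambda>x. C1_representative (W22_0_to_L2 u) x - C1_representative (W22_0_to_L2 v) x)"

text \<open>Membership in $C([0,\infty), C^1([0,1]))$; values at negative times play no role.\<close>

definition C1_continuous :: "(real \<Rightarrow> W22_0) \<Rightarrow> bool" where
  "C1_continuous u \<longleftrightarrow> (\<forall>t\<ge>0. ((\<lambda>s. C1_dist (u s) (u t)) \<longlongrightarrow> 0) (at t within {0..}))"

text \<open>
  All target spaces below are separable, so that Borel measurability with respect to the complete
  measure \<^term>\<open>lebesgue_on S\<close> is the same as strong (Bochner) measurability.
\<close>

definition Linfty_on ::
    "real set \<Rightarrow> (real \<Rightarrow> 'b::{real_normed_vector, second_countable_topology}) \<Rightarrow> bool" where
  "Linfty_on S u \<longleftrightarrow>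
     u \<in> borel_measurable (lebesgue_on S) \<and> (\<exists>C. AE t in lebesgue_on S. norm (u t) \<le> C)"

definition D12_on ::
    "real set \<Rightarrow> (real \<Rightarrow> 'b::{banach, second_countable_topology}) \<Rightarrow> bool" where
  "D12_on S u \<longleftrightarrow> (\<exists>v. weak_derivative_on S u v \<and> v square_integrable_on S)"

text \<open>The weak derivative is unique up to a null set; some version of it is selected.\<close>

definition wderiv_on ::
    "real set \<Rightarrow> (real \<Rightarrow> 'b::{banach, second_countable_topology}) \<Rightarrow> real \<Rightarrow> 'b" where
  "wderiv_on S u = (SOME v. weak_derivative_on S u v)"

abbreviation time_deriv :: "(real \<Rightarrow> W22_0) \<Rightarrow> real \<Rightarrow> L2" where
  "time_deriv u \<equiv> wderiv_on {0<..} (\<lambda>t. W22_0_to_L2 (u t))"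

text \<open>
  Values of \<open>u\<close> at times \<open>t < 0\<close> are irrelevant. The conditions are invariant under changing \<open>u\<close> on a
  null set of times; \<^const>\<open>C1_continuous\<close> singles out the continuous representative, whose values
  lie in $W^{2,2}(0,1) \cap W^{1,2}_0(0,1)$ at every time because \<open>u\<close> is bounded in that space.
\<close>

definition fvi_gradient_flow :: "(real \<Rightarrow> real) \<Rightarrow> W22_0 \<Rightarrow> (real \<Rightarrow> W22_0) \<Rightarrow> bool" where
  "fvi_gradient_flow \<psi> u0 u \<longleftrightarrow>
     Linfty_on {0<..} u \<and> D12_on {0<..} (\<lambda>t. W22_0_to_L2 (u t)) \<and>
     (AE t in lebesgue_on {0<..}. u t \<in> admissible \<psi>) \<and>
     (\<exists>\<phi>. antimono_on {0..} \<phi> \<and> \<phi> 0 = energy u0 \<and>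
        (AE t in lebesgue_on {0<..}. energy (u t) = \<phi> t)) \<and>
     (\<exists>w. continuous_on {0..} w \<and> w 0 = W22_0_to_L2 u0 \<and>
        (AE t in lebesgue_on {0<..}. w t = W22_0_to_L2 (u t))) \<and>
     (AE t in lebesgue_on {0<..}. \<forall>v\<in>admissible \<psi>.
        time_deriv u t \<bullet> (W22_0_to_L2 v - W22_0_to_L2 (u t)) +
        frechet_derivative energy (at (u t)) (v - u t) \<ge> 0)"

definition minimizing_movement ::
    "(real \<Rightarrow> real) \<Rightarrow> W22_0 \<Rightarrow> real \<Rightarrow> (nat \<Rightarrow> W22_0) \<Rightarrow> bool" where
  "minimizing_movement \<psi> u0 \<tau> U \<longleftrightarrow> U 0 = u0 \<and>
     (\<forall>k. is_arg_min
        (\<lambda>w. energy w + 1 / (2 * \<tau>) * (norm (W22_0_to_L2 w - W22_0_to_L2 (U k)))\<^sup>2)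
        (\<lambda>w. w \<in> admissible \<psi>) (U (Suc k)))"

text \<open>For \<open>t \<in> (k\<tau>, (k+1)\<tau>]\<close> one has \<open>k = \<lceil>t/\<tau>\<rceil> - 1\<close>.\<close>

definition interpolation :: "real \<Rightarrow> (nat \<Rightarrow> W22_0) \<Rightarrow> real \<Rightarrow> W22_0" where
  "interpolation \<tau> U t =
     (if t \<le> 0 then U 0
      else let k = nat (\<lceil>t / \<tau>\<rceil> - 1) in U k + ((t - real k * \<tau>) / \<tau>) *\<^sub>R (U (Suc k) - U k))"

definition weakly_tendsto :: "(nat \<Rightarrow> 'a::real_normed_vector) \<Rightarrow> 'a \<Rightarrow> bool" where
  "weakly_tendsto x l \<longleftrightarrow>
     (\<forall>F::'a \<Rightarrow> real. bounded_linear F \<longrightarrow> (\<lambda>n. F (x n)) \<longlonglongrightarrow> F l)"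

definition W12_on ::
    "real set \<Rightarrow> (real \<Rightarrow> 'b::{banach, second_countable_topology}) \<Rightarrow> bool" where
  "W12_on S u \<longleftrightarrow> u square_integrable_on S \<and> D12_on S u"

definition W12_norm_on ::
    "real set \<Rightarrow> (real \<Rightarrow> 'b::{banach, second_countable_topology}) \<Rightarrow> real" where
  "W12_norm_on S u = sqrt ((LINT t|lebesgue_on S. (norm (u t))\<^sup>2) +
     (LINT t|lebesgue_on S. (norm (wderiv_on S u t))\<^sup>2))"

text \<open>
  Weak convergence in $W^{1,2}(S, V)$, that is, under all bounded linear functionals. Elements of that
  space are represented by functions; a functional \<open>F\<close> as below respects equality almost everywhere on
  \<open>S\<close>, because it is bounded by the seminorm \<open>W12_norm_on S\<close>.
\<close>

definition weakly_tendsto_W12_on ::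
    "real set \<Rightarrow> (nat \<Rightarrow> real \<Rightarrow> 'b::{banach, second_countable_topology}) \<Rightarrow>
     (real \<Rightarrow> 'b) \<Rightarrow> bool" where
  "weakly_tendsto_W12_on S f g \<longleftrightarrow>
     (\<forall>n. W12_on S (f n)) \<and> W12_on S g \<and>
     (\<forall>F :: (real \<Rightarrow> 'b) \<Rightarrow> real.
        (\<forall>v w a b. W12_on S v \<longrightarrow> W12_on S w \<longrightarrow>
           F (\<lambda>t. a *\<^sub>R v t + b *\<^sub>R w t) = a * F v + b * F w) \<longrightarrow>
        (\<exists>C. \<forall>v. W12_on S v \<longrightarrow> \<bar>F v\<bar> \<le> C * W12_norm_on S v) \<longrightarrow>
        (\<lambda>n. F (f n)) \<longlonglongrightarrow> F g)"

definition minimizing_movement_limit ::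
    "(real \<Rightarrow> real) \<Rightarrow> W22_0 \<Rightarrow> (real \<Rightarrow> W22_0) \<Rightarrow> bool" where
  "minimizing_movement_limit \<psi> u0 u \<longleftrightarrow>
     Linfty_on {0<..} (\<lambda>t. W22_0_to_W22 (u t)) \<and> D12_on {0<..} (\<lambda>t. W22_0_to_L2 (u t)) \<and>
     (\<exists>\<tau> U. (\<forall>n. \<tau> n > 0 \<and> minimizing_movement \<psi> u0 (\<tau> n) (U n)) \<and> \<tau> \<longlonglongrightarrow> 0 \<and>
        (\<forall>T>0. weakly_tendsto_W12_on {0<..<T}
             (\<lambda>n t. W22_0_to_L2 (interpolation (\<tau> n) (U n) t)) (\<lambda>t. W22_0_to_L2 (u t)) \<and>
           uniform_limit {0..T}
             (\<lambda>n t. C1_dist (interpolation (\<tau> n) (U n) t) (u t)) (\<lambda>_. 0) sequentially) \<and>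
        (\<forall>t>0. weakly_tendsto
           (\<lambda>n. W22_0_to_W22 (interpolation (\<tau> n) (U n) t)) (W22_0_to_W22 (u t))))"

end

theory Submission
  imports Defs
begin

text \<open>
  Comparing each minimizer with its predecessor and summing gives
  $\mathcal{E}(u_{m\tau}) + \frac12 \int_0^T \|\dot u^\tau\|^2 \le \mathcal{E}(u_0)$ whenever
  $T \le m\tau$, and it remains to pass to the limit. For the energy, write
  $\mathcal{E}(w) = \|A(w)\|^2$, where $A(w) = w''(1 + w'^2)^{-5/4}$ is the weak derivative of
  $G(w')$ for a primitive $G$ of $(1 + s^2)^{-5/4}$. Since $G$ is a contraction, convergence of
  $w'$ in $L^2$ makes $A(w)$ converge when tested against smooth functions. For the dissipation,
  $\dot u^\tau$ converges weakly. Both terms are then bounded below by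
  $\|a\|^2 \ge 2(a, b) - \|b\|^2$ with $b$ a smooth approximation of $A(u(T))$ and $b = \dot u$,
  respectively.
\<close>

section \<open>Functions orthogonal to all test functions\<close>

text \<open>Minimality bounds the energy only at the discrete values \<open>U k\<close>. The energy
  is not convex, so nothing follows for the interpolant between two of them, and \<open>T\<close> is
  in general no grid time. The energy is therefore taken at the first grid time not before
  \<open>T\<close>; these times tend to \<open>T\<close>, and C^1 convergence, uniform on an
  interval reaching beyond \<open>T\<close>, together with continuity of \<open>u\<close> in C^1
  identifies the limit. The dissipation up to that grid time covers (0,T), so the overshoot has the
  right sign.

  The other obstacle is that w'' enters the energy quadratically, with a coefficient depending on
  w'. A is a derivative, and a derivative converges against a fixed test function as soon as the
  function itself does. The affine lower bounds then replace any extraction of weakly convergent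
  subsequences, in space as in time.

  Time derivatives are chosen versions of L^2-valued weak derivatives. Identities between them hold
  almost everywhere and rest on uniqueness, which is reduced to the real case by pairing with a
  countable dense set of vectors.\<close>

lemma AE_zero_if_integrals_atMost_zero:
  fixes f :: "real \<Rightarrow> real"
  assumes f: "integrable lebesgue f" and total: "(LINT t|lebesgue. f t) = 0"
    and zero: "\<And>x. (LINT t|lebesgue. indicat_real {..x} t * f t) = 0"
  shows "AE t in lebesgue. f t = 0"
proof -
  have int: "integrable lebesgue (\<lambda>t. indicat_real A t * f t)" if "A \<in> sets lebesgue" for A
    using integrable_mult_indicator[OF that f] by simp
  \<comment> \<open>Half-lines are stable under intersection and generate the Borel sets, so the
    vanishing of the integral spreads to all Borel sets: complements use \<open>total\<close>,
    disjoint unions use countable additivity.\<close>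
  have borel: "(LINT t|lebesgue. indicat_real A t * f t) = 0" if "A \<in> sets borel" for A
  proof -
    have "Int_stable (range (atMost :: real \<Rightarrow> real set))"
      by (auto simp: Int_stable_def)
    moreover have "range (atMost :: real \<Rightarrow> real set) \<subseteq> Pow UNIV" by simp
    moreover have "A \<in> sigma_sets UNIV (range atMost)"
      using that by (simp add: borel_eq_atMost)
    ultimately show ?thesis
    proof (induction A rule: sigma_sets_induct_disjoint)
      case (compl A)
      have A: "A \<in> sets lebesgue"
        by (rule sets_completionI_sets) (use compl(1) in \<open>simp add: borel_eq_atMost\<close>)
      have "(LINT t|lebesgue. indicat_real (UNIV - A) t * f t)
          = (LINT t|lebesgue. f t - indicat_real A t * f t)"
        by (intro Bochner_Integration.integral_cong) (auto simp: indicator_def)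
      also have "\<dots> = 0"
        using f int[OF A] total compl(2) by simp
      finally show ?case .
    next
      case (union A)
      have A: "A i \<in> sets lebesgue" for i
        by (rule sets_completionI_sets) (use union(2) in \<open>auto simp: borel_eq_atMost\<close>)
      have "(LINT t:(\<Union>i. A i)|lebesgue. f t) = (\<Sum>i. LINT t:A i|lebesgue. f t)"
        using union(1) A set_integrable_subset[of lebesgue UNIV f "\<Union>i. A i"] f
        by (intro lebesgue_integral_countable_add) (auto simp: disjoint_family_on_def set_integrable_def)
      then show ?case using union(3) by (simp add: set_lebesgue_integral_def)
    qed (use zero in auto)
  qed
  have neg: "AE t in lebesgue. g t \<le> 0" if g: "integrable lebesgue g"
    and g0: "\<And>A. A \<in> sets borel \<Longrightarrow> (LINT t|lebesgue. indicat_real A t * g t) = 0" for g :: "real \<Rightarrow> real"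
  proof -
    have gm: "g \<in> borel_measurable lebesgue" using g by auto
    then have "{t. g t > 0} \<in> sets lebesgue"
      using measurable_sets[OF gm, of "{0<..}"] by (simp add: vimage_def)
    \<comment> \<open>\<open>{t. g t > 0}\<close> is only Lebesgue measurable. Its Borel part
      \<open>A\<close> is enough: the rest is null, and on \<open>A\<close> a positive function has
      integral zero.\<close>
    then obtain A N N' where A: "{t. g t > 0} = A \<union> N" "N \<subseteq> N'" "N' \<in> null_sets lborel" "A \<in> sets lborel"
      using sets_completionE[of "{t. g t > 0}" lborel] by metis
    have N: "AE t in lebesgue. t \<notin> N"
      using A(2,3) by (intro AE_completion AE_I'[of N']) auto
    have AB: "A \<in> sets borel" using A(4) by simp
    have pos: "0 < g t" if "t \<in> A" for t using A(1) that by blast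
    have "integrable lebesgue (\<lambda>t. indicat_real A t * g t)"
      using AB integrable_mult_indicator[OF sets_completionI_sets[of A lborel] g] by simp
    then have "AE t in lebesgue. indicat_real A t * g t = 0"
      using g0[OF AB] pos by (subst (asm) integral_nonneg_eq_0_iff_AE) (auto simp: indicator_def less_imp_le intro!: AE_I2)
    with N show ?thesis
      by eventually_elim (use A(1) in \<open>auto simp: indicator_def not_less[symmetric]\<close>)
  qed
  have "AE t in lebesgue. f t \<le> 0" by (rule neg[OF f borel])
  moreover have "AE t in lebesgue. - f t \<le> 0" by (rule neg) (use f borel in auto)
  ultimately show ?thesis by eventually_elim simp
qed

text \<open>Local integrability gives measurability on compact subsets only. Compact intervals
  exhaust the open one, and \<open>f\<close> is the pointwise limit of its truncations to
  them.\<close>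

lemma locally_integrable_imp_measurable:
  fixes f :: "real \<Rightarrow> 'b::{banach, second_countable_topology}"
  assumes "f locally_integrable_on {a<..<b}"
  shows "f \<in> borel_measurable (lebesgue_on {a<..<b})"
proof (rule borel_measurable_LIMSEQ_metric)
  let ?K = "\<lambda>n. {a + 1 / Suc n..b - 1 / Suc n}"
  let ?f = "\<lambda>n x. indicat_real (?K n) x *\<^sub>R f x"
  have sub: "?K n \<subseteq> {a<..<b}" for n
  proof
    fix x assume "x \<in> ?K n"
    moreover have "1 / real (Suc n) > 0" by simp
    ultimately show "x \<in> {a<..<b}" by (simp only: atLeastAtMost_iff greaterThanLessThan_iff) linarith
  qed
  show "?f n \<in> borel_measurable (lebesgue_on {a<..<b})" for n
  proof -
    have "integrable (lebesgue_on (?K n)) f"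
      using assms sub unfolding locally_integrable_on_def by blast
    then have "integrable lebesgue (?f n)"
      by (subst (asm) integrable_restrict_space) auto
    then show ?thesis by (intro measurable_restrict_space1) auto
  qed
  show "(\<lambda>n. ?f n x) \<longlonglongrightarrow> f x" if "x \<in> space (lebesgue_on {a<..<b})" for x
  proof -
    have x: "min (x - a) (b - x) > 0" using that by simp
    then obtain N where N: "1 / Suc N < min (x - a) (b - x)" using nat_approx_posE by blast
    have "?f n x = f x" if "n \<ge> N" for n
    proof -
      have "1 / real (Suc n) \<le> 1 / Suc N" using that by (intro divide_left_mono) auto
      then have "x \<in> ?K n" using N by auto
      then show ?thesis by simp
    qed
    then show ?thesis by (intro tendsto_eventually) (auto simp: eventually_sequentially)
  qed
qed

lemma locally_integrable_test_mult:
  fixes f :: "real \<Rightarrow> 'b::{banach, second_countable_topology}"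
  assumes f: "f locally_integrable_on S" and \<phi>: "test_function_on S \<phi>" and S: "S \<in> sets lebesgue"
  shows "integrable (lebesgue_on S) (\<lambda>x. \<phi> x *\<^sub>R f x)"
proof -
  obtain K where K: "compact K" "K \<subseteq> S" "\<And>x. x \<notin> K \<Longrightarrow> \<phi> x = 0"
    using \<phi> by (auto simp: test_function_on_def)
  obtain c where c: "\<And>x. \<bar>\<phi> x\<bar> \<le> c" using test_function_bounded[OF \<phi>] by blast
  have Km: "K \<in> sets lebesgue" using K(1) by (simp add: lmeasurable_compact fmeasurableD)
  have "integrable (lebesgue_on K) f" using f K unfolding locally_integrable_on_def by blast
  then have i: "integrable lebesgue (\<lambda>x. indicat_real K x *\<^sub>R f x)"
    using Km by (subst (asm) integrable_restrict_space) auto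
  have "integrable lebesgue (\<lambda>x. \<phi> x *\<^sub>R indicat_real K x *\<^sub>R f x)"
  proof (rule Bochner_Integration.integrable_bound)
    show "integrable lebesgue (\<lambda>x. c *\<^sub>R norm (indicat_real K x *\<^sub>R f x))"
      using i by (intro integrable_scaleR_right integrable_norm)
    have "\<phi> \<in> borel_measurable lebesgue"
      by (intro measurable_completion) (simp add: borel_measurable_continuous_onI test_function_continuous[OF \<phi>])
    then show "(\<lambda>x. \<phi> x *\<^sub>R indicat_real K x *\<^sub>R f x) \<in> borel_measurable lebesgue"
      by (rule borel_measurable_scaleR) (use i in \<open>rule borel_measurable_integrable\<close>)
    have "norm (\<phi> x *\<^sub>R indicat_real K x *\<^sub>R f x) \<le> norm (c *\<^sub>R norm (indicat_real K x *\<^sub>R f x))" for x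
      using c[of x] by (auto simp: indicator_def abs_mult intro!: mult_right_mono)
    then show "AE x in lebesgue. norm (\<phi> x *\<^sub>R indicat_real K x *\<^sub>R f x)
        \<le> norm (c *\<^sub>R norm (indicat_real K x *\<^sub>R f x))" by simp
  qed
  also have "(\<lambda>x. \<phi> x *\<^sub>R indicat_real K x *\<^sub>R f x) = (\<lambda>x. indicat_real S x *\<^sub>R \<phi> x *\<^sub>R f x)"
    using K by (fastforce simp: indicator_def)
  finally show ?thesis using S by (subst integrable_restrict_space) auto
qed

text \<open>The fundamental lemma of the calculus of variations. Test functions approximate
  indicators of inner intervals boundedly, so \<open>d\<close> has integral zero over each of these.
  On a compact subinterval the half-line criterion then applies, and countably many such
  subintervals exhaust \<open>{a<..<b}\<close>.\<close>

lemma AE_zero_if_test_integrals_zero: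
  fixes d :: "real \<Rightarrow> real"
  assumes d: "d locally_integrable_on {a<..<b}"
    and zero: "\<And>\<phi>. test_function_on {a<..<b} \<phi> \<Longrightarrow> (LINT x|lebesgue_on {a<..<b}. \<phi> x * d x) = 0"
  shows "AE x in lebesgue_on {a<..<b}. d x = 0"
proof -
  have Icc: "integrable lebesgue (\<lambda>t. indicat_real {c..e} t * d t)" if "a < c" "e < b" for c e
  proof -
    have "integrable (lebesgue_on {c..e}) d"
      using d that unfolding locally_integrable_on_def by (elim allE[of _ "{c..e}"]) auto
    then show ?thesis by (subst (asm) integrable_restrict_space) auto
  qed
  have Ioo: "(LINT t|lebesgue. indicat_real {c<..<e} t * d t) = 0" if ce: "a < c" "e < b" for c e
  proof -
    obtain \<phi> where \<phi>: "\<And>n. test_function_on {c<..<e} (\<phi> n)" "\<And>n x. \<bar>\<phi> n x\<bar> \<le> 1"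
      "\<And>x. (\<lambda>n. \<phi> n x) \<longlonglongrightarrow> indicat_real {c<..<e} x"
      using test_function_approx_indicator by blast
    have out: "\<phi> n x = 0" if "x \<notin> {c..e}" for n x
      using \<phi>(1)[of n] that unfolding test_function_on_def by force
    have t: "test_function_on {a<..<b} (\<phi> n)" for n
      by (rule test_function_mono[OF \<phi>(1)]) (use ce in auto)
    have dm: "(\<lambda>t. indicat_real {c..e} t * d t) \<in> borel_measurable lebesgue" using Icc[OF ce] by auto
    \<comment> \<open>The factor \<open>indicat_real {c..e}\<close> does not change the integrals,
      since \<open>\<phi> n\<close> vanishes off \<open>{c..e}\<close>. It makes the dominating
      function integrable over the whole line, while \<open>d\<close> itself is only locally
      integrable.\<close>
    have "(\<lambda>n. LINT t|lebesgue. \<phi> n t * (indicat_real {c..e} t * d t)) \<longlonglongrightarrow>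
        (LINT t|lebesgue. indicat_real {c<..<e} t * (indicat_real {c..e} t * d t))"
    proof (rule integral_dominated_convergence)
      show "integrable lebesgue (\<lambda>t. \<bar>indicat_real {c..e} t * d t\<bar>)" using Icc[OF ce] by auto
      show "AE t in lebesgue. (\<lambda>n. \<phi> n t * (indicat_real {c..e} t * d t)) \<longlonglongrightarrow>
          indicat_real {c<..<e} t * (indicat_real {c..e} t * d t)"
        by (intro AE_I2 tendsto_mult \<phi> tendsto_const)
      show "AE t in lebesgue. norm (\<phi> n t * (indicat_real {c..e} t * d t)) \<le> \<bar>indicat_real {c..e} t * d t\<bar>" for n
        using \<phi>(2) by (auto simp: abs_mult intro!: mult_left_le_one_le)
      have "\<phi> n \<in> borel_measurable lebesgue" for n
        by (intro measurable_completion) (simp add: borel_measurable_continuous_onI test_function_continuous[OF t])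
      then show "(\<lambda>t. \<phi> n t * (indicat_real {c..e} t * d t)) \<in> borel_measurable lebesgue" for n
        by (rule borel_measurable_times[OF _ dm])
      show "(\<lambda>t. indicat_real {c<..<e} t * (indicat_real {c..e} t * d t)) \<in> borel_measurable lebesgue"
        by (rule borel_measurable_times[OF borel_measurable_indicator dm]) simp
    qed
    moreover have "(LINT t|lebesgue. \<phi> n t * (indicat_real {c..e} t * d t)) = 0" for n
    proof -
      have "(LINT t|lebesgue. \<phi> n t * (indicat_real {c..e} t * d t)) =
          (LINT t|lebesgue. indicat_real {a<..<b} t *\<^sub>R (\<phi> n t * d t))"
        by (rule Bochner_Integration.integral_cong) (use out ce in \<open>fastforce simp: indicator_def\<close>)+
      also have "\<dots> = (LINT t|lebesgue_on {a<..<b}. \<phi> n t * d t)"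
        by (subst integral_restrict_space) auto
      finally show ?thesis using zero[OF t] by simp
    qed
    moreover have "(LINT t|lebesgue. indicat_real {c<..<e} t * (indicat_real {c..e} t * d t)) =
        (LINT t|lebesgue. indicat_real {c<..<e} t * d t)"
      by (rule Bochner_Integration.integral_cong) (auto simp: indicator_def)
    ultimately show ?thesis by (simp add: LIMSEQ_const_iff)
  qed
  have AEp: "AE t in lebesgue. t \<noteq> p" for p :: real
    by (rule AE_completion) (rule AE_lborel_singleton)
  have AEK: "AE t in lebesgue. indicat_real {c..e} t * d t = 0" if ce: "a < c" "e < b" for c e
  proof (rule AE_zero_if_integrals_atMost_zero[OF Icc[OF ce]])
    have eq: "(LINT t|lebesgue. indicat_real {c..e} t * d t) = 0" if "e < b" for e
    proof -
      have "AE t in lebesgue. indicat_real {c..e} t * d t = indicat_real {c<..<e} t * d t"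
        using AEp[of c] AEp[of e] by eventually_elim (auto simp: indicator_def)
      then have "(LINT t|lebesgue. indicat_real {c..e} t * d t) = (LINT t|lebesgue. indicat_real {c<..<e} t * d t)"
      proof (rule integral_cong_AE[rotated 2])
        have "integrable lebesgue (\<lambda>t. indicat_real {c<..<e} t * (indicat_real {c..e} t * d t))"
          using integrable_mult_indicator[OF _ Icc[OF ce(1) \<open>e < b\<close>], of "{c<..<e}"] by simp
        also have "(\<lambda>t. indicat_real {c<..<e} t * (indicat_real {c..e} t * d t)) = (\<lambda>t. indicat_real {c<..<e} t * d t)"
          by (auto simp: indicator_def)
        finally show "(\<lambda>t. indicat_real {c<..<e} t * d t) \<in> borel_measurable lebesgue" by auto
      qed (use Icc[OF ce(1) \<open>e < b\<close>] in auto)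
      then show ?thesis using Ioo[OF ce(1) \<open>e < b\<close>] by simp
    qed
    show "(LINT t|lebesgue. indicat_real {c..e} t * d t) = 0" by (rule eq[OF ce(2)])
    fix x
    have "(LINT t|lebesgue. indicat_real {..x} t * (indicat_real {c..e} t * d t))
        = (LINT t|lebesgue. indicat_real {c..min x e} t * d t)"
      by (rule Bochner_Integration.integral_cong) (auto simp: indicator_def)
    then show "(LINT t|lebesgue. indicat_real {..x} t * (indicat_real {c..e} t * d t)) = 0"
      using eq[of "min x e"] ce by simp
  qed
  have "AE t in lebesgue. \<forall>n. indicat_real {a + 1 / Suc n..b - 1 / Suc n} t * d t = 0"
    unfolding AE_all_countable
  proof
    fix n :: nat
    have "1 / real (Suc n) > 0" by simp
    then show "AE t in lebesgue. indicat_real {a + 1 / Suc n..b - 1 / Suc n} t * d t = 0"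
      by (intro AEK) (simp_all del: of_nat_Suc)
  qed
  then have "AE t in lebesgue. t \<in> {a<..<b} \<longrightarrow> d t = 0"
  proof eventually_elim
    case (elim t)
    show ?case
    proof
      assume "t \<in> {a<..<b}"
      then have "min (t - a) (b - t) > 0" by simp
      then obtain N where "1 / Suc N < min (t - a) (b - t)" using nat_approx_posE by blast
      then show "d t = 0" using elim[rule_format, of N] by (auto simp: indicator_def split: if_splits)
    qed
  qed
  then show ?thesis by (subst AE_restrict_space_iff) auto
qed

section \<open>Sobolev functions on the unit interval\<close>

lemma test_function_DERIV:
  assumes "test_function_on S \<phi>"
  shows "(\<phi> has_real_derivative deriv \<phi> x) (at x)"
  using smooth_deriv_DERIV[of \<phi> 0] assms by (simp add: test_function_on_def)

text \<open>The finite exceptional set \<open>K\<close> is there for the piecewise linear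
  interpolation in time; for C^1 functions of space it is empty. No boundary terms arise because
  \<phi> vanishes at both end points.\<close>

lemma integration_by_parts_test:
  fixes f f' :: "real \<Rightarrow> real"
  assumes "a < b" and \<phi>: "test_function_on {a<..<b} \<phi>"
    and K: "finite K" and cont: "continuous_on {a..b} f"
    and f': "\<And>x. x \<in> {a<..<b} - K \<Longrightarrow> (f has_real_derivative f' x) (at x)"
    and int: "integrable (lebesgue_on {a<..<b}) f'"
  shows "(LINT x|lebesgue_on {a<..<b}. deriv \<phi> x * f x) = - (LINT x|lebesgue_on {a<..<b}. \<phi> x * f' x)"
proof -
  let ?S = "{a<..<b}"
  have \<phi>c: "continuous_on UNIV \<phi>" and \<phi>'c: "continuous_on UNIV (deriv \<phi>)"
    using test_function_continuous[OF \<phi>] test_function_continuous[OF test_function_deriv[OF \<phi>]] by auto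
  have ends: "\<phi> a = 0" "\<phi> b = 0"
    using \<phi> by (auto simp: test_function_on_def)
  have "((\<lambda>x. deriv \<phi> x * f x + \<phi> x * f' x) has_integral \<phi> b * f b - \<phi> a * f a) {a..b}"
  proof (rule fundamental_theorem_of_calculus_interior_strong[OF K])
    show "continuous_on {a..b} (\<lambda>x. \<phi> x * f x)"
      by (intro continuous_on_mult cont continuous_on_subset[OF \<phi>c]) auto
    fix x assume "x \<in> ?S - K"
    then show "((\<lambda>x. \<phi> x * f x) has_vector_derivative deriv \<phi> x * f x + \<phi> x * f' x) (at x)"
      using DERIV_mult[OF test_function_DERIV[OF \<phi>] f']
      by (simp add: has_real_derivative_iff_has_vector_derivative mult.commute)
  qed (use \<open>a < b\<close> in simp)
  then have hi: "((\<lambda>x. deriv \<phi> x * f x + \<phi> x * f' x) has_integral 0) ?S"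
    by (simp add: ends has_integral_Icc_iff_Ioo)
  obtain c where c: "\<And>x. \<bar>\<phi> x\<bar> \<le> c" using test_function_bounded[OF \<phi>] by blast
  have i1: "integrable (lebesgue_on ?S) (\<lambda>x. \<phi> x * f' x)"
  proof (rule Bochner_Integration.integrable_bound)
    show "integrable (lebesgue_on ?S) (\<lambda>x. c * f' x)" using int by auto
    show "(\<lambda>x. \<phi> x * f' x) \<in> borel_measurable (lebesgue_on ?S)"
      by (rule borel_measurable_times[OF borel_imp_lebesgue_on[OF borel_measurable_continuous_onI[OF \<phi>c]]
            borel_measurable_integrable[OF int]])
    show "AE x in lebesgue_on ?S. norm (\<phi> x * f' x) \<le> norm (c * f' x)"
      using order_trans[OF c abs_ge_self] by (auto simp: abs_mult intro!: mult_right_mono)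
  qed
  have i2: "integrable (lebesgue_on ?S) (\<lambda>x. deriv \<phi> x * f x)"
  proof -
    have "continuous_on {a..b} (\<lambda>x. deriv \<phi> x * f x)"
      by (intro continuous_on_mult cont continuous_on_subset[OF \<phi>'c]) auto
    then have "(\<lambda>x. deriv \<phi> x * f x) absolutely_integrable_on {a..b}"
      by (rule absolutely_integrable_continuous_real)
    then have "(\<lambda>x. deriv \<phi> x * f x) absolutely_integrable_on ?S"
      by (rule set_integrable_subset) auto
    then show ?thesis by (simp add: integrable_restrict_space set_integrable_def)
  qed
  have "(LINT x|lebesgue_on ?S. deriv \<phi> x * f x + \<phi> x * f' x) = 0"
    using lebesgue_integral_eq_integral[OF Bochner_Integration.integrable_add[OF i2 i1]] hi
    by (simp add: integral_unique)
  then show ?thesis using i1 i2 by simp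
qed

lemma continuous_square_integrable:
  fixes f :: "real \<Rightarrow> real"
  assumes "continuous_on {0..1} f"
  shows "f square_integrable_on {0<..<1}"
proof -
  have "compact (f ` {0..1})" by (intro compact_continuous_image assms) auto
  then obtain c where c: "\<And>x. x \<in> {0..1} \<Longrightarrow> \<bar>f x\<bar> \<le> c"
    by (force dest!: compact_imp_bounded simp: bounded_iff)
  have "continuous_on {0<..<1} f" using assms by (rule continuous_on_subset) auto
  then have "f \<in> borel_measurable (lebesgue_on {0<..<1})"
    by (rule continuous_imp_measurable_on_sets_lebesgue) auto
  then show ?thesis
    by (rule square_integrable_bound[OF square_integrable_const[of c]]) (auto intro!: AE_I2 c)
qed

lemma inner_abs_abs_L2:
  assumes "f square_integrable_on {0<..<1}" "g square_integrable_on {0<..<1}"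
  shows "abs_L2 f \<bullet> abs_L2 g = (LINT x|lebesgue_on {0<..<1}. f x * g x)"
proof -
  note [measurable] = square_integrable_imp_measurable[OF assms(1)] square_integrable_imp_measurable[OF assms(2)]
  have "(LINT x|lebesgue_on {0<..<1}. f x * rep_L2 (abs_L2 g) x) = (LINT x|lebesgue_on {0<..<1}. f x * g x)"
  proof (rule integral_cong_AE)
    show "AE x in lebesgue_on {0<..<1}. f x * rep_L2 (abs_L2 g) x = f x * g x"
      using rep_abs_L2[OF assms(2)] by eventually_elim simp
  qed measurable
  then show ?thesis by (simp add: inner_abs_L2[OF assms(1)])
qed

lemma norm_abs_L2_le:
  assumes f: "f \<in> borel_measurable (lebesgue_on {0<..<1})" and le: "AE x in lebesgue_on {0<..<1}. \<bar>f x\<bar> \<le> \<bar>rep_L2 u x\<bar>"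
  shows "norm (abs_L2 f) \<le> norm u"
proof -
  have w: "(\<lambda>x. \<bar>rep_L2 u x\<bar>) square_integrable_on {0<..<1}"
    using rep_L2_square_integrable[of u] by (auto simp: square_integrable_on_def)
  have fs: "f square_integrable_on {0<..<1}"
    by (rule square_integrable_bound[OF w f le])
  have "(LINT x|lebesgue_on {0<..<1}. (rep_L2 (abs_L2 f) x)\<^sup>2) \<le> (LINT x|lebesgue_on {0<..<1}. (rep_L2 u x)\<^sup>2)"
  proof (rule integral_mono_AE)
    show "AE x in lebesgue_on {0<..<1}. (rep_L2 (abs_L2 f) x)\<^sup>2 \<le> (rep_L2 u x)\<^sup>2"
      using le rep_abs_L2[OF fs] by eventually_elim (simp add: abs_le_square_iff)
  qed (use rep_L2_square_integrable[of u] rep_L2_square_integrable[of "abs_L2 f"] in \<open>auto simp: square_integrable_on_def\<close>)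
  then show ?thesis by (simp add: norm_L2_rep)
qed

lemma norm_abs_L2_le_const:
  assumes f: "f \<in> borel_measurable (lebesgue_on {0<..<1})" and le: "AE x in lebesgue_on {0<..<1}. \<bar>f x\<bar> \<le> c"
    and "0 \<le> c"
  shows "norm (abs_L2 f) \<le> c"
proof -
  have s: "(\<lambda>_. c) square_integrable_on {0<..<1}" by (rule square_integrable_const)
  have "norm (abs_L2 f) \<le> norm (abs_L2 (\<lambda>_. c))"
  proof (rule norm_abs_L2_le[OF f])
    show "AE x in lebesgue_on {0<..<1}. \<bar>f x\<bar> \<le> \<bar>rep_L2 (abs_L2 (\<lambda>_. c)) x\<bar>"
      using le rep_abs_L2[OF s] by eventually_elim simp
  qed
  also have "\<dots> = sqrt (LINT x|lebesgue_on {0<..<1::real}. c * c)"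
    by (simp add: norm_eq_sqrt_inner inner_abs_abs_L2[OF s s])
  also have "\<dots> = c"
    using \<open>0 \<le> c\<close> by (simp add: measure_restrict_space)
  finally show ?thesis .
qed

lemma abs_L2_test_inner_C1:
  assumes cont: "continuous_on {0..1} f'"
    and deriv: "\<And>x. x \<in> {0..1} \<Longrightarrow> (f has_real_derivative f' x) (at x within {0..1})"
    and \<phi>: "test_function_on {0<..<1} \<phi>"
  shows "abs_L2 (deriv \<phi>) \<bullet> abs_L2 f = - (abs_L2 \<phi> \<bullet> abs_L2 f')"
proof -
  have fc: "continuous_on {0..1} f"
    using deriv by (meson DERIV_continuous_on)
  note f's = continuous_square_integrable[OF cont] and fs = continuous_square_integrable[OF fc]
  have "(LINT x|lebesgue_on {0<..<1}. deriv \<phi> x * f x) = - (LINT x|lebesgue_on {0<..<1}. \<phi> x * f' x)"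
  proof (rule integration_by_parts_test[OF _ \<phi>, of "{}"])
    show "(f has_real_derivative f' x) (at x)" if "x \<in> {0<..<1} - {}" for x
    proof -
      have "x \<in> interior {0..1}" using that by simp
      then have "at x within {0..1} = at x" by (rule at_within_interior)
      then show ?thesis using deriv[of x] that by auto
    qed
    show "integrable (lebesgue_on {0<..<1}) f'"
      using square_integrable_mult[OF square_integrable_const[of 1] f's] by simp
  qed (use fc in auto)
  then show ?thesis
    by (simp add: inner_abs_abs_L2 fs f's test_function_square_integrable[OF \<phi>]
        test_function_square_integrable[OF test_function_deriv[OF \<phi>]])
qed

lemma L2_wderiv_eqI:
  assumes "\<And>\<phi>. test_function_on {0<..<1} \<phi> \<Longrightarrow> abs_L2 (deriv \<phi>) \<bullet> u = - (abs_L2 \<phi> \<bullet> v)"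
  shows "u \<in> W12_01" "L2_wderiv u = v"
proof -
  have w: "weak_derivative_on {0<..<1} (rep_L2 u) (rep_L2 v)"
    using assms by (simp add: weak_derivative_L2_iff)
  then show "L2_wderiv u = v" by (rule L2_wderiv_unique)
  show "u \<in> W12_01" using w by (auto simp: W12_01_def)
qed

lemma L2_wderiv_C1:
  assumes "continuous_on {0..1} f'"
    and "\<And>x. x \<in> {0..1} \<Longrightarrow> (f has_real_derivative f' x) (at x within {0..1})"
  shows "abs_L2 f \<in> W12_01" "L2_wderiv (abs_L2 f) = abs_L2 f'"
  using L2_wderiv_eqI[of "abs_L2 f" "abs_L2 f'"] abs_L2_test_inner_C1[OF assms] by auto

section \<open>Density of test functions in L^2(0,1)\<close>

lemma test_function_lincomb:
  assumes "test_function_on S f" "test_function_on S g"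
  shows "test_function_on S (\<lambda>x. a * f x + b * g x)"
proof -
  obtain K L where "compact K" "K \<subseteq> S" "\<And>x. x \<notin> K \<Longrightarrow> f x = 0"
    and "compact L" "L \<subseteq> S" "\<And>x. x \<notin> L \<Longrightarrow> g x = 0"
    using assms by (auto simp: test_function_on_def)
  then show ?thesis
    using assms unfolding test_function_on_def
    by (intro conjI smooth_lincomb exI[of _ "K \<union> L"]) auto
qed

lemma test_function_sum:
  fixes n :: nat
  assumes "\<And>k. test_function_on S (\<phi> k)"
  shows "test_function_on S (\<lambda>x. \<Sum>k<n. c k * \<phi> k x)"
proof (induction n)
  case 0
  then show ?case using test_function_lincomb[OF assms assms, of 0 _ 0] by simp
next
  case (Suc n)
  then show ?case using test_function_lincomb[OF Suc assms[of n], of 1 "c n"] by simp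
qed

text \<open>Step functions are dense, and each indicator of a cell is a bounded pointwise limit of
  test functions supported in that cell, so dominated convergence applies.\<close>

lemma L2_approx_test_functions:
  obtains \<phi> where "\<And>n. test_function_on {0<..<1} (\<phi> n)" "(\<lambda>n. abs_L2 (\<phi> n)) \<longlonglongrightarrow> u"
proof -
  let ?D = "abs_L2 ` {\<phi>. test_function_on {0<..<1} \<phi>}"
  have "abs_L2 (step_fun n rs) \<in> closure ?D" for n rs
  proof -
    \<comment> \<open>\<open>min 1\<close> keeps the supports inside the unit interval:
      \<open>rs\<close> may be longer than \<open>Suc n\<close>, and the surplus cells become empty.
      Opening the cells on the left loses only grid points, a null set.\<close>
    let ?A = "\<lambda>k::nat. {k / Suc n<..<min 1 ((k + 1) / Suc n)}"
    have "\<forall>k. \<exists>\<phi>. (\<forall>j. test_function_on (?A k) (\<phi> j)) \<and> (\<forall>j x. \<bar>\<phi> j x\<bar> \<le> 1) \<and>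
        (\<forall>x. (\<lambda>j. \<phi> j x) \<longlonglongrightarrow> indicat_real (?A k) x)"
      using test_function_approx_indicator by metis
    then obtain \<phi> where \<phi>: "\<And>k j. test_function_on (?A k) (\<phi> k j)" "\<And>k j x. \<bar>\<phi> k j x\<bar> \<le> 1"
        "\<And>k x. (\<lambda>j. \<phi> k j x) \<longlonglongrightarrow> indicat_real (?A k) x"
      unfolding choice_iff by blast
    define h where "h = (\<lambda>j x. \<Sum>k<length rs. of_rat (rs ! k) * \<phi> k j x)"
    have test: "test_function_on {0<..<1} (h j)" for j
      unfolding h_def
    proof (rule test_function_sum)
      fix k :: nat
      have "0 < x" if "k / Suc n < x" for x
        by (rule le_less_trans[OF _ that]) simp
      then have "?A k \<subseteq> {0<..<1}" by (auto simp del: of_nat_Suc)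
      then show "test_function_on {0<..<1} (\<phi> k j)" by (rule test_function_mono[OF \<phi>(1)])
    qed
    have "(\<lambda>j. abs_L2 (h j)) \<longlonglongrightarrow> abs_L2 (step_fun n rs)"
    proof (rule L2_dominated_convergence[OF square_integrable_const[of "\<Sum>k<length rs. \<bar>of_rat (rs ! k)\<bar>"]])
      show "h j \<in> borel_measurable (lebesgue_on {0<..<1})" for j
        by (rule square_integrable_imp_measurable[OF test_function_square_integrable[OF test]])
      show "AE x in lebesgue_on {0<..<1}. \<bar>h j x\<bar> \<le> (\<Sum>k<length rs. \<bar>of_rat (rs ! k)\<bar>)" for j
        unfolding h_def using \<phi>(2)
        by (intro AE_I2 order_trans[OF sum_abs] sum_mono) (auto simp: abs_mult intro!: mult_left_le)
      have "AE x in lebesgue. \<forall>k. x \<noteq> real k / Suc n"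
        unfolding AE_all_countable by (intro allI AE_completion AE_lborel_singleton)
      then have "AE x in lebesgue_on {0<..<1}. \<forall>k. x \<noteq> real k / Suc n"
        by (subst AE_restrict_space_iff) (auto elim: eventually_mono)
      moreover have "AE x in lebesgue_on {0<..<1::real}. x \<in> {0<..<1}" by (rule AE_I2) simp
      ultimately show "AE x in lebesgue_on {0<..<1}. (\<lambda>j. h j x) \<longlonglongrightarrow> step_fun n rs x"
      proof eventually_elim
        case (elim x)
        have "indicat_real (?A k) x = indicat_real {k / Suc n..<real (k + 1) / Suc n} x" for k
          using elim(1)[rule_format, of k] elim(2) by (auto simp: indicator_def simp del: of_nat_Suc)
        then have "step_fun n rs x = (\<Sum>k<length rs. of_rat (rs ! k) * indicat_real (?A k) x)"
          unfolding step_fun_def by (simp only:)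
        then show ?case
          unfolding h_def by (simp only:) (intro tendsto_intros \<phi>(3))
      qed
    qed simp
    then show ?thesis
      unfolding closure_sequential using test by (intro exI[of _ "\<lambda>j. abs_L2 (h j)"]) auto
  qed
  then have "closure (range (\<lambda>(n, rs). abs_L2 (step_fun n rs))) \<subseteq> closure ?D"
    by (intro closure_minimal) auto
  then have "u \<in> closure ?D" by (simp add: closure_step_funs top_unique)
  then obtain X where X: "\<And>n::nat. X n \<in> ?D" "X \<longlonglongrightarrow> u"
    by (auto simp: closure_sequential)
  then have "\<forall>n. \<exists>\<phi>. test_function_on {0<..<1} \<phi> \<and> X n = abs_L2 \<phi>" by blast
  then obtain \<phi> where \<phi>: "\<And>n. test_function_on {0<..<1} (\<phi> n)" "\<And>n. X n = abs_L2 (\<phi> n)" by metis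
  have "X = (\<lambda>n. abs_L2 (\<phi> n))" using \<phi>(2) by blast
  then show thesis using that[of \<phi>] X(2) \<phi>(1) by simp
qed

section \<open>Primitives of square integrable functions\<close>

lemma abs_L2_diff:
  assumes "f square_integrable_on {0<..<1}" "g square_integrable_on {0<..<1}"
  shows "abs_L2 f - abs_L2 g = abs_L2 (\<lambda>x. f x - g x)"
  using abs_L2_lincomb[OF assms, of 1 "-1"] by simp

lemma abs_L2_add:
  assumes "f square_integrable_on {0<..<1}" "g square_integrable_on {0<..<1}"
  shows "abs_L2 f + abs_L2 g = abs_L2 (\<lambda>x. f x + g x)"
  using abs_L2_lincomb[OF assms, of 1 1] by simp

lemma square_integrable_indicator:
  "A \<in> sets borel \<Longrightarrow> indicat_real A square_integrable_on {0<..<1}"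
  by (rule bounded_square_integrable[of _ 1]) (auto intro!: borel_imp_lebesgue_on simp: indicator_def)

text \<open>The integral of \<open>g\<close> from 0 to \<open>x\<close>, for \<open>x\<close> in the
  unit interval. As an inner product it makes sense for a class \<open>g\<close>, and Cauchy-Schwarz
  makes it Lipschitz in \<open>g\<close> uniformly in \<open>x\<close>, so that facts about smooth
  \<open>g\<close> carry over by density.\<close>

definition primitive :: "L2 \<Rightarrow> real \<Rightarrow> real" where
  "primitive g x = abs_L2 (indicat_real {0<..<x}) \<bullet> g"

lemma primitive_diff_le: "\<bar>primitive g x - primitive h x\<bar> \<le> norm (g - h)"
proof -
  have "norm (abs_L2 (indicat_real {0<..<x})) \<le> 1"
    by (rule norm_abs_L2_le_const) (auto intro!: borel_imp_lebesgue_on simp: indicator_def)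
  then have "norm (abs_L2 (indicat_real {0<..<x})) * norm (g - h) \<le> 1 * norm (g - h)"
    by (intro mult_right_mono) auto
  then show ?thesis
    using Cauchy_Schwarz_ineq2[of "abs_L2 (indicat_real {0<..<x})" "g - h"]
    by (simp add: primitive_def inner_diff_right)
qed

lemma primitive_continuous_DERIV:
  assumes g: "continuous_on {0..1} g" and x: "x \<in> {0..1}"
  shows "(primitive (abs_L2 g) has_real_derivative g x) (at x within {0..1})"
proof -
  have eq: "primitive (abs_L2 g) y = integral {0..y} g" if y: "y \<in> {0..1}" for y
  proof -
    have sub: "{0<..<y} \<subseteq> {0<..<1}" using y by auto
    have "g absolutely_integrable_on {0..1}"
      by (rule absolutely_integrable_continuous_real[OF g])
    then have i: "g absolutely_integrable_on {0<..<y}"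
      by (rule set_integrable_subset) (use y in auto)
    have "primitive (abs_L2 g) y = (LINT t|lebesgue_on {0<..<1}. indicat_real {0<..<y} t * g t)"
      unfolding primitive_def
      by (intro inner_abs_abs_L2 square_integrable_indicator continuous_square_integrable[OF g]) auto
    also have "\<dots> = (LINT t|lebesgue. indicat_real {0<..<1} t *\<^sub>R (indicat_real {0<..<y} t * g t))"
      by (subst integral_restrict_space) auto
    also have "\<dots> = (LINT t:{0<..<y}|lebesgue. g t)"
      unfolding set_lebesgue_integral_def
      by (rule Bochner_Integration.integral_cong) (use y in \<open>auto simp: indicator_def\<close>)
    also have "\<dots> = integral {0<..<y} g"
      by (rule set_lebesgue_integral_eq_integral(2)[OF i])
    also have "\<dots> = integral {0..y} g" by (simp add: integral_open_interval_real)
    finally show ?thesis .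
  qed
  have "((\<lambda>y. integral {0..y} g) has_real_derivative g x) (at x within {0..1})"
    by (rule integral_has_real_derivative[OF g x])
  then show ?thesis
    by (rule has_field_derivative_transform_within[OF _ zero_less_one x]) (simp add: eq)
qed

text \<open>L^2 convergence of test functions to \<open>g\<close> makes their primitives converge
  uniformly, and those are differentiable.\<close>

lemma continuous_on_primitive: "continuous_on {0..1} (primitive g)"
proof -
  obtain \<phi> where \<phi>: "\<And>n. test_function_on {0<..<1} (\<phi> n)" "(\<lambda>n. abs_L2 (\<phi> n)) \<longlonglongrightarrow> g"
    using L2_approx_test_functions by blast
  show ?thesis
  proof (rule uniform_limit_theorem[OF _ _ sequentially_bot])
    show "\<forall>\<^sub>F n in sequentially. continuous_on {0..1} (primitive (abs_L2 (\<phi> n)))"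
    proof (intro always_eventually allI)
      fix n
      have "continuous_on {0..1} (\<phi> n)"
        by (rule continuous_on_subset[OF test_function_continuous[OF \<phi>(1)]]) simp
      then show "continuous_on {0..1} (primitive (abs_L2 (\<phi> n)))"
        by (intro DERIV_continuous_on[OF primitive_continuous_DERIV])
    qed
    show "uniform_limit {0..1} (\<lambda>n. primitive (abs_L2 (\<phi> n))) (primitive g) sequentially"
    proof (rule uniform_limitI)
      fix e :: real assume "e > 0"
      then have "\<forall>\<^sub>F n in sequentially. dist (abs_L2 (\<phi> n)) g < e"
        using \<phi>(2) by (simp add: tendsto_iff)
      then show "\<forall>\<^sub>F n in sequentially. \<forall>x\<in>{0..1}. dist (primitive (abs_L2 (\<phi> n)) x) (primitive g x) < e"
      proof eventually_elim
        case (elim n)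
        then show ?case
          unfolding dist_norm real_norm_def by (intro ballI le_less_trans[OF primitive_diff_le])
      qed
    qed
  qed
qed

lemma square_integrable_primitive: "primitive g square_integrable_on {0<..<1}"
  by (rule continuous_square_integrable[OF continuous_on_primitive])

lemma tendsto_abs_L2_primitive:
  assumes "g \<longlonglongrightarrow> h"
  shows "(\<lambda>n. abs_L2 (primitive (g n))) \<longlonglongrightarrow> abs_L2 (primitive h)"
proof -
  have "norm (abs_L2 (primitive (g n)) - abs_L2 (primitive h)) \<le> norm (g n - h)" for n
    unfolding abs_L2_diff[OF square_integrable_primitive square_integrable_primitive]
    by (rule norm_abs_L2_le_const)
      (auto intro!: primitive_diff_le borel_measurable_diff square_integrable_imp_measurable[OF square_integrable_primitive])
  moreover have "(\<lambda>n. norm (g n - h)) \<longlonglongrightarrow> 0"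
    using assms by (simp add: tendsto_norm_zero LIM_zero)
  ultimately have "(\<lambda>n. abs_L2 (primitive (g n)) - abs_L2 (primitive h)) \<longlonglongrightarrow> 0"
    by (rule Lim_null_comparison[OF always_eventually[OF allI]])
  then show ?thesis by (rule LIM_zero_cancel)
qed

text \<open>For a test function in place of \<open>g\<close> this is classical integration by parts,
  and both sides are continuous in \<open>g\<close>.\<close>

lemma test_inner_primitive:
  assumes \<psi>: "test_function_on {0<..<1} \<psi>"
  shows "abs_L2 (deriv \<psi>) \<bullet> abs_L2 (primitive g) = - (abs_L2 \<psi> \<bullet> g)"
proof -
  obtain \<phi> where \<phi>: "\<And>n. test_function_on {0<..<1} (\<phi> n)" "(\<lambda>n. abs_L2 (\<phi> n)) \<longlonglongrightarrow> g"
    using L2_approx_test_functions by blast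
  have c: "continuous_on {0..1} (\<phi> n)" for n
    by (rule continuous_on_subset[OF test_function_continuous[OF \<phi>(1)]]) simp
  have "abs_L2 (deriv \<psi>) \<bullet> abs_L2 (primitive (abs_L2 (\<phi> n))) = - (abs_L2 \<psi> \<bullet> abs_L2 (\<phi> n))" for n
    by (rule abs_L2_test_inner_C1[OF c primitive_continuous_DERIV[OF c] \<psi>])
  moreover have "(\<lambda>n. abs_L2 (deriv \<psi>) \<bullet> abs_L2 (primitive (abs_L2 (\<phi> n)))) \<longlonglongrightarrow>
      abs_L2 (deriv \<psi>) \<bullet> abs_L2 (primitive g)"
    by (intro tendsto_intros tendsto_abs_L2_primitive \<phi>)
  moreover have "(\<lambda>n. - (abs_L2 \<psi> \<bullet> abs_L2 (\<phi> n))) \<longlonglongrightarrow> - (abs_L2 \<psi> \<bullet> g)"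
    by (intro tendsto_intros \<phi>)
  ultimately show ?thesis using LIMSEQ_unique by simp
qed

section \<open>The lemma of du Bois-Reymond and C^1 representatives\<close>

lemma test_function_antiderivative:
  assumes \<theta>: "test_function_on {0<..<1} \<theta>" and zero: "abs_L2 \<theta> \<bullet> abs_L2 (\<lambda>_. 1) = 0"
  obtains \<Phi> where "test_function_on {0<..<1} \<Phi>" "deriv \<Phi> = \<theta>"
proof -
  have \<theta>c: "continuous_on UNIV \<theta>" by (rule test_function_continuous[OF \<theta>])
  obtain K where K: "compact K" "K \<subseteq> {0<..<1}" "\<And>x. x \<notin> K \<Longrightarrow> \<theta> x = 0"
    using \<theta> by (auto simp: test_function_on_def)
  obtain a b where ab: "0 < a" "a < b" "b < 1" "K \<subseteq> {a..b}"
  proof (cases "K = {}")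
    case True
    then show thesis using that[of "1/3" "1/2"] by auto
  next
    case False
    then obtain l r where lr: "l \<in> K" "\<And>x. x \<in> K \<Longrightarrow> l \<le> x" "r \<in> K" "\<And>x. x \<in> K \<Longrightarrow> x \<le> r"
      using compact_attains_inf[OF K(1)] compact_attains_sup[OF K(1)] by metis
    then have *: "0 < l" "l \<le> r" "r < 1" using K(2) lr(2)[OF lr(3)] by auto
    \<comment> \<open>Halving the left end gives \<open>a < b\<close> also when \<open>K\<close> is
      a single point.\<close>
    then have "K \<subseteq> {l / 2..r}" using lr(2,4) by fastforce
    with * show thesis using that[of "l / 2" r] by simp
  qed
  obtain F where F: "\<And>x. (F has_real_derivative \<theta> x) (at x)"
  proof -
    have "isCont \<theta> x" for x using \<theta>c by (simp add: continuous_on_eq_continuous_at)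
    then obtain F where "\<forall>x. (F has_vector_derivative \<theta> x) (at x)"
      using einterval_antiderivative[of "-\<infinity>" "\<infinity>" \<theta>] by force
    then show thesis using that[of F] by (simp add: has_real_derivative_iff_has_vector_derivative)
  qed
  define \<Phi> where "\<Phi> = (\<lambda>x. F x - F 0)"
  have D: "(\<Phi> has_real_derivative \<theta> x) (at x)" for x
    unfolding \<Phi>_def by (auto intro!: derivative_eq_intros F)
  have FTC: "(\<theta> has_integral \<Phi> d - \<Phi> c) {c..d}" if "c \<le> d" for c d
    using D that by (intro fundamental_theorem_of_calculus)
      (auto simp: has_real_derivative_iff_has_vector_derivative[symmetric] intro: has_field_derivative_at_within)
  \<comment> \<open>Only overlap with the open interval \<open>{a<..<b}\<close> is excluded, so
    \<open>{c..d}\<close> may touch an end point. This is enough because \<open>a < b\<close>: if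
    \<open>{c<..<d}\<close> meets \<open>{a..b}\<close>, then it meets
    \<open>{a<..<b}\<close>.\<close>
  have const: "\<Phi> d = \<Phi> c" if "c \<le> d" "{c..d} \<inter> {a<..<b} = {}" for c d
  proof -
    have "\<theta> x = 0" if x: "x \<in> {c<..<d}" for x
    proof (rule K(3))
      show "x \<notin> K"
      proof
        assume "x \<in> K"
        then have "x \<in> {a..b} \<inter> {c<..<d}" using ab(4) x by blast
        then have "max a c < min b d" using ab(2) by auto
        then obtain y where "max a c < y" "y < min b d" using dense by blast
        then have "y \<in> {c..d} \<inter> {a<..<b}" by auto
        then show False using \<open>{c..d} \<inter> {a<..<b} = {}\<close> by blast
      qed
    qed
    then have "((\<lambda>_. 0) has_integral \<Phi> d - \<Phi> c) {c<..<d}"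
      using FTC[OF \<open>c \<le> d\<close>] by (subst has_integral_cong[of _ _ \<theta>]) (auto simp: has_integral_Icc_iff_Ioo)
    then show ?thesis using has_integral_0_eq by fastforce
  qed
  \<comment> \<open>The zero mean enters here: otherwise \<Phi> would be a nonzero constant to the
    right of the support.\<close>
  have one: "\<Phi> 1 = \<Phi> 0"
  proof -
    have "integral {0..1} \<theta> = integral {0<..<1} \<theta>" by (simp add: integral_open_interval_real)
    also have "\<dots> = (LINT x|lebesgue_on {0<..<1}. \<theta> x)"
      using square_integrable_mult[OF test_function_square_integrable[OF \<theta>] square_integrable_const[of 1]]
      by (intro lebesgue_integral_eq_integral[symmetric]) auto
    also have "\<dots> = abs_L2 \<theta> \<bullet> abs_L2 (\<lambda>_. 1)"
      by (simp add: inner_abs_abs_L2 test_function_square_integrable[OF \<theta>] square_integrable_const)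
    finally show ?thesis using FTC[of 0 1] zero by (simp add: integral_unique)
  qed
  have d: "deriv \<Phi> = \<theta>" using DERIV_imp_deriv[OF D] by auto
  have "test_function_on {0<..<1} \<Phi>"
    unfolding test_function_on_def
  proof
    have "(deriv ^^ k) \<Phi> differentiable (at x)" for k x
    proof (cases k)
      case 0
      then show ?thesis using D by (auto simp: real_differentiable_def)
    next
      case (Suc j)
      then show ?thesis
        using \<theta> by (simp add: funpow_Suc_right d test_function_on_def smooth_def del: funpow.simps)
    qed
    then show "smooth \<Phi>" by (simp add: smooth_def)
    have "\<Phi> x = 0" if x: "x \<notin> {a..b}" for x
    proof -
      have "\<Phi> 0 = 0" by (simp add: \<Phi>_def)
      consider "x \<le> 0" | "0 \<le> x" "x \<le> a" | "b \<le> x" "x \<le> 1" | "1 \<le> x"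
        using x by fastforce
      then show ?thesis
      proof cases
        case 1
        then have "\<Phi> 0 = \<Phi> x" by (rule const) (use ab in auto)
        then show ?thesis using \<open>\<Phi> 0 = 0\<close> by simp
      next
        case 2
        then have "\<Phi> x = \<Phi> 0" by (intro const) (use ab in auto)
        then show ?thesis using \<open>\<Phi> 0 = 0\<close> by simp
      next
        case 3
        then have "\<Phi> 1 = \<Phi> x" by (intro const) (use ab in auto)
        then show ?thesis using \<open>\<Phi> 0 = 0\<close> one by simp
      next
        case 4
        then have "\<Phi> x = \<Phi> 1" by (intro const) (use ab in auto)
        then show ?thesis using \<open>\<Phi> 0 = 0\<close> one by simp
      qed
    qed
    then show "\<exists>K. compact K \<and> K \<subseteq> {0<..<1} \<and> (\<forall>x. x \<notin> K \<longrightarrow> \<Phi> x = 0)"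
      using ab by (intro exI[of _ "{a..b}"]) auto
  qed
  then show thesis using d that by blast
qed

text \<open>The lemma of du Bois-Reymond.\<close>

lemma orthogonal_test_derivatives_imp_const:
  assumes orth: "\<And>\<phi>. test_function_on {0<..<1} \<phi> \<Longrightarrow> abs_L2 (deriv \<phi>) \<bullet> z = 0"
  obtains c where "z = abs_L2 (\<lambda>_. c)"
proof -
  let ?e = "abs_L2 (\<lambda>_. 1)"
  have s: "(\<lambda>_. 1::real) square_integrable_on {0<..<1}" by (rule square_integrable_const)
  have "?e \<noteq> 0"
  proof
    assume "?e = 0"
    then have "?e \<bullet> ?e = 0" by simp
    then show False by (simp add: inner_abs_abs_L2[OF s s] measure_restrict_space)
  qed
  then obtain \<psi> where \<psi>: "test_function_on {0<..<1} \<psi>" "abs_L2 \<psi> \<bullet> ?e \<noteq> 0"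
    using orthogonal_test_functions[of ?e] by blast
  define m where "m = abs_L2 \<psi> \<bullet> ?e"
  define c where "c = (abs_L2 \<psi> \<bullet> z) / m"
  have "z - c *\<^sub>R ?e = 0"
  proof (rule orthogonal_test_functions)
    fix \<phi> assume \<phi>: "test_function_on {0<..<1} \<phi>"
    \<comment> \<open>The function \<psi> has nonzero mean \<open>m\<close>, and \<open>r\<close> is
      chosen so that \<phi> - r \<psi> has mean zero and hence is the derivative of a test function.
      So \<open>z\<close> acts on \<phi> as \<open>r\<close> times its action on \<psi>, that is,
      like the constant \<open>c\<close>.\<close>
    define r where "r = (abs_L2 \<phi> \<bullet> ?e) / m"
    let ?\<theta> = "\<lambda>x. 1 * \<phi> x + (- r) * \<psi> x"
    have abs\<theta>: "abs_L2 ?\<theta> = abs_L2 \<phi> - r *\<^sub>R abs_L2 \<psi>"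
      using abs_L2_lincomb[OF test_function_square_integrable[OF \<phi>] test_function_square_integrable[OF \<psi>(1)], of 1 "- r"]
      by simp
    have "abs_L2 ?\<theta> \<bullet> ?e = 0"
      using \<psi>(2) unfolding abs\<theta> by (simp add: inner_diff_left r_def m_def)
    then obtain \<Phi> where "test_function_on {0<..<1} \<Phi>" "deriv \<Phi> = ?\<theta>"
      using test_function_antiderivative[OF test_function_lincomb[OF \<phi> \<psi>(1)]] by blast
    then have "abs_L2 ?\<theta> \<bullet> z = 0" using orth by metis
    then have "abs_L2 \<phi> \<bullet> z = r * (abs_L2 \<psi> \<bullet> z)"
      unfolding abs\<theta> by (simp add: inner_diff_left)
    then show "abs_L2 \<phi> \<bullet> (z - c *\<^sub>R ?e) = 0"
      using \<psi>(2) by (simp add: inner_diff_right r_def c_def m_def)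
  qed
  moreover have "c *\<^sub>R ?e = abs_L2 (\<lambda>_. c)"
    using abs_L2_lincomb[OF s s, of c 0] by simp
  ultimately show thesis using that by simp
qed

text \<open>Since \<open>w\<close> and the primitive of its weak derivative have the same weak
  derivative, they differ by a constant. This provides an explicit continuous
  representative.\<close>

lemma W12_01_eq_primitive:
  assumes "w \<in> W12_01"
  obtains c where "w = abs_L2 (\<lambda>x. c + primitive (L2_wderiv w) x)"
proof -
  let ?p = "primitive (L2_wderiv w)"
  have "abs_L2 (deriv \<phi>) \<bullet> (w - abs_L2 ?p) = 0" if "test_function_on {0<..<1} \<phi>" for \<phi>
    using W12_01_test[OF assms that] test_inner_primitive[OF that] by (simp add: inner_diff_right)
  then obtain c where "w - abs_L2 ?p = abs_L2 (\<lambda>_. c)"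
    using orthogonal_test_derivatives_imp_const by blast
  then have "w = abs_L2 (\<lambda>x. c + ?p x)"
    using abs_L2_add[OF square_integrable_const[of c] square_integrable_primitive] by (simp add: diff_eq_eq)
  then show thesis using that by blast
qed

text \<open>The primitive formula is applied twice: the derivative gets a continuous representative,
  and the primitive of a continuous function is C^1.\<close>

lemma W22_01_eq_C1:
  assumes "u \<in> W22_01"
  obtains f f' where "continuous_on {0..1} f'"
    "\<And>x. x \<in> {0..1} \<Longrightarrow> (f has_real_derivative f' x) (at x within {0..1})"
    "u = abs_L2 f" "L2_wderiv u = abs_L2 f'"
proof -
  have u: "u \<in> W12_01" "L2_wderiv u \<in> W12_01" using assms by (auto simp: W22_01_def)
  obtain c where c: "L2_wderiv u = abs_L2 (\<lambda>x. c + primitive (L2_wderiv (L2_wderiv u)) x)"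
    by (rule W12_01_eq_primitive[OF u(2)])
  obtain d where d: "u = abs_L2 (\<lambda>x. d + primitive (L2_wderiv u) x)"
    by (rule W12_01_eq_primitive[OF u(1)])
  let ?f' = "\<lambda>x. c + primitive (L2_wderiv (L2_wderiv u)) x"
  have cont: "continuous_on {0..1} ?f'" by (intro continuous_intros continuous_on_primitive)
  show thesis
  proof (rule that[OF cont _ d c])
    fix x :: real assume x: "x \<in> {0..1}"
    show "((\<lambda>x. d + primitive (L2_wderiv u) x) has_real_derivative ?f' x) (at x within {0..1})"
      using DERIV_add[OF DERIV_const primitive_continuous_DERIV[OF cont x]] by (simp only: c[symmetric] add_0_left)
  qed
qed


text \<open>\<open>C1_representative\<close> is a choice by \<open>SOME\<close>, about which nothing
  is known until a C^1 representative has been shown to exist.\<close>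

lemma abs_L2_C1_representative:
  assumes "u \<in> W22_01"
  obtains f' where "continuous_on {0..1} f'"
    "\<And>x. x \<in> {0..1} \<Longrightarrow> (C1_representative u has_real_derivative f' x) (at x within {0..1})"
    "abs_L2 (C1_representative u) = u" "abs_L2 f' = L2_wderiv u"
proof -
  obtain f f' where f: "continuous_on {0..1} f'"
    "\<And>x. x \<in> {0..1} \<Longrightarrow> (f has_real_derivative f' x) (at x within {0..1})" "u = abs_L2 f"
    by (rule W22_01_eq_C1[OF assms]) blast
  have "continuous_on {0..1} f" using f(2) by (rule DERIV_continuous_on)
  then have "AE x in lebesgue_on {0<..<1}. f x = rep_L2 u x"
    using rep_abs_L2[OF continuous_square_integrable, of f] unfolding f(3) by (simp add: eq_commute)
  with f(1,2) have "\<exists>f. (\<exists>f'. continuous_on {0..1} f' \<and>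
           (\<forall>x\<in>{0..1}. (f has_real_derivative f' x) (at x within {0..1}))) \<and>
     (AE x in lebesgue_on {0<..<1}. f x = rep_L2 u x)" by blast
  from someI_ex[OF this] obtain h' where h': "continuous_on {0..1} h'"
    "\<And>x. x \<in> {0..1} \<Longrightarrow> (C1_representative u has_real_derivative h' x) (at x within {0..1})"
    and ae: "AE x in lebesgue_on {0<..<1}. C1_representative u x = rep_L2 u x"
    unfolding C1_representative_def by blast
  have "continuous_on {0..1} (C1_representative u)" using h'(2) by (rule DERIV_continuous_on)
  then have u: "abs_L2 (C1_representative u) = u"
    by (intro abs_L2_eqI continuous_square_integrable) (use ae in \<open>simp_all add: eq_commute\<close>)
  with L2_wderiv_C1(2)[OF h'] show thesis using that[OF h'] by simp
qed

text \<open>C^1 convergence enters the proof only through this estimate: the flux asks just for L^2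
  convergence of first derivatives. On an interval of length one the supremum norm dominates the L^2
  norm.\<close>

lemma norm_L2_wderiv_diff_le_C1_dist:
  "norm (L2_wderiv (W22_0_to_L2 u) - L2_wderiv (W22_0_to_L2 v)) \<le> C1_dist u v"
proof -
  let ?f = "C1_representative (W22_0_to_L2 u)" and ?g = "C1_representative (W22_0_to_L2 v)"
  let ?d = "\<lambda>x. ?f x - ?g x"
  have W: "W22_0_to_L2 u \<in> W22_01" "W22_0_to_L2 v \<in> W22_01"
    using W22_0_to_L2 by auto
  obtain f' where f': "continuous_on {0..1} f'"
    "\<And>x. x \<in> {0..1} \<Longrightarrow> (?f has_real_derivative f' x) (at x within {0..1})"
    "abs_L2 f' = L2_wderiv (W22_0_to_L2 u)"
    using abs_L2_C1_representative[OF W(1)] by blast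
  obtain g' where g': "continuous_on {0..1} g'"
    "\<And>x. x \<in> {0..1} \<Longrightarrow> (?g has_real_derivative g' x) (at x within {0..1})"
    "abs_L2 g' = L2_wderiv (W22_0_to_L2 v)"
    using abs_L2_C1_representative[OF W(2)] by blast
  have D: "(?d has_real_derivative f' x - g' x) (at x within {0..1})" if "x \<in> {0..1}" for x
    using f'(2) g'(2) that by (intro DERIV_diff)
  have vd: "vector_derivative ?d (at x within {0..1}) = f' x - g' x" if "x \<in> {0..1}" for x
    using D[OF that] that
    by (intro vector_derivative_within_closed_interval) (auto simp: has_real_derivative_iff_has_vector_derivative)
  \<comment> \<open>A real \<open>SUP\<close> bounds its members only if the family is bounded
    above; continuity on the compact interval provides that.\<close>
  have bdd: "bdd_above ((\<lambda>x. \<bar>h x\<bar>) ` {0..1})" if "continuous_on {0..1} h" for h :: "real \<Rightarrow> real"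
    using that by (intro bounded_imp_bdd_above compact_imp_bounded compact_continuous_image continuous_intros) auto
  have d: "continuous_on {0..1} ?d" using D by (rule DERIV_continuous_on)
  have d': "continuous_on {0..1} (\<lambda>x. f' x - g' x)" using f'(1) g'(1) by (rule continuous_on_diff)
  have sup0: "0 \<le> (SUP x\<in>{0..1}. \<bar>?d x\<bar>)"
    by (rule order_trans[OF abs_ge_zero cSUP_upper[of 0, OF _ bdd[OF d]]]) simp
  have le: "\<bar>f' x - g' x\<bar> \<le> C1_dist u v" if "x \<in> {0..1}" for x
  proof -
    have "\<bar>f' x - g' x\<bar> \<le> (SUP x\<in>{0..1}. \<bar>f' x - g' x\<bar>)"
      by (rule cSUP_upper[OF that bdd[OF d']])
    also have "\<dots> = (SUP x\<in>{0..1}. \<bar>vector_derivative ?d (at x within {0..1})\<bar>)"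
      by (rule SUP_cong) (simp_all add: vd)
    finally show ?thesis using sup0 by (simp add: C1_dist_def C1_norm_def)
  qed
  have "norm (abs_L2 f' - abs_L2 g') = norm (abs_L2 (\<lambda>x. f' x - g' x))"
    using f'(1) g'(1) by (simp add: abs_L2_diff continuous_square_integrable)
  also have "\<dots> \<le> C1_dist u v"
  proof (rule norm_abs_L2_le_const)
    show "(\<lambda>x. f' x - g' x) \<in> borel_measurable (lebesgue_on {0<..<1})"
      by (rule square_integrable_imp_measurable[OF continuous_square_integrable[OF d']])
    show "AE x in lebesgue_on {0<..<1}. \<bar>f' x - g' x\<bar> \<le> C1_dist u v"
      by (rule AE_I2) (simp add: le)
    show "0 \<le> C1_dist u v" using le[of 0] by simp
  qed
  finally show ?thesis by (simp add: f'(3) g'(3))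
qed

lemma abs_L2_eq_AE:
  assumes "f square_integrable_on {0<..<1}" "g \<in> borel_measurable (lebesgue_on {0<..<1})"
    "AE x in lebesgue_on {0<..<1}. g x = f x"
  shows "abs_L2 g = abs_L2 f"
proof (rule abs_L2_eqI)
  have f: "(\<lambda>x. \<bar>f x\<bar>) square_integrable_on {0<..<1}"
    using assms(1) by (auto simp: square_integrable_on_def)
  show "g square_integrable_on {0<..<1}"
    by (rule square_integrable_bound[OF f assms(2)]) (use assms(3) in \<open>auto elim: eventually_mono\<close>)
  show "AE x in lebesgue_on {0<..<1}. rep_L2 (abs_L2 f) x = g x"
    using rep_abs_L2[OF assms(1)] assms(3) by eventually_elim simp
qed

lemma measurable_continuous_compose:
  fixes G f :: "real \<Rightarrow> real"
  assumes "continuous_on UNIV G" "f \<in> borel_measurable (lebesgue_on S)"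
  shows "(\<lambda>x. G (f x)) \<in> borel_measurable (lebesgue_on S)"
  using measurable_compose[OF assms(2) borel_measurable_continuous_onI[OF assms(1)]] .

section \<open>Chain rule and semicontinuity of the energy\<close>

text \<open>Nothing else is used about the primitive of the weight in the flux. The bound 1 makes
  composition with \<open>G\<close> nonexpansive in L^2 and multiplication by \<open>G'\<close>
  harmless for square integrability.\<close>

locale C1_contraction =
  fixes G G' :: "real \<Rightarrow> real"
  assumes deriv: "(G has_real_derivative G' s) (at s)"
    and deriv_cont: "continuous_on UNIV G'"
    and deriv_bound: "\<bar>G' s\<bar> \<le> 1"
begin

lemma contraction: "\<bar>G a - G b\<bar> \<le> \<bar>a - b\<bar>"
  using field_differentiable_bound[of UNIV G G' 1 a b] deriv deriv_bound by simp

lemma cont: "continuous_on UNIV G"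
  using deriv by (auto intro!: continuous_at_imp_continuous_on DERIV_isCont)

lemma square_integrable_compose:
  assumes "f square_integrable_on {0<..<1}"
  shows "(\<lambda>x. G (f x)) square_integrable_on {0<..<1}"
proof (rule square_integrable_bound)
  show "(\<lambda>x. \<bar>f x\<bar> + \<bar>G 0\<bar>) square_integrable_on {0<..<1}"
    using assms by (intro square_integrable_add square_integrable_const) (auto simp: square_integrable_on_def)
  show "AE x in lebesgue_on {0<..<1}. \<bar>G (f x)\<bar> \<le> \<bar>f x\<bar> + \<bar>G 0\<bar>"
  proof (rule AE_I2)
    fix x show "\<bar>G (f x)\<bar> \<le> \<bar>f x\<bar> + \<bar>G 0\<bar>"
      using contraction[of "f x" 0] by linarith
  qed
qed (rule measurable_continuous_compose[OF cont square_integrable_imp_measurable[OF assms]])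

lemma tendsto_compose:
  assumes "w \<longlonglongrightarrow> v"
  shows "(\<lambda>n. abs_L2 (\<lambda>x. G (rep_L2 (w n) x))) \<longlonglongrightarrow> abs_L2 (\<lambda>x. G (rep_L2 v x))"
proof -
  note sq = square_integrable_compose[OF rep_L2_square_integrable]
  have "norm (abs_L2 (\<lambda>x. G (rep_L2 a x)) - abs_L2 (\<lambda>x. G (rep_L2 b x))) \<le> norm (a - b)" for a b
    unfolding abs_L2_diff[OF sq sq]
  proof (rule norm_abs_L2_le)
    show "(\<lambda>x. G (rep_L2 a x) - G (rep_L2 b x)) \<in> borel_measurable (lebesgue_on {0<..<1})"
      by (intro borel_measurable_diff square_integrable_imp_measurable[OF sq])
    show "AE x in lebesgue_on {0<..<1}. \<bar>G (rep_L2 a x) - G (rep_L2 b x)\<bar> \<le> \<bar>rep_L2 (a - b) x\<bar>"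
      using rep_L2_minus[of a b] by eventually_elim (simp add: contraction)
  qed
  moreover have "(\<lambda>n. norm (w n - v)) \<longlonglongrightarrow> 0"
    using assms by (simp add: tendsto_norm_zero LIM_zero)
  ultimately have "(\<lambda>n. abs_L2 (\<lambda>x. G (rep_L2 (w n) x)) - abs_L2 (\<lambda>x. G (rep_L2 v x))) \<longlonglongrightarrow> 0"
    by (rule Lim_null_comparison[OF always_eventually[OF allI]])
  then show ?thesis by (rule LIM_zero_cancel)
qed

lemma square_integrable_deriv_mult:
  assumes f: "f \<in> borel_measurable (lebesgue_on {0<..<1})" and g: "g square_integrable_on {0<..<1}"
  shows "(\<lambda>x. G' (f x) * g x) square_integrable_on {0<..<1}"
proof (rule square_integrable_bound)
  show "(\<lambda>x. \<bar>g x\<bar>) square_integrable_on {0<..<1}"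
    using g by (auto simp: square_integrable_on_def)
  show "(\<lambda>x. G' (f x) * g x) \<in> borel_measurable (lebesgue_on {0<..<1})"
    by (intro borel_measurable_times measurable_continuous_compose[OF deriv_cont f]
        square_integrable_imp_measurable[OF g])
  show "AE x in lebesgue_on {0<..<1}. \<bar>G' (f x) * g x\<bar> \<le> \<bar>g x\<bar>"
    using deriv_bound by (auto simp: abs_mult intro!: mult_left_le_one_le)
qed

text \<open>The coefficient converges only pointwise, the other factor in L^2. With
  \<open>G' (f_n n x) * rep_L2 g x\<close> inserted in between, one error is controlled by the bound
  on \<open>G'\<close>, the other by domination with \<open>\<bar>rep_L2 g x\<bar>\<close>.\<close>

lemma tendsto_deriv_mult:
  assumes f_n: "\<And>n. f_n n \<in> borel_measurable (lebesgue_on {0<..<1})"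
    and lim: "\<And>x. (\<lambda>n. f_n n x) \<longlonglongrightarrow> f x" and f: "f \<in> borel_measurable (lebesgue_on {0<..<1})"
    and g_n: "\<And>n. g_n n square_integrable_on {0<..<1}" and g: "(\<lambda>n. abs_L2 (g_n n)) \<longlonglongrightarrow> g"
  shows "(\<lambda>n. abs_L2 (\<lambda>x. G' (f_n n x) * g_n n x)) \<longlonglongrightarrow> abs_L2 (\<lambda>x. G' (f x) * rep_L2 g x)"
proof -
  note rg = rep_L2_square_integrable[of g]
  have gm: "(\<lambda>x. G' (h x) * rep_L2 g x) \<in> borel_measurable (lebesgue_on {0<..<1})"
    if "h \<in> borel_measurable (lebesgue_on {0<..<1})" for h
    by (rule square_integrable_imp_measurable[OF square_integrable_deriv_mult[OF that rg]])
  have "(\<lambda>n. abs_L2 (\<lambda>x. G' (f_n n x) * rep_L2 g x)) \<longlonglongrightarrow> abs_L2 (\<lambda>x. G' (f x) * rep_L2 g x)"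
  proof (rule L2_dominated_convergence)
    show "(\<lambda>x. \<bar>rep_L2 g x\<bar>) square_integrable_on {0<..<1}"
      using rg by (auto simp: square_integrable_on_def)
    show "AE x in lebesgue_on {0<..<1}. \<bar>G' (f_n n x) * rep_L2 g x\<bar> \<le> \<bar>rep_L2 g x\<bar>" for n
      using deriv_bound by (auto simp: abs_mult intro!: mult_left_le_one_le)
    show "AE x in lebesgue_on {0<..<1}. (\<lambda>n. G' (f_n n x) * rep_L2 g x) \<longlonglongrightarrow> G' (f x) * rep_L2 g x"
    proof (rule AE_I2)
      fix x
      have "(\<lambda>n. G' (f_n n x)) \<longlonglongrightarrow> G' (f x)"
        by (rule continuous_on_tendsto_compose[OF deriv_cont lim]) auto
      then show "(\<lambda>n. G' (f_n n x) * rep_L2 g x) \<longlonglongrightarrow> G' (f x) * rep_L2 g x"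
        by (intro tendsto_mult tendsto_const)
    qed
  qed (intro gm f_n f)+
  moreover have "(\<lambda>n. abs_L2 (\<lambda>x. G' (f_n n x) * g_n n x) - abs_L2 (\<lambda>x. G' (f_n n x) * rep_L2 g x)) \<longlonglongrightarrow> 0"
  proof (rule Lim_null_comparison[OF always_eventually[OF allI]])
    show "(\<lambda>n. norm (abs_L2 (g_n n) - g)) \<longlonglongrightarrow> 0"
      using g by (simp add: tendsto_norm_zero LIM_zero)
    fix n
    note sq = square_integrable_deriv_mult[OF f_n g_n] square_integrable_deriv_mult[OF f_n rg]
    show "norm (abs_L2 (\<lambda>x. G' (f_n n x) * g_n n x) - abs_L2 (\<lambda>x. G' (f_n n x) * rep_L2 g x))
        \<le> norm (abs_L2 (g_n n) - g)"
      unfolding abs_L2_diff[OF sq]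
    proof (rule norm_abs_L2_le)
      show "(\<lambda>x. G' (f_n n x) * g_n n x - G' (f_n n x) * rep_L2 g x) \<in> borel_measurable (lebesgue_on {0<..<1})"
        by (intro borel_measurable_diff square_integrable_imp_measurable[OF sq(1)] gm f_n)
      show "AE x in lebesgue_on {0<..<1}. \<bar>G' (f_n n x) * g_n n x - G' (f_n n x) * rep_L2 g x\<bar>
          \<le> \<bar>rep_L2 (abs_L2 (g_n n) - g) x\<bar>"
        using rep_L2_minus[of "abs_L2 (g_n n)" g] rep_abs_L2[OF g_n[of n]]
      proof eventually_elim
        case (elim x)
        have "\<bar>G' (f_n n x) * (g_n n x - rep_L2 g x)\<bar> \<le> \<bar>g_n n x - rep_L2 g x\<bar>"
          using deriv_bound by (auto simp: abs_mult intro!: mult_left_le_one_le)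
        then show ?case using elim by (simp add: right_diff_distrib)
      qed
    qed
  qed
  ultimately show ?thesis using tendsto_add by fastforce
qed

text \<open>The weak chain rule. When test functions replace the weak derivative of
  \<open>w\<close>, the corresponding primitives are C^1 and the classical chain rule applies; both
  sides converge.\<close>

lemma test_inner_chain_rule:
  assumes w: "w \<in> W12_01" and \<psi>: "test_function_on {0<..<1} \<psi>"
  shows "abs_L2 (deriv \<psi>) \<bullet> abs_L2 (\<lambda>x. G (rep_L2 w x)) =
    - (abs_L2 \<psi> \<bullet> abs_L2 (\<lambda>x. G' (rep_L2 w x) * rep_L2 (L2_wderiv w) x))"
proof -
  let ?g = "L2_wderiv w"
  obtain c where c: "w = abs_L2 (\<lambda>x. c + primitive ?g x)"
    by (rule W12_01_eq_primitive[OF w])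
  obtain \<phi> where \<phi>: "\<And>n. test_function_on {0<..<1} (\<phi> n)" "(\<lambda>n. abs_L2 (\<phi> n)) \<longlonglongrightarrow> ?g"
    using L2_approx_test_functions by blast
  define f where "f = (\<lambda>x. c + primitive ?g x)"
  \<comment> \<open>Same constant \<open>c\<close>, approximate derivative. Since
    \<open>primitive\<close> is an inner product, these functions converge at every point, as the
    coefficient \<open>G' (f_n n x)\<close> requires.\<close>
  define f_n where "f_n = (\<lambda>n x. c + primitive (abs_L2 (\<phi> n)) x)"
  have fs: "f square_integrable_on {0<..<1}" "f_n n square_integrable_on {0<..<1}" for n
    unfolding f_def f_n_def by (intro square_integrable_add square_integrable_const square_integrable_primitive)+
  note fm = square_integrable_imp_measurable[OF fs(1)] square_integrable_imp_measurable[OF fs(2)]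
  have wf: "w = abs_L2 f" unfolding f_def by (rule c)
  have "(\<lambda>n. abs_L2 (f_n n)) \<longlonglongrightarrow> w"
    unfolding wf unfolding f_n_def f_def
      abs_L2_add[OF square_integrable_const square_integrable_primitive, symmetric]
    by (intro tendsto_intros tendsto_abs_L2_primitive \<phi>)
  then have "(\<lambda>n. abs_L2 (\<lambda>x. G (rep_L2 (abs_L2 (f_n n)) x))) \<longlonglongrightarrow> abs_L2 (\<lambda>x. G (rep_L2 w x))"
    by (rule tendsto_compose)
  moreover have "abs_L2 (\<lambda>x. G (rep_L2 (abs_L2 (f_n n)) x)) = abs_L2 (\<lambda>x. G (f_n n x))" for n
  proof (rule abs_L2_eq_AE)
    show "AE x in lebesgue_on {0<..<1}. G (rep_L2 (abs_L2 (f_n n)) x) = G (f_n n x)"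
      using rep_abs_L2[OF fs(2)[of n]] by eventually_elim simp
  qed (intro square_integrable_compose fs measurable_continuous_compose[OF cont] borel_measurable_rep_L2)+
  ultimately have lim1: "(\<lambda>n. abs_L2 (\<lambda>x. G (f_n n x))) \<longlonglongrightarrow> abs_L2 (\<lambda>x. G (rep_L2 w x))"
    by simp
  have lim2: "(\<lambda>n. abs_L2 (\<lambda>x. G' (f_n n x) * \<phi> n x)) \<longlonglongrightarrow> abs_L2 (\<lambda>x. G' (f x) * rep_L2 ?g x)"
  proof (rule tendsto_deriv_mult[OF fm(2) _ fm(1) test_function_square_integrable[OF \<phi>(1)] \<phi>(2)])
    show "(\<lambda>n. f_n n x) \<longlonglongrightarrow> f x" for x
      unfolding f_n_def f_def primitive_def by (intro tendsto_intros \<phi>)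
  qed
  have "abs_L2 (deriv \<psi>) \<bullet> abs_L2 (\<lambda>x. G (f_n n x)) = - (abs_L2 \<psi> \<bullet> abs_L2 (\<lambda>x. G' (f_n n x) * \<phi> n x))" for n
  proof (rule abs_L2_test_inner_C1[OF _ _ \<psi>])
    have \<phi>c: "continuous_on {0..1} (\<phi> n)"
      by (rule continuous_on_subset[OF test_function_continuous[OF \<phi>(1)]]) simp
    have "continuous_on {0..1} (f_n n)"
      unfolding f_n_def by (intro continuous_intros continuous_on_primitive)
    then show "continuous_on {0..1} (\<lambda>x. G' (f_n n x) * \<phi> n x)"
      by (intro continuous_on_mult \<phi>c continuous_on_compose2[OF deriv_cont]) auto
    fix x :: real assume x: "x \<in> {0..1}"
    have "(f_n n has_real_derivative \<phi> n x) (at x within {0..1})"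
      unfolding f_n_def using DERIV_add[OF DERIV_const primitive_continuous_DERIV[OF \<phi>c x]] by simp
    then show "((\<lambda>x. G (f_n n x)) has_real_derivative G' (f_n n x) * \<phi> n x) (at x within {0..1})"
      by (rule DERIV_chain2[OF deriv])
  qed
  moreover have "(\<lambda>n. abs_L2 (deriv \<psi>) \<bullet> abs_L2 (\<lambda>x. G (f_n n x))) \<longlonglongrightarrow>
      abs_L2 (deriv \<psi>) \<bullet> abs_L2 (\<lambda>x. G (rep_L2 w x))"
    by (intro tendsto_intros lim1)
  moreover have "(\<lambda>n. - (abs_L2 \<psi> \<bullet> abs_L2 (\<lambda>x. G' (f_n n x) * \<phi> n x))) \<longlonglongrightarrow>
      - (abs_L2 \<psi> \<bullet> abs_L2 (\<lambda>x. G' (f x) * rep_L2 ?g x))"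
    by (intro tendsto_intros lim2)
  ultimately have "abs_L2 (deriv \<psi>) \<bullet> abs_L2 (\<lambda>x. G (rep_L2 w x)) =
      - (abs_L2 \<psi> \<bullet> abs_L2 (\<lambda>x. G' (f x) * rep_L2 ?g x))"
    using LIMSEQ_unique by simp
  also have "abs_L2 (\<lambda>x. G' (f x) * rep_L2 ?g x) = abs_L2 (\<lambda>x. G' (rep_L2 w x) * rep_L2 ?g x)"
  proof (rule abs_L2_eq_AE)
    have "AE x in lebesgue_on {0<..<1}. rep_L2 w x = f x"
      unfolding wf by (rule rep_abs_L2[OF fs(1)])
    then show "AE x in lebesgue_on {0<..<1}. G' (f x) * rep_L2 ?g x = G' (rep_L2 w x) * rep_L2 ?g x"
      by eventually_elim simp
  qed (intro square_integrable_imp_measurable square_integrable_deriv_mult fm(1)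
      borel_measurable_rep_L2 rep_L2_square_integrable)+
  finally show ?thesis .
qed

end

text \<open>The A of the overview. The exponent is half of the one in the energy; the weight is at
  most 1, so the product is square integrable.\<close>

definition flux :: "W22_0 \<Rightarrow> L2" where
  "flux u = abs_L2 (\<lambda>x. (1 + (rep_L2 (L2_wderiv (W22_0_to_L2 u)) x)\<^sup>2) powr (- 5 / 4) *
     rep_L2 (L2_wderiv (L2_wderiv (W22_0_to_L2 u))) x)"

lemma flux_primitive_exists:
  obtains G where "C1_contraction G (\<lambda>s. (1 + s\<^sup>2) powr (- 5 / 4))"
proof -
  let ?G' = "\<lambda>s::real. (1 + s\<^sup>2) powr (- 5 / 4)"
  have pos: "1 + s\<^sup>2 \<noteq> 0" for s :: real using zero_le_power2[of s] by linarith
  have cont: "continuous_on UNIV ?G'" using pos by (intro continuous_intros) auto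
  have "isCont ?G' s" for s using cont by (simp add: continuous_on_eq_continuous_at)
  then obtain G where "\<forall>s. (G has_vector_derivative ?G' s) (at s)"
    using einterval_antiderivative[of "-\<infinity>" "\<infinity>" ?G'] by force
  moreover have "\<bar>?G' s\<bar> \<le> 1" for s
    using powr_mono2'[of "- 5 / 4" 1 "1 + s\<^sup>2"] by simp
  ultimately have "C1_contraction G ?G'"
    using cont by unfold_locales (auto simp: has_real_derivative_iff_has_vector_derivative)
  then show thesis by (rule that)
qed

lemma energy_eq_norm_flux: "energy u = (norm (flux u))\<^sup>2"
proof -
  obtain G where "C1_contraction G (\<lambda>s. (1 + s\<^sup>2) powr (- 5 / 4))"
    by (rule flux_primitive_exists)
  then interpret C1_contraction G "\<lambda>s. (1 + s\<^sup>2) powr (- 5 / 4)" .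
  note sq = square_integrable_deriv_mult[OF borel_measurable_rep_L2 rep_L2_square_integrable]
  have "a\<^sup>2 / (1 + s\<^sup>2) powr (5 / 2) = (1 + s\<^sup>2) powr (- 5 / 4) * a * ((1 + s\<^sup>2) powr (- 5 / 4) * a)"
    for a s :: real
  proof -
    have "(1 + s\<^sup>2) powr (- 5 / 4) * (1 + s\<^sup>2) powr (- 5 / 4) = (1 + s\<^sup>2) powr (- (5 / 2))"
      by (simp flip: powr_add)
    then show ?thesis by (simp add: powr_minus_divide power2_eq_square field_simps)
  qed
  then show ?thesis
    unfolding energy_def flux_def power2_norm_eq_inner inner_abs_abs_L2[OF sq sq] by (simp only:)
qed

text \<open>The flux contains the second derivative, over which \<open>lim\<close> gives no control.
  The chain rule moves that derivative onto \<psi>, and what remains depends on the first derivative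
  through the contraction \<open>G\<close>.\<close>

lemma tendsto_test_inner_flux:
  assumes \<psi>: "test_function_on {0<..<1} \<psi>"
    and lim: "(\<lambda>n. L2_wderiv (W22_0_to_L2 (U n))) \<longlonglongrightarrow> L2_wderiv (W22_0_to_L2 u)"
  shows "(\<lambda>n. abs_L2 \<psi> \<bullet> flux (U n)) \<longlonglongrightarrow> abs_L2 \<psi> \<bullet> flux u"
proof -
  obtain G where "C1_contraction G (\<lambda>s. (1 + s\<^sup>2) powr (- 5 / 4))"
    by (rule flux_primitive_exists)
  then interpret C1_contraction G "\<lambda>s. (1 + s\<^sup>2) powr (- 5 / 4)" .
  have "abs_L2 \<psi> \<bullet> flux v =
      - (abs_L2 (deriv \<psi>) \<bullet> abs_L2 (\<lambda>x. G (rep_L2 (L2_wderiv (W22_0_to_L2 v)) x)))" for v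
  proof -
    have "L2_wderiv (W22_0_to_L2 v) \<in> W12_01"
      using W22_0_to_L2[of v] by (simp add: W22_01_def)
    from test_inner_chain_rule[OF this \<psi>] show ?thesis by (simp add: flux_def)
  qed
  then show ?thesis by (simp only:) (intro tendsto_intros tendsto_compose lim)
qed

section \<open>Weak derivatives in time\<close>

lemma locally_integrable_lincomb:
  fixes f g :: "real \<Rightarrow> 'b::{banach, second_countable_topology}"
  assumes "f locally_integrable_on S" "g locally_integrable_on S"
  shows "(\<lambda>x. a *\<^sub>R f x + b *\<^sub>R g x) locally_integrable_on S"
  using assms unfolding locally_integrable_on_def by auto

lemma integrable_imp_locally_integrable:
  fixes f :: "real \<Rightarrow> 'b::{banach, second_countable_topology}"
  assumes f: "integrable (lebesgue_on S) f" and S: "S \<in> sets lebesgue"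
  shows "f locally_integrable_on S"
  unfolding locally_integrable_on_def
proof (intro allI impI)
  fix K assume K: "compact K \<and> K \<subseteq> S"
  have "set_integrable lebesgue S f"
    using f S by (simp add: integrable_restrict_space set_integrable_def)
  then have "set_integrable lebesgue K f"
    by (rule set_integrable_subset) (use K in \<open>auto simp: lmeasurable_compact fmeasurableD\<close>)
  then show "integrable (lebesgue_on K) f"
    using K by (simp add: integrable_restrict_space set_integrable_def lmeasurable_compact fmeasurableD)
qed

lemma weak_derivative_on_lincomb:
  fixes f g :: "real \<Rightarrow> 'b::{banach, second_countable_topology}"
  assumes f: "weak_derivative_on S f f'" and g: "weak_derivative_on S g g'" and S: "S \<in> sets lebesgue"
  shows "weak_derivative_on S (\<lambda>x. a *\<^sub>R f x + b *\<^sub>R g x) (\<lambda>x. a *\<^sub>R f' x + b *\<^sub>R g' x)"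
proof -
  note li = f[unfolded weak_derivative_on_def, THEN conjunct1] f[unfolded weak_derivative_on_def, THEN conjunct2, THEN conjunct1]
    g[unfolded weak_derivative_on_def, THEN conjunct1] g[unfolded weak_derivative_on_def, THEN conjunct2, THEN conjunct1]
  have "(LINT x|lebesgue_on S. \<phi> x *\<^sub>R (a *\<^sub>R p x + b *\<^sub>R q x)) =
      a *\<^sub>R (LINT x|lebesgue_on S. \<phi> x *\<^sub>R p x) + b *\<^sub>R (LINT x|lebesgue_on S. \<phi> x *\<^sub>R q x)"
    if "test_function_on S \<phi>" "p locally_integrable_on S" "q locally_integrable_on S" for \<phi> and p q :: "real \<Rightarrow> 'b"
  proof -
    have "\<phi> x *\<^sub>R (a *\<^sub>R p x + b *\<^sub>R q x) = a *\<^sub>R (\<phi> x *\<^sub>R p x) + b *\<^sub>R (\<phi> x *\<^sub>R q x)" for x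
      by (simp add: scaleR_add_right mult.commute)
    then show ?thesis
      using locally_integrable_test_mult[OF that(2,1) S] locally_integrable_test_mult[OF that(3,1) S]
      by (simp only:) (simp del: scaleR_scaleR)
  qed
  note eq = this
  show ?thesis
    unfolding weak_derivative_on_def
  proof (intro conjI locally_integrable_lincomb li allI impI)
    fix \<phi> assume \<phi>: "test_function_on S \<phi>"
    have "(LINT x|lebesgue_on S. deriv \<phi> x *\<^sub>R f x) = - (LINT x|lebesgue_on S. \<phi> x *\<^sub>R f' x)"
      "(LINT x|lebesgue_on S. deriv \<phi> x *\<^sub>R g x) = - (LINT x|lebesgue_on S. \<phi> x *\<^sub>R g' x)"
      using f g \<phi> by (auto simp: weak_derivative_on_def)
    then show "(LINT x|lebesgue_on S. deriv \<phi> x *\<^sub>R (a *\<^sub>R f x + b *\<^sub>R g x)) =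
        - (LINT x|lebesgue_on S. \<phi> x *\<^sub>R (a *\<^sub>R f' x + b *\<^sub>R g' x))"
      by (simp add: eq[OF test_function_deriv[OF \<phi>] li(1) li(3)] eq[OF \<phi> li(2) li(4)])
  qed
qed

text \<open>Pairing with a fixed vector commutes with the Bochner integral. This reduces questions
  about vector-valued functions of time to real ones.\<close>

lemma weak_derivative_on_inner:
  fixes f :: "real \<Rightarrow> 'b::{real_inner, banach, second_countable_topology}"
  assumes f: "weak_derivative_on S f g" and S: "S \<in> sets lebesgue"
  shows "weak_derivative_on S (\<lambda>x. f x \<bullet> y) (\<lambda>x. g x \<bullet> y)"
proof -
  have li: "f locally_integrable_on S" "g locally_integrable_on S"
    and wd: "\<And>\<phi>. test_function_on S \<phi> \<Longrightarrow>
      (LINT x|lebesgue_on S. deriv \<phi> x *\<^sub>R f x) = - (LINT x|lebesgue_on S. \<phi> x *\<^sub>R g x)"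
    using f by (auto simp: weak_derivative_on_def)
  have eq: "(LINT x|lebesgue_on S. \<phi> x *\<^sub>R (p x \<bullet> y)) = (LINT x|lebesgue_on S. \<phi> x *\<^sub>R p x) \<bullet> y"
    if "test_function_on S \<phi>" "p locally_integrable_on S" for \<phi> and p :: "real \<Rightarrow> 'b"
    using integral_inner_left[of y "lebesgue_on S" "\<lambda>x. \<phi> x *\<^sub>R p x"] locally_integrable_test_mult[OF that(2,1) S]
    by simp
  show ?thesis
    unfolding weak_derivative_on_def
  proof (intro conjI allI impI)
    show "(\<lambda>x. f x \<bullet> y) locally_integrable_on S" "(\<lambda>x. g x \<bullet> y) locally_integrable_on S"
      using li by (auto simp: locally_integrable_on_def)
    fix \<phi> assume \<phi>: "test_function_on S \<phi>"
    show "(LINT x|lebesgue_on S. deriv \<phi> x *\<^sub>R (f x \<bullet> y)) = - (LINT x|lebesgue_on S. \<phi> x *\<^sub>R (g x \<bullet> y))"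
      unfolding eq[OF test_function_deriv[OF \<phi>] li(1)] eq[OF \<phi> li(2)] wd[OF \<phi>] by simp
  qed
qed

text \<open>The exceptional null set may depend on \<open>y\<close>, so only countably many
  \<open>y\<close> can be used at once; separability supplies a countable dense set.\<close>

lemma AE_eq_if_AE_inner_eq:
  fixes g h :: "'a \<Rightarrow> 'b::{real_inner, second_countable_topology}"
  assumes "\<And>y. AE x in M. g x \<bullet> y = h x \<bullet> y"
  shows "AE x in M. g x = h x"
proof -
  obtain D :: "'b set" where D: "countable D" "\<And>p. open p \<Longrightarrow> p \<noteq> {} \<Longrightarrow> \<exists>d\<in>D. d \<in> p"
    using countable_dense_exists by blast
  have "AE x in M. \<forall>d\<in>D. g x \<bullet> d = h x \<bullet> d"
    using D(1) assms by (simp add: AE_ball_countable)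
  then show ?thesis
  proof eventually_elim
    case (elim x)
    let ?z = "g x - h x"
    show ?case
    proof (rule ccontr)
      assume "g x \<noteq> h x"
      then have z: "norm ?z > 0" by simp
      \<comment> \<open>The radius \<open>norm ?z\<close> makes the Cauchy-Schwarz bound below
        strict: \<open>?z\<close> is orthogonal to \<open>d\<close>, so its squared norm is
        \<open>?z \<bullet> (?z - d)\<close>.\<close>
      then obtain d where d: "d \<in> D" "dist ?z d < norm ?z"
        using D(2)[of "ball ?z (norm ?z)"] by auto
      have "?z \<bullet> d = 0" using elim d(1) by (simp add: inner_diff_left)
      then have "(norm ?z)\<^sup>2 = ?z \<bullet> (?z - d)" by (simp only: inner_diff_right power2_norm_eq_inner)
      also have "\<dots> \<le> norm ?z * norm (?z - d)" by (rule norm_cauchy_schwarz)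
      also have "\<dots> < norm ?z * norm ?z" using d(2) z by (simp add: dist_norm)
      finally show False by (simp add: power2_eq_square)
    qed
  qed
qed

lemma weak_derivative_unique_real:
  fixes f g h :: "real \<Rightarrow> real"
  assumes g: "weak_derivative_on {a<..<b} f g" and h: "weak_derivative_on {a<..<b} f h"
  shows "AE x in lebesgue_on {a<..<b}. g x = h x"
proof -
  have li: "g locally_integrable_on {a<..<b}" "h locally_integrable_on {a<..<b}"
    using g h by (auto simp: weak_derivative_on_def)
  have "AE x in lebesgue_on {a<..<b}. g x - h x = 0"
  proof (rule AE_zero_if_test_integrals_zero)
    show "(\<lambda>x. g x - h x) locally_integrable_on {a<..<b}"
      using locally_integrable_lincomb[OF li, of 1 "-1"] by simp
    fix \<phi> assume \<phi>: "test_function_on {a<..<b} \<phi>"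
    have "(LINT x|lebesgue_on {a<..<b}. \<phi> x * g x) = (LINT x|lebesgue_on {a<..<b}. \<phi> x * h x)"
      using g h \<phi> by (simp add: weak_derivative_on_def)
    then show "(LINT x|lebesgue_on {a<..<b}. \<phi> x * (g x - h x)) = 0"
      using locally_integrable_test_mult[OF li(1) \<phi>] locally_integrable_test_mult[OF li(2) \<phi>]
      by (simp add: right_diff_distrib)
  qed
  then show ?thesis by eventually_elim simp
qed

lemma weak_derivative_unique:
  fixes f g h :: "real \<Rightarrow> 'b::{real_inner, banach, second_countable_topology}"
  assumes "weak_derivative_on {a<..<b} f g" "weak_derivative_on {a<..<b} f h"
  shows "AE x in lebesgue_on {a<..<b}. g x = h x"
proof (rule AE_eq_if_AE_inner_eq)
  show "AE x in lebesgue_on {a<..<b}. g x \<bullet> y = h x \<bullet> y" for y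
    by (rule weak_derivative_unique_real[OF weak_derivative_on_inner weak_derivative_on_inner])
      (use assms in simp_all)
qed

text \<open>The flow has its time derivative on \<open>{0<..}\<close>, whereas weak convergence is
  stated on bounded intervals. Restriction links the two, because a test function on the smaller set
  is one on the larger.\<close>

lemma weak_derivative_on_mono:
  fixes f g :: "real \<Rightarrow> 'b::{banach, second_countable_topology}"
  assumes f: "weak_derivative_on S' f g" and S: "S \<subseteq> S'" "S \<in> sets lebesgue" "S' \<in> sets lebesgue"
  shows "weak_derivative_on S f g"
  unfolding weak_derivative_on_def
proof (intro conjI allI impI)
  show "f locally_integrable_on S" "g locally_integrable_on S"
    using f S(1) by (auto simp: weak_derivative_on_def locally_integrable_on_def)
  fix \<phi> assume \<phi>: "test_function_on S \<phi>"
  have eq: "(LINT x|lebesgue_on S'. \<psi> x *\<^sub>R p x) = (LINT x|lebesgue_on S. \<psi> x *\<^sub>R p x)"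
    if \<psi>: "test_function_on S \<psi>" for \<psi> and p :: "real \<Rightarrow> 'b"
  proof -
    have "indicat_real S' x *\<^sub>R \<psi> x *\<^sub>R p x = indicat_real S x *\<^sub>R \<psi> x *\<^sub>R p x" for x
      using \<psi> S(1) by (cases "x \<in> S") (auto simp: test_function_on_def indicator_def)
    then have "(LINT x|lebesgue. indicat_real S' x *\<^sub>R \<psi> x *\<^sub>R p x) = (LINT x|lebesgue. indicat_real S x *\<^sub>R \<psi> x *\<^sub>R p x)"
      by (simp only:)
    moreover have "(LINT x|lebesgue_on A. \<psi> x *\<^sub>R p x) = (LINT x|lebesgue. indicat_real A x *\<^sub>R \<psi> x *\<^sub>R p x)"
      if "A \<in> sets lebesgue" for A
      using that by (subst integral_restrict_space) auto
    ultimately show ?thesis using S(2,3) by simp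
  qed
  show "(LINT x|lebesgue_on S. deriv \<phi> x *\<^sub>R f x) = - (LINT x|lebesgue_on S. \<phi> x *\<^sub>R g x)"
    using f test_function_mono[OF \<phi> S(1)]
    by (simp add: weak_derivative_on_def eq[OF \<phi>, symmetric] eq[OF test_function_deriv[OF \<phi>], symmetric])
qed

lemma wderiv_on_weak_derivative: "weak_derivative_on S f g \<Longrightarrow> weak_derivative_on S f (wderiv_on S f)"
  unfolding wderiv_on_def by (rule someI[where P = "weak_derivative_on S f"])

text \<open>The version selected by \<open>wderiv_on\<close> need not be the square integrable one
  from \<open>D12_on\<close>; by uniqueness the two agree almost everywhere.\<close>

lemma D12_on_wderiv_on:
  fixes f :: "real \<Rightarrow> 'b::{real_inner, banach, second_countable_topology}"
  assumes "D12_on {a<..<b} f"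
  shows "weak_derivative_on {a<..<b} f (wderiv_on {a<..<b} f)" "wderiv_on {a<..<b} f square_integrable_on {a<..<b}"
proof -
  obtain v where v: "weak_derivative_on {a<..<b} f v" "v square_integrable_on {a<..<b}"
    using assms by (auto simp: D12_on_def)
  show w: "weak_derivative_on {a<..<b} f (wderiv_on {a<..<b} f)"
    by (rule wderiv_on_weak_derivative[OF v(1)])
  have m: "wderiv_on {a<..<b} f \<in> borel_measurable (lebesgue_on {a<..<b})"
    using w by (intro locally_integrable_imp_measurable) (simp add: weak_derivative_on_def)
  have "integrable (lebesgue_on {a<..<b}) (\<lambda>t. (norm (wderiv_on {a<..<b} f t))\<^sup>2)"
  proof (rule integrable_cong_AE_imp)
    show "integrable (lebesgue_on {a<..<b}) (\<lambda>t. (norm (v t))\<^sup>2)"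
      using v(2) by (simp add: square_integrable_on_def)
    show "(\<lambda>t. (norm (wderiv_on {a<..<b} f t))\<^sup>2) \<in> borel_measurable (lebesgue_on {a<..<b})"
      using m by measurable
    show "AE t in lebesgue_on {a<..<b}. (norm (v t))\<^sup>2 = (norm (wderiv_on {a<..<b} f t))\<^sup>2"
      using weak_derivative_unique[OF v(1) w] by eventually_elim simp
  qed
  with m show "wderiv_on {a<..<b} f square_integrable_on {a<..<b}" by (simp add: square_integrable_on_def)
qed

section \<open>Square integrable functions of time and weak convergence\<close>

lemma square_integrable_inner:
  fixes p h :: "real \<Rightarrow> 'b::{real_inner, second_countable_topology}"
  assumes p: "p square_integrable_on S" and h: "h square_integrable_on S"
  shows "integrable (lebesgue_on S) (\<lambda>t. p t \<bullet> h t)"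
proof (rule Bochner_Integration.integrable_bound)
  show "integrable (lebesgue_on S) (\<lambda>t. (norm (p t))\<^sup>2 + (norm (h t))\<^sup>2)"
    using assms by (simp add: square_integrable_on_def)
  show "(\<lambda>t. p t \<bullet> h t) \<in> borel_measurable (lebesgue_on S)"
    using assms by (auto simp: square_integrable_on_def)
  have "\<bar>x \<bullet> y\<bar> \<le> (norm x)\<^sup>2 + (norm y)\<^sup>2" for x y :: 'b
  proof -
    have "0 \<le> norm x * norm y" by simp
    then show ?thesis
      using Cauchy_Schwarz_ineq2[of x y] sum_squares_bound[of "norm x" "norm y"] by linarith
  qed
  then show "AE t in lebesgue_on S. norm (p t \<bullet> h t) \<le> norm ((norm (p t))\<^sup>2 + (norm (h t))\<^sup>2)"
    by simp
qed

text \<open>The integrated form of \<open>0 \<le> (norm (p t - h t))\<^sup>2\<close>. The left side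
  is affine in \<open>p\<close> and so passes to weak limits; this serves as the semicontinuity of
  the dissipation.\<close>

lemma integral_inner_le_norms:
  fixes p h :: "real \<Rightarrow> 'b::{real_inner, second_countable_topology}"
  assumes p: "p square_integrable_on S" and h: "h square_integrable_on S"
  shows "2 * (LINT t|lebesgue_on S. p t \<bullet> h t) - (LINT t|lebesgue_on S. (norm (h t))\<^sup>2)
    \<le> (LINT t|lebesgue_on S. (norm (p t))\<^sup>2)"
proof -
  note i = square_integrable_inner[OF p h]
  have ih: "integrable (lebesgue_on S) (\<lambda>t. (norm (h t))\<^sup>2)" and ip: "integrable (lebesgue_on S) (\<lambda>t. (norm (p t))\<^sup>2)"
    using p h by (auto simp: square_integrable_on_def)
  have "(LINT t|lebesgue_on S. 2 * (p t \<bullet> h t) - (norm (h t))\<^sup>2) \<le> (LINT t|lebesgue_on S. (norm (p t))\<^sup>2)"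
  proof (rule integral_mono)
    fix t
    have "0 \<le> (p t - h t) \<bullet> (p t - h t)" by simp
    then show "2 * (p t \<bullet> h t) - (norm (h t))\<^sup>2 \<le> (norm (p t))\<^sup>2"
      by (simp add: power2_norm_eq_inner inner_diff_left inner_diff_right inner_commute)
  qed (use i ih ip in auto)
  then show ?thesis using i ih by simp
qed

text \<open>Obtained from the previous inequality by optimizing over multiples of
  \<open>p\<close>.\<close>

lemma Cauchy_Schwarz_integral:
  fixes p h :: "real \<Rightarrow> 'b::{real_inner, second_countable_topology}"
  assumes p: "p square_integrable_on S" and h: "h square_integrable_on S"
  shows "\<bar>LINT t|lebesgue_on S. p t \<bullet> h t\<bar> \<le>
    sqrt (LINT t|lebesgue_on S. (norm (h t))\<^sup>2) * sqrt (LINT t|lebesgue_on S. (norm (p t))\<^sup>2)"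
    (is "\<bar>?F\<bar> \<le> sqrt ?H * sqrt ?P")
proof -
  have quad: "2 * s * ?F - ?H \<le> s\<^sup>2 * ?P" for s
  proof -
    have "(\<lambda>t. s *\<^sub>R p t) square_integrable_on S"
      using p by (auto simp: square_integrable_on_def power_mult_distrib)
    from integral_inner_le_norms[OF this h] show ?thesis
      by (simp add: power_mult_distrib)
  qed
  have P: "0 \<le> ?P" by (rule integral_nonneg_AE) simp
  have "?F\<^sup>2 \<le> ?H * ?P"
  proof (cases "?P = 0")
    case True
    have "?F = 0"
    proof (rule ccontr)
      assume "?F \<noteq> 0"
      \<comment> \<open>With \<open>?P = 0\<close> the bound \<open>quad\<close> is affine in
        \<open>s\<close>, and this value of \<open>s\<close> turns it into
        \<open>?H + 1 \<le> ?H\<close>.\<close>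
      then show False using quad[of "(?H + 1) / (2 * ?F)"] True by simp
    qed
    then show ?thesis using True by simp
  next
    case False
    then have "?P > 0" using P by linarith
    \<comment> \<open>The multiple \<open>?F / ?P\<close> is the optimal one.\<close>
    then show ?thesis
      using quad[of "?F / ?P"] by (simp add: field_simps power2_eq_square)
  qed
  then have "sqrt (?F\<^sup>2) \<le> sqrt (?H * ?P)" by (rule real_sqrt_le_mono)
  then show ?thesis by (simp add: real_sqrt_mult)
qed

text \<open>Pairing the time derivative with \<open>h\<close> is one of the functionals that define
  weak convergence. It is linear although \<open>wderiv_on\<close> is a choice, because versions
  agree almost everywhere; Cauchy-Schwarz bounds it by the W^{1,2} norm.\<close>

lemma weakly_tendsto_W12_on_wderiv:
  fixes f :: "nat \<Rightarrow> real \<Rightarrow> 'b::{real_inner, banach, second_countable_topology}"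
  assumes weak: "weakly_tendsto_W12_on {a<..<b} f g" and h: "h square_integrable_on {a<..<b}"
  shows "(\<lambda>n. LINT t|lebesgue_on {a<..<b}. wderiv_on {a<..<b} (f n) t \<bullet> h t)
    \<longlonglongrightarrow> (LINT t|lebesgue_on {a<..<b}. wderiv_on {a<..<b} g t \<bullet> h t)"
proof -
  let ?S = "{a<..<b}"
  define F where "F = (\<lambda>v::real \<Rightarrow> 'b. LINT t|lebesgue_on ?S. wderiv_on ?S v t \<bullet> h t)"
  let ?C = "sqrt (LINT t|lebesgue_on ?S. (norm (h t))\<^sup>2)"
  have D: "weak_derivative_on ?S v (wderiv_on ?S v)" "wderiv_on ?S v square_integrable_on ?S" if "W12_on ?S v" for v :: "real \<Rightarrow> 'b"
    using that D12_on_wderiv_on by (auto simp: W12_on_def)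
  have lin: "F (\<lambda>t. c *\<^sub>R v t + d *\<^sub>R w t) = c * F v + d * F w" if v: "W12_on ?S v" and w: "W12_on ?S w" for v w c d
  proof -
    let ?l = "\<lambda>t. c *\<^sub>R v t + d *\<^sub>R w t"
    let ?l' = "\<lambda>t. c *\<^sub>R wderiv_on ?S v t + d *\<^sub>R wderiv_on ?S w t"
    have wl: "weak_derivative_on ?S ?l ?l'"
      by (rule weak_derivative_on_lincomb[OF D(1)[OF v] D(1)[OF w]]) simp
    have ae: "AE t in lebesgue_on ?S. wderiv_on ?S ?l t = ?l' t"
      by (rule weak_derivative_unique[OF wderiv_on_weak_derivative[OF wl] wl])
    have m: "wderiv_on ?S ?l \<in> borel_measurable (lebesgue_on ?S)"
      using wderiv_on_weak_derivative[OF wl] by (intro locally_integrable_imp_measurable) (simp add: weak_derivative_on_def)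
    have hm: "h \<in> borel_measurable (lebesgue_on ?S)" using h by (simp add: square_integrable_on_def)
    note i = square_integrable_inner[OF D(2)[OF v] h] square_integrable_inner[OF D(2)[OF w] h]
    have "F ?l = (LINT t|lebesgue_on ?S. c * (wderiv_on ?S v t \<bullet> h t) + d * (wderiv_on ?S w t \<bullet> h t))"
      unfolding F_def
    proof (rule integral_cong_AE)
      show "AE t in lebesgue_on ?S. wderiv_on ?S ?l t \<bullet> h t = c * (wderiv_on ?S v t \<bullet> h t) + d * (wderiv_on ?S w t \<bullet> h t)"
        using ae by eventually_elim (simp add: inner_add_left)
      show "(\<lambda>t. wderiv_on ?S ?l t \<bullet> h t) \<in> borel_measurable (lebesgue_on ?S)"
        using m hm by (rule borel_measurable_inner)
    qed (use i in auto)
    then show ?thesis using i by (simp add: F_def)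
  qed
  have bd: "\<bar>F v\<bar> \<le> ?C * W12_norm_on ?S v" if "W12_on ?S v" for v
  proof -
    have "\<bar>F v\<bar> \<le> ?C * sqrt (LINT t|lebesgue_on ?S. (norm (wderiv_on ?S v t))\<^sup>2)"
      unfolding F_def by (rule Cauchy_Schwarz_integral[OF D(2)[OF that] h])
    also have "\<dots> \<le> ?C * W12_norm_on ?S v"
      unfolding W12_norm_on_def by (intro mult_left_mono real_sqrt_le_mono) auto
    finally show ?thesis .
  qed
  have "(\<lambda>n. F (f n)) \<longlonglongrightarrow> F g"
    using weak lin bd unfolding weakly_tendsto_W12_on_def by blast
  then show ?thesis by (simp add: F_def)
qed

section \<open>Interpolated minimizing movements\<close>

text \<open>
  Writing the interpolation as a sum of clamped linear functions makes its continuity at the grid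
  points evident.
\<close>

lemma clamp_sum:
  fixes V :: "nat \<Rightarrow> 'a::real_vector"
  assumes "0 < \<tau>" "real j * \<tau> \<le> t" "t \<le> real (Suc j) * \<tau>" "j < m"
  shows "V 0 + (\<Sum>k<m. max 0 (min 1 ((t - real k * \<tau>) / \<tau>)) *\<^sub>R (V (Suc k) - V k)) =
    V j + ((t - real j * \<tau>) / \<tau>) *\<^sub>R (V (Suc j) - V j)"
proof -
  let ?c = "\<lambda>k. max 0 (min 1 ((t - real k * \<tau>) / \<tau>))"
  have hi: "?c k = 0" if "j < k" for k
  proof -
    have "real (Suc j) * \<tau> \<le> real k * \<tau>" using that assms(1) by (intro mult_right_mono) auto
    then have "t \<le> real k * \<tau>" using assms(3) by (rule order_trans[rotated])
    then have "(t - real k * \<tau>) / \<tau> \<le> 0" using assms(1) by (intro divide_nonpos_pos) auto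
    then show ?thesis by simp
  qed
  have lo: "?c k = 1" if "k < j" for k
  proof -
    have "real (Suc k) * \<tau> \<le> real j * \<tau>" using that assms(1) by (intro mult_right_mono) auto
    then have "real (Suc k) * \<tau> \<le> t" using assms(2) by (rule order_trans)
    then have "1 \<le> (t - real k * \<tau>) / \<tau>" using assms(1) by (simp add: field_simps)
    then show ?thesis by simp
  qed
  have mid: "?c j = (t - real j * \<tau>) / \<tau>"
    using assms(1-3) by (simp add: field_simps)
  \<comment> \<open>Cells after \<open>j\<close> contribute nothing; completed cells contribute
    whole increments, which telescope to \<open>V j - V 0\<close>.\<close>
  have "(\<Sum>k<m. ?c k *\<^sub>R (V (Suc k) - V k)) = (\<Sum>k<Suc j. ?c k *\<^sub>R (V (Suc k) - V k))"
    by (rule sum.mono_neutral_right) (use assms(4) hi in auto)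
  also have "\<dots> = (\<Sum>k<j. V (Suc k) - V k) + ((t - real j * \<tau>) / \<tau>) *\<^sub>R (V (Suc j) - V j)"
    by (simp add: lo mid)
  finally show ?thesis by (simp add: sum_lessThan_telescope)
qed

text \<open>The time derivative of the interpolant on the first \<open>m\<close> cells. The open
  cells leave the value 0 at grid points, a null set.\<close>

definition interpolation_slope :: "real \<Rightarrow> (nat \<Rightarrow> W22_0) \<Rightarrow> nat \<Rightarrow> real \<Rightarrow> L2" where
  "interpolation_slope \<tau> U m t = (\<Sum>k<m. indicat_real {real k * \<tau><..<real (Suc k) * \<tau>} t *\<^sub>R
     ((1 / \<tau>) *\<^sub>R (W22_0_to_L2 (U (Suc k)) - W22_0_to_L2 (U k))))"

lemma time_cell:
  assumes "0 < \<tau>" "0 < t" "t \<le> real m * \<tau>"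
  defines "j \<equiv> nat (\<lceil>t / \<tau>\<rceil> - 1)"
  shows "real j * \<tau> \<le> t" "t \<le> real (Suc j) * \<tau>" "j < m"
proof -
  have "0 < \<lceil>t / \<tau>\<rceil>" using assms by (simp add: zero_less_ceiling)
  then have j: "real j = of_int \<lceil>t / \<tau>\<rceil> - 1" by (simp add: j_def)
  have "real j < t / \<tau>" "t / \<tau> \<le> real (Suc j)" unfolding of_nat_Suc j by linarith+
  then show "real j * \<tau> \<le> t" "t \<le> real (Suc j) * \<tau>"
    using assms(1) by (simp_all add: pos_less_divide_eq pos_divide_le_eq)
  have "t / \<tau> \<le> real m" using assms(1,3) by (simp add: field_simps)
  then have "\<lceil>t / \<tau>\<rceil> \<le> int m" by (simp add: ceiling_le_iff)
  then show "j < m" using \<open>0 < \<lceil>t / \<tau>\<rceil>\<close> unfolding j_def by linarith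
qed

lemma W22_0_to_L2_interpolation:
  assumes "0 < \<tau>" "0 < t" "t \<le> real m * \<tau>"
  shows "W22_0_to_L2 (interpolation \<tau> U t) = W22_0_to_L2 (U 0) +
    (\<Sum>k<m. max 0 (min 1 ((t - real k * \<tau>) / \<tau>)) *\<^sub>R (W22_0_to_L2 (U (Suc k)) - W22_0_to_L2 (U k)))"
  using clamp_sum[OF assms(1) time_cell[OF assms], of "\<lambda>k. W22_0_to_L2 (U k)"] assms(2)
  by (simp add: interpolation_def Let_def plus_W22_0.rep_eq minus_W22_0.rep_eq scaleR_W22_0.rep_eq)

text \<open>The cells are closed on the right, so for \<open>0 < m\<close> this time lies in cell
  \<open>m - 1\<close> with weight 1.\<close>

lemma interpolation_grid:
  assumes "0 < \<tau>" "0 < m"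
  shows "interpolation \<tau> U (real m * \<tau>) = U m"
proof -
  have "nat (\<lceil>real m * \<tau> / \<tau>\<rceil> - 1) = m - 1" using assms by simp
  moreover have "(real m * \<tau> - real (m - 1) * \<tau>) / \<tau> = 1"
    using assms by (simp add: of_nat_diff field_simps)
  ultimately show ?thesis using assms by (simp add: interpolation_def Let_def mult_le_0_iff)
qed

lemma clamp_DERIV:
  fixes \<tau> :: real
  assumes "0 < \<tau>" "t \<noteq> s" "t \<noteq> s + \<tau>"
  shows "((\<lambda>t. max 0 (min 1 ((t - s) / \<tau>))) has_real_derivative indicat_real {s<..<s + \<tau>} t / \<tau>) (at t)"
proof -
  consider "t < s" | "t \<in> {s<..<s + \<tau>}" | "s + \<tau> < t" using assms by fastforce
  then show ?thesis
  proof cases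
    case 1
    have "((\<lambda>_. 0) has_real_derivative indicat_real {s<..<s + \<tau>} t / \<tau>) (at t)" using 1 by simp
    then show ?thesis
    proof (rule has_field_derivative_transform_within_open[where S = "{..<s}"])
      fix x assume "x \<in> {..<s}"
      then have "(x - s) / \<tau> \<le> 0" using assms(1) by (intro divide_nonpos_pos) auto
      then show "0 = max 0 (min 1 ((x - s) / \<tau>))" by simp
    qed (use 1 in auto)
  next
    case 2
    have "((\<lambda>t. (t - s) / \<tau>) has_real_derivative indicat_real {s<..<s + \<tau>} t / \<tau>) (at t)"
      using 2 by (auto intro!: derivative_eq_intros)
    then show ?thesis
    proof (rule has_field_derivative_transform_within_open[where S = "{s<..<s + \<tau>}"])
      fix x assume "x \<in> {s<..<s + \<tau>}"
      then show "(x - s) / \<tau> = max 0 (min 1 ((x - s) / \<tau>))" using assms(1) by (simp add: field_simps)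
    qed (use 2 in auto)
  next
    case 3
    have "((\<lambda>_. 1) has_real_derivative indicat_real {s<..<s + \<tau>} t / \<tau>) (at t)" using 3 by simp
    then show ?thesis
    proof (rule has_field_derivative_transform_within_open[where S = "{s + \<tau><..}"])
      fix x assume "x \<in> {s + \<tau><..}"
      then have "1 \<le> (x - s) / \<tau>" using assms(1) by (simp add: field_simps)
      then show "1 = max 0 (min 1 ((x - s) / \<tau>))" by simp
    qed (use 3 in auto)
  qed
qed

lemma integrable_indicator_lebesgue_on:
  "A \<in> sets borel \<Longrightarrow> integrable (lebesgue_on {0<..<T::real}) (indicat_real A)"
proof (rule finite_measure.integrable_const_bound[OF finite_measure_lebesgue_on, where B = 1])
  assume "A \<in> sets borel"
  then show "indicat_real A \<in> borel_measurable (lebesgue_on {0<..<T})"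
    by (intro borel_imp_lebesgue_on) simp
qed (auto simp: indicator_def)

text \<open>Paired with \<open>y\<close>, the interpolant agrees on the interval with a continuous
  piecewise linear real function, so integration by parts applies with the grid as exceptional
  set.\<close>

lemma weak_derivative_interpolation:
  assumes \<tau>: "0 < \<tau>" and T: "0 < T" "T \<le> real m * \<tau>"
    and li: "(\<lambda>t. W22_0_to_L2 (interpolation \<tau> U t) \<bullet> y) locally_integrable_on {0<..<T}"
  shows "weak_derivative_on {0<..<T} (\<lambda>t. W22_0_to_L2 (interpolation \<tau> U t) \<bullet> y)
    (\<lambda>t. interpolation_slope \<tau> U m t \<bullet> y)"
proof -
  let ?V = "\<lambda>k. W22_0_to_L2 (U k)"
  let ?a = "\<lambda>k. (?V (Suc k) - ?V k) \<bullet> y"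
  let ?f = "\<lambda>t. ?V 0 \<bullet> y + (\<Sum>k<m. max 0 (min 1 ((t - real k * \<tau>) / \<tau>)) * ?a k)"
  let ?f' = "\<lambda>t. \<Sum>k<m. indicat_real {real k * \<tau><..<real k * \<tau> + \<tau>} t / \<tau> * ?a k"
  have f: "W22_0_to_L2 (interpolation \<tau> U t) \<bullet> y = ?f t" if "t \<in> {0<..<T}" for t
    using W22_0_to_L2_interpolation[OF \<tau>, of t m U] that T by (simp add: inner_add_left inner_sum_left)
  have f': "interpolation_slope \<tau> U m t \<bullet> y = ?f' t" for t
  proof -
    have "real (Suc k) * \<tau> = real k * \<tau> + \<tau>" for k by (simp add: algebra_simps)
    then show ?thesis by (simp add: interpolation_slope_def inner_sum_left del: of_nat_Suc)
  qed
  have int: "integrable (lebesgue_on {0<..<T}) ?f'"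
    by (intro Bochner_Integration.integrable_sum integrable_mult_left integrable_divide
        integrable_indicator_lebesgue_on) simp
  have parts: "(LINT t|lebesgue_on {0<..<T}. deriv \<phi> t * ?f t) = - (LINT t|lebesgue_on {0<..<T}. \<phi> t * ?f' t)"
    if \<phi>: "test_function_on {0<..<T} \<phi>" for \<phi>
  \<comment> \<open>The grid points run up to \<open>m\<close> inclusive: the clamped function with
    index \<open>k\<close> has kinks at both ends of cell \<open>k\<close>, and the last cell ends
    at \<open>real m * \<tau>\<close>.\<close>
  proof (rule integration_by_parts_test[OF T(1) \<phi>, where K = "(\<lambda>k. real k * \<tau>) ` {..m}"])
    show "continuous_on {0..T} ?f" using \<tau> by (intro continuous_intros) auto
    fix t assume "t \<in> {0<..<T} - (\<lambda>k. real k * \<tau>) ` {..m}"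
    then have t: "t \<noteq> real k * \<tau>" if "k \<le> m" for k using that by auto
    have "(?f has_real_derivative 0 + ?f' t) (at t)"
    proof (intro DERIV_add DERIV_const DERIV_sum DERIV_cmult_right clamp_DERIV \<tau>)
      fix k assume "k \<in> {..<m}"
      then show "t \<noteq> real k * \<tau>" "t \<noteq> real k * \<tau> + \<tau>"
        using t[of k] t[of "Suc k"] by (auto simp: algebra_simps)
    qed
    then show "(?f has_real_derivative ?f' t) (at t)" by simp
  qed (use int in auto)
  show ?thesis
    unfolding weak_derivative_on_def
  proof (intro conjI li allI impI)
    show "(\<lambda>t. interpolation_slope \<tau> U m t \<bullet> y) locally_integrable_on {0<..<T}"
      unfolding f' by (rule integrable_imp_locally_integrable[OF int]) simp
    fix \<phi> assume \<phi>: "test_function_on {0<..<T} \<phi>"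
    have "(LINT t|lebesgue_on {0<..<T}. deriv \<phi> t *\<^sub>R (W22_0_to_L2 (interpolation \<tau> U t) \<bullet> y)) =
        (LINT t|lebesgue_on {0<..<T}. deriv \<phi> t * ?f t)"
      by (rule Bochner_Integration.integral_cong) (simp_all add: f)
    then show "(LINT t|lebesgue_on {0<..<T}. deriv \<phi> t *\<^sub>R (W22_0_to_L2 (interpolation \<tau> U t) \<bullet> y)) =
        - (LINT t|lebesgue_on {0<..<T}. \<phi> t *\<^sub>R (interpolation_slope \<tau> U m t \<bullet> y))"
      unfolding f' using parts[OF \<phi>] by simp
  qed
qed

text \<open>The cells are disjoint, so at most one summand is nonzero and the square may be taken
  term by term.\<close>

lemma norm_interpolation_slope:
  assumes \<tau>: "0 < \<tau>"
  shows "(norm (interpolation_slope \<tau> U m t))\<^sup>2 =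
    (\<Sum>k<m. indicat_real {real k * \<tau><..<real (Suc k) * \<tau>} t *
      ((norm (W22_0_to_L2 (U (Suc k)) - W22_0_to_L2 (U k)))\<^sup>2 / \<tau>\<^sup>2))"
proof -
  let ?I = "\<lambda>k. {real k * \<tau><..<real (Suc k) * \<tau>}"
  let ?D = "\<lambda>k. W22_0_to_L2 (U (Suc k)) - W22_0_to_L2 (U k)"
  show ?thesis
  proof (cases "\<exists>j<m. t \<in> ?I j")
    case True
    then obtain j where j: "j < m" "t \<in> ?I j" by blast
    have ind: "indicat_real (?I k) t = (if k = j then 1 else 0)" for k
    proof -
      have "t \<notin> ?I k" if "k \<noteq> j"
      proof
        assume "t \<in> ?I k"
        with j(2) have "real k * \<tau> < real (Suc j) * \<tau>" "real j * \<tau> < real (Suc k) * \<tau>"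
          unfolding greaterThanLessThan_iff by linarith+
        then have "k < Suc j" "j < Suc k" using \<tau> by (simp_all del: of_nat_Suc)
        then show False using that by simp
      qed
      then show ?thesis using j(2) by (simp add: indicator_def del: of_nat_Suc)
    qed
    have "interpolation_slope \<tau> U m t = (\<Sum>k<m. if k = j then (1 / \<tau>) *\<^sub>R ?D k else 0)"
      unfolding interpolation_slope_def ind by (rule sum.cong) simp_all
    then have "interpolation_slope \<tau> U m t = (1 / \<tau>) *\<^sub>R ?D j"
      using j(1) by simp
    moreover have "(\<Sum>k<m. indicat_real (?I k) t * ((norm (?D k))\<^sup>2 / \<tau>\<^sup>2)) =
        (\<Sum>k<m. if k = j then (norm (?D k))\<^sup>2 / \<tau>\<^sup>2 else 0)"
      unfolding ind by (rule sum.cong) simp_all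
    then have "(\<Sum>k<m. indicat_real (?I k) t * ((norm (?D k))\<^sup>2 / \<tau>\<^sup>2)) = (norm (?D j))\<^sup>2 / \<tau>\<^sup>2"
      using j(1) by simp
    ultimately show ?thesis by (simp add: power_divide)
  next
    case False
    then have "indicat_real (?I k) t = 0" if "k < m" for k
      using that by (auto simp: indicator_def)
    then show ?thesis by (simp add: interpolation_slope_def)
  qed
qed

text \<open>Only an inequality, since cells may reach beyond \<open>T\<close>: each contributes at
  most its length \<tau> times the squared slope.\<close>

lemma dissipation_interpolation_le:
  assumes \<tau>: "0 < \<tau>" and T: "0 < T" "T \<le> real m * \<tau>"
    and W: "W12_on {0<..<T} (\<lambda>t. W22_0_to_L2 (interpolation \<tau> U t))"
  shows "(LINT t|lebesgue_on {0<..<T}.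
      (norm (wderiv_on {0<..<T} (\<lambda>t. W22_0_to_L2 (interpolation \<tau> U t)) t))\<^sup>2) \<le>
    (\<Sum>k<m. (norm (W22_0_to_L2 (U (Suc k)) - W22_0_to_L2 (U k)))\<^sup>2 / \<tau>)"
proof -
  let ?S = "{0<..<T}"
  let ?f = "\<lambda>t. W22_0_to_L2 (interpolation \<tau> U t)"
  let ?I = "\<lambda>k. {real k * \<tau><..<real (Suc k) * \<tau>}"
  let ?c = "\<lambda>k. (norm (W22_0_to_L2 (U (Suc k)) - W22_0_to_L2 (U k)))\<^sup>2 / \<tau>\<^sup>2"
  have wd: "weak_derivative_on ?S ?f (wderiv_on ?S ?f)" "wderiv_on ?S ?f square_integrable_on ?S"
    using W D12_on_wderiv_on by (auto simp: W12_on_def)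
  have ae: "AE t in lebesgue_on ?S. wderiv_on ?S ?f t = interpolation_slope \<tau> U m t"
  proof (rule AE_eq_if_AE_inner_eq)
    fix y
    have wy: "weak_derivative_on ?S (\<lambda>t. ?f t \<bullet> y) (\<lambda>t. wderiv_on ?S ?f t \<bullet> y)"
      by (rule weak_derivative_on_inner[OF wd(1)]) simp
    then have "(\<lambda>t. ?f t \<bullet> y) locally_integrable_on ?S" by (simp add: weak_derivative_on_def)
    from weak_derivative_unique_real[OF wy weak_derivative_interpolation[OF \<tau> T this]]
    show "AE t in lebesgue_on ?S. wderiv_on ?S ?f t \<bullet> y = interpolation_slope \<tau> U m t \<bullet> y" .
  qed
  have int: "integrable (lebesgue_on ?S) (\<lambda>t. indicat_real (?I k) t * ?c k)" for k
    by (intro integrable_mult_left integrable_indicator_lebesgue_on) simp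
  have "(LINT t|lebesgue_on ?S. (norm (wderiv_on ?S ?f t))\<^sup>2) =
      (LINT t|lebesgue_on ?S. (\<Sum>k<m. indicat_real (?I k) t * ?c k))"
  proof (rule integral_cong_AE)
    show "AE t in lebesgue_on ?S. (norm (wderiv_on ?S ?f t))\<^sup>2 = (\<Sum>k<m. indicat_real (?I k) t * ?c k)"
      using ae by eventually_elim (simp only: norm_interpolation_slope[OF \<tau>])
    show "(\<lambda>t. (norm (wderiv_on ?S ?f t))\<^sup>2) \<in> borel_measurable (lebesgue_on ?S)"
      using wd(2) by (auto simp: square_integrable_on_def)
    show "(\<lambda>t. \<Sum>k<m. indicat_real (?I k) t * ?c k) \<in> borel_measurable (lebesgue_on ?S)"
      by (intro borel_measurable_sum borel_measurable_integrable int)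
  qed
  also have "\<dots> = (\<Sum>k<m. (LINT t|lebesgue_on ?S. indicat_real (?I k) t) * ?c k)"
    using int by (subst Bochner_Integration.integral_sum) auto
  also have "\<dots> \<le> (\<Sum>k<m. \<tau> * ?c k)"
  proof (intro sum_mono mult_right_mono)
    fix k
    have "(LINT t|lebesgue_on ?S. indicat_real (?I k) t) = measure (lebesgue_on ?S) (?I k \<inter> space (lebesgue_on ?S))"
      by simp
    also have "\<dots> = measure lebesgue (?I k \<inter> ?S)"
      by (subst measure_restrict_space) auto
    also have "\<dots> \<le> measure lebesgue (?I k)"
      by (rule measure_mono_fmeasurable) auto
    also have "\<dots> = \<tau>" using \<tau> by (simp add: algebra_simps)
    finally show "(LINT t|lebesgue_on ?S. indicat_real (?I k) t) \<le> \<tau>" .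
  qed simp
  also have "\<dots> = (\<Sum>k<m. (norm (W22_0_to_L2 (U (Suc k)) - W22_0_to_L2 (U k)))\<^sup>2 / \<tau>)"
    using \<tau> by (intro sum.cong) (simp_all add: power2_eq_square)
  finally show ?thesis .
qed

section \<open>The discrete energy inequality\<close>

lemma minimizing_movement_energy:
  assumes U: "minimizing_movement \<psi> u0 \<tau> U" and u0: "u0 \<in> admissible \<psi>"
  shows "energy (U m) + 1 / 2 * (\<Sum>k<m. (norm (W22_0_to_L2 (U (Suc k)) - W22_0_to_L2 (U k)))\<^sup>2 / \<tau>)
    \<le> energy u0"
proof (induction m)
  case 0
  then show ?case using U by (simp add: minimizing_movement_def)
next
  case (Suc m)
  \<comment> \<open>The predecessor may serve as a competitor: \<open>u0\<close> is admissible by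
    assumption, every later value as a minimizer.\<close>
  have "U m \<in> admissible \<psi>"
    using U u0 by (cases m) (auto simp: minimizing_movement_def is_arg_min_def)
  then have "energy (U (Suc m)) + 1 / (2 * \<tau>) * (norm (W22_0_to_L2 (U (Suc m)) - W22_0_to_L2 (U m)))\<^sup>2
      \<le> energy (U m)"
    using U unfolding minimizing_movement_def is_arg_min_linorder by (metis diff_self norm_zero power_zero_numeral mult_zero_right add_0_right)
  with Suc show ?case by (simp add: algebra_simps)
qed

section \<open>Passage to the limit\<close>

theorem lemma4p17:
  fixes \<psi> :: "real \<Rightarrow> real" and u0 :: W22_0 and u :: "real \<Rightarrow> W22_0" and T :: real
  assumes "obstacle \<psi>"
    and "u0 \<in> admissible \<psi>"
    and "energy u0 < c0\<^sup>2 / 4"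
    and "fvi_gradient_flow \<psi> u0 u"
    and "C1_continuous u"
    and "minimizing_movement_limit \<psi> u0 u"
    and "T > 0"
  shows "energy (u T) + 1 / 2 * (LINT t|lebesgue_on {0<..<T}. (norm (time_deriv u t))\<^sup>2) \<le> energy u0"
proof -
  let ?S = "{0<..<T}"
  let ?w = "\<lambda>v. L2_wderiv (W22_0_to_L2 v)"
  let ?u = "\<lambda>t. W22_0_to_L2 (u t)"
  obtain \<tau> U where \<tau>: "\<And>n. \<tau> n > 0" "\<tau> \<longlonglongrightarrow> 0" and U: "\<And>n. minimizing_movement \<psi> u0 (\<tau> n) (U n)"
    and weak: "weakly_tendsto_W12_on ?S (\<lambda>n t. W22_0_to_L2 (interpolation (\<tau> n) (U n) t)) ?u"
    and unif: "\<And>T. T > 0 \<Longrightarrow> uniform_limit {0..T}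
      (\<lambda>n t. C1_dist (interpolation (\<tau> n) (U n) t) (u t)) (\<lambda>_. 0) sequentially"
    using assms(6,7) unfolding minimizing_movement_limit_def by blast
  let ?f = "\<lambda>n t. W22_0_to_L2 (interpolation (\<tau> n) (U n) t)"
  \<comment> \<open>Rounding up makes the summed dissipation cover (0,T), and the overshoot is at
    most one step. That \<open>m n\<close> is positive is required to evaluate the interpolant at
    this grid time.\<close>
  define m where "m n = nat \<lceil>T / \<tau> n\<rceil>" for n
  have m_ge: "T \<le> real (m n) * \<tau> n" and m_le: "real (m n) * \<tau> n \<le> T + \<tau> n" and m_pos: "0 < m n" for n
  proof -
    have pos: "0 < T / \<tau> n" using \<tau>(1) \<open>T > 0\<close> by simp
    then have "real (m n) = of_int \<lceil>T / \<tau> n\<rceil>" by (simp add: m_def)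
    then have "T / \<tau> n \<le> real (m n)" "real (m n) \<le> T / \<tau> n + 1" by linarith+
    then show "T \<le> real (m n) * \<tau> n" "real (m n) * \<tau> n \<le> T + \<tau> n"
      using \<tau>(1)[of n] by (simp_all add: field_simps)
    show "0 < m n" using pos by (simp add: m_def zero_less_ceiling)
  qed
  define t where "t n = real (m n) * \<tau> n" for n
  have t_lim: "t \<longlonglongrightarrow> T"
  proof (rule tendsto_sandwich)
    show "(\<lambda>_. T) \<longlonglongrightarrow> T" by simp
    show "(\<lambda>n. T + \<tau> n) \<longlonglongrightarrow> T" using tendsto_add[OF tendsto_const \<tau>(2), of T] by simp
  qed (simp_all add: t_def m_ge m_le)
  have t0: "0 \<le> t n" for n using m_ge[of n] \<open>T > 0\<close> by (simp add: t_def)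

  \<comment> \<open>The discrete value at \<open>t n\<close> is compared with \<open>u (t n)\<close>
    by uniform convergence, and \<open>u (t n)\<close> with \<open>u T\<close> by continuity in
    time.\<close>
  have "(\<lambda>n. ?w (u (t n))) \<longlonglongrightarrow> ?w (u T)"
  proof -
    have "((\<lambda>s. ?w (u s) - ?w (u T)) \<longlongrightarrow> 0) (at T within {0..})"
      using assms(5) \<open>T > 0\<close> unfolding C1_continuous_def
      by (intro Lim_null_comparison[OF always_eventually[OF allI[OF norm_L2_wderiv_diff_le_C1_dist]]]) auto
    then have "continuous (at T within {0..}) (\<lambda>s. ?w (u s))"
      by (simp add: continuous_within LIM_zero_iff)
    then show ?thesis
      using t0 t_lim by (auto simp: continuous_within_sequentially o_def)
  qed
  moreover have "(\<lambda>n. ?w (U n (m n)) - ?w (u (t n))) \<longlonglongrightarrow> 0"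
  proof (rule tendstoI)
    \<comment> \<open>Since \<open>t n\<close> may exceed \<open>T\<close>, uniform convergence is
      used on the longer interval \<open>{0..T + 1}\<close>, which contains \<open>t n\<close>
      eventually.\<close>
    fix e :: real assume e: "e > 0"
    have "\<forall>\<^sub>F n in sequentially. t n < T + 1"
      using t_lim by (rule order_tendstoD) simp
    moreover have "\<forall>\<^sub>F n in sequentially. \<forall>s\<in>{0..T + 1}.
        dist (C1_dist (interpolation (\<tau> n) (U n) s) (u s)) 0 < e"
      using unif[of "T + 1"] \<open>T > 0\<close> e by (auto simp: uniform_limit_iff)
    ultimately show "\<forall>\<^sub>F n in sequentially. dist (?w (U n (m n)) - ?w (u (t n))) 0 < e"
    proof eventually_elim
      case (elim n)
      have "t n \<in> {0..T + 1}" using elim(1) t0[of n] by simp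
      with elim(2) have "dist (C1_dist (interpolation (\<tau> n) (U n) (t n)) (u (t n))) 0 < e" by blast
      moreover have "interpolation (\<tau> n) (U n) (t n) = U n (m n)"
        unfolding t_def by (rule interpolation_grid[OF \<tau>(1) m_pos])
      ultimately show ?case
        using norm_L2_wderiv_diff_le_C1_dist[of "U n (m n)" "u (t n)"] by simp
    qed
  qed
  ultimately have w_lim: "(\<lambda>n. ?w (U n (m n))) \<longlonglongrightarrow> ?w (u T)"
    using tendsto_add by fastforce

  have W: "W12_on ?S (?f n)" "W12_on ?S ?u" for n
    using weak by (auto simp: weakly_tendsto_W12_on_def)
  define h where "h = wderiv_on ?S ?u"
  have h: "weak_derivative_on ?S ?u h" "h square_integrable_on ?S"
    using W(2) D12_on_wderiv_on unfolding h_def by (auto simp: W12_on_def)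
  let ?H = "LINT s|lebesgue_on ?S. (norm (h s))\<^sup>2"
  have lim: "(\<lambda>n. LINT s|lebesgue_on ?S. wderiv_on ?S (?f n) s \<bullet> h s) \<longlonglongrightarrow> ?H"
    using weakly_tendsto_W12_on_wderiv[OF weak h(2)] by (simp add: h_def[symmetric] power2_norm_eq_inner)

  \<comment> \<open>Both squared norms are replaced by lower bounds affine in the converging
    quantities, so every term has a limit. In time the limit derivative \<open>h\<close> is itself
    allowed as comparison function, which leaves exactly \<open>?H\<close>; in space only test
    functions are allowed.\<close>
  have test: "2 * (abs_L2 \<phi> \<bullet> flux (u T)) - (norm (abs_L2 \<phi>))\<^sup>2 + 1 / 2 * ?H \<le> energy u0"
    if \<phi>: "test_function_on {0<..<1} \<phi>" for \<phi>
  proof -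
    let ?v = "abs_L2 \<phi>"
    have "(\<lambda>n. 2 * (?v \<bullet> flux (U n (m n))) - (norm ?v)\<^sup>2 +
        1 / 2 * (2 * (LINT s|lebesgue_on ?S. wderiv_on ?S (?f n) s \<bullet> h s) - ?H)) \<longlonglongrightarrow>
      2 * (?v \<bullet> flux (u T)) - (norm ?v)\<^sup>2 + 1 / 2 * (2 * ?H - ?H)"
      by (intro tendsto_intros tendsto_test_inner_flux[OF \<phi> w_lim] lim)
    moreover have "2 * (?v \<bullet> flux (U n (m n))) - (norm ?v)\<^sup>2 +
        1 / 2 * (2 * (LINT s|lebesgue_on ?S. wderiv_on ?S (?f n) s \<bullet> h s) - ?H) \<le> energy u0" for n
    proof -
      have "0 \<le> (flux (U n (m n)) - ?v) \<bullet> (flux (U n (m n)) - ?v)" by simp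
      then have "2 * (?v \<bullet> flux (U n (m n))) - (norm ?v)\<^sup>2 \<le> energy (U n (m n))"
        by (simp add: energy_eq_norm_flux power2_norm_eq_inner inner_diff_left inner_diff_right inner_commute)
      moreover have "2 * (LINT s|lebesgue_on ?S. wderiv_on ?S (?f n) s \<bullet> h s) - ?H \<le>
          (LINT s|lebesgue_on ?S. (norm (wderiv_on ?S (?f n) s))\<^sup>2)"
        using W(1) D12_on_wderiv_on(2) by (intro integral_inner_le_norms h(2)) (auto simp: W12_on_def)
      moreover note dissipation_interpolation_le[OF \<tau>(1) \<open>T > 0\<close> m_ge W(1), of n]
        minimizing_movement_energy[OF U assms(2), of n "m n"]
      moreover have "a + 1 / 2 * b \<le> E" if "a \<le> e" "b \<le> p" "p \<le> q" "e + 1 / 2 * q \<le> E" for a b e p q E :: real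
        using that by linarith
      ultimately show ?thesis by blast
    qed
    ultimately have "2 * (?v \<bullet> flux (u T)) - (norm ?v)\<^sup>2 + 1 / 2 * (2 * ?H - ?H) \<le> energy u0"
      by (intro LIMSEQ_le_const2) auto
    then show ?thesis by simp
  qed
  \<comment> \<open>The optimal comparison \<open>flux (u T)\<close> need not come from a test
    function. It is approached in L^2, where the bound \<open>test\<close> depends continuously on
    the comparison.\<close>
  obtain \<phi> where \<phi>: "\<And>n. test_function_on {0<..<1} (\<phi> n)" "(\<lambda>n. abs_L2 (\<phi> n)) \<longlonglongrightarrow> flux (u T)"
    using L2_approx_test_functions by blast
  have "(\<lambda>n. 2 * (abs_L2 (\<phi> n) \<bullet> flux (u T)) - (norm (abs_L2 (\<phi> n)))\<^sup>2 + 1 / 2 * ?H) \<longlonglongrightarrow>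
      2 * (flux (u T) \<bullet> flux (u T)) - (norm (flux (u T)))\<^sup>2 + 1 / 2 * ?H"
    by (intro tendsto_intros \<phi>)
  then have "2 * (flux (u T) \<bullet> flux (u T)) - (norm (flux (u T)))\<^sup>2 + 1 / 2 * ?H \<le> energy u0"
    by (rule LIMSEQ_le_const2) (use test[OF \<phi>(1)] in auto)
  then have main: "energy (u T) + 1 / 2 * ?H \<le> energy u0"
    by (simp add: energy_eq_norm_flux power2_norm_eq_inner)

  \<comment> \<open>\<open>time_deriv u\<close> is selected on \<open>{0<..}\<close> and
    \<open>h\<close> on \<open>{0<..<T}\<close>: two separate choices, which agree almost everywhere
    on the smaller interval.\<close>
  have "weak_derivative_on {0<..} ?u (time_deriv u)"
    using assms(6) wderiv_on_weak_derivative unfolding minimizing_movement_limit_def D12_on_def by blast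
  then have td: "weak_derivative_on ?S ?u (time_deriv u)"
    by (rule weak_derivative_on_mono) auto
  have "(LINT s|lebesgue_on ?S. (norm (time_deriv u s))\<^sup>2) = ?H"
  proof (rule integral_cong_AE)
    show "AE s in lebesgue_on ?S. (norm (time_deriv u s))\<^sup>2 = (norm (h s))\<^sup>2"
      using weak_derivative_unique[OF td h(1)] by eventually_elim simp
    have "time_deriv u \<in> borel_measurable (lebesgue_on ?S)"
      using td by (intro locally_integrable_imp_measurable) (simp add: weak_derivative_on_def)
    then show "(\<lambda>s. (norm (time_deriv u s))\<^sup>2) \<in> borel_measurable (lebesgue_on ?S)" by measurable
    show "(\<lambda>s. (norm (h s))\<^sup>2) \<in> borel_measurable (lebesgue_on ?S)"
      using h(2) by (auto simp: square_integrable_on_def)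
  qed
  then show ?thesis using main by simp
qed

end
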